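(* Let $\Omega\subset\mathbf{R}^d$ be open. For all $i,j\in\{1,\ldots,d\}$ let $a_{ij}\in L_\infty(\Omega)$ (complex valued). Let $\theta\in[0,\frac\pi2)$ and suppose $\sum_{i,j=1}^d a_{ij}(x)\,\xi_i\,\overline{\xi_j}\in\Sigma_\theta$ for all $\xi\in\mathbf{C}^d$ and a.e. $x\in\Omega$. Define the form $a\colon D(a)\times D(a)\to\mathbf{C}$ by $a(u,v)=\sum_{i,j=1}^d\int_\Omega(\partial_iu)\,a_{ij}\,\overline{\partial_jv}$, where $D(a)$ is a subspace of $H^1(\Omega)$ with $C_c^\infty(\Omega)\subset D(a)$, and suppose $e^{\rho\psi}u\in D(a)$ for all $u\in D(a)$, $\rho\in\mathbf{R}$ and $\psi\in C_{\rm b}^\infty(\mathbf{R}^d,\mathbf{R})$. Let $\overline{a_r}$ be the relaxed form of $a$. Then $\overline{a_r}(u,v)=0$ for all $u,v\in D(\overline{a_r})$ with disjoint compact supports.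
   Context: $\Sigma_\theta=\{re^{i\alpha}:r\ge0,\ |\alpha|\le\theta\}$. $C_{\rm b}^\infty(\mathbf{R}^d,\mathbf{R})$ is the space of smooth real functions on $\mathbf{R}^d$ that are bounded together with all derivatives. The form $a$ is densely defined and sectorial in $L_2(\Omega)$ with vertex $0$ (possibly not closable). The operator $A$ associated with $a$ is the well-defined $m$-sectorial operator in $L_2(\Omega)$ such that $x\in D(A)$ and $Ax=f$ if and only if there exist $u_1,u_2,\ldots\in D(a)$ with $(\operatorname{Re}a(u_n,u_n))_n$ bounded, $u_n\to x$ in $L_2(\Omega)$ and $a(u_n,v)\to(f,v)_{L_2(\Omega)}$ for all $v\in D(a)$. The regular part $a_r$ of $a$ is the unique closable sectorial form with form domain $D(a)$ such that $A$ is associated (in Kato's classical sense) with its closure $\overline{a_r}$; the closed sectorial form $\overline{a_r}$ is called the relaxed form of $a$. Thus $\overline{a_r}$ is the closed sectorial form in $L_2(\Omega)$ classically associated with the $m$-sectorial operator $A$. *)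

theory Defs
  imports "HOL-Analysis.Analysis"
begin

section \<open>The Hilbert space L2 of an open set\<close>

text \<open>Elements of \<open>L_2(\<Omega>)\<close> are represented by functions on the whole space, taken modulo equality
  almost everywhere on \<open>\<Omega>\<close>; values outside \<open>\<Omega>\<close> play no role.  Subspaces are therefore required
  to be saturated, and forms to respect almost-everywhere equality.\<close>

type_synonym 'd cfun = "real^'d \<Rightarrow> complex"

definition L2 :: "(real^'d::finite) set \<Rightarrow> 'd cfun set" where
  "L2 \<Omega> = {u \<in> borel_measurable (lebesgue_on \<Omega>). integrable (lebesgue_on \<Omega>) (\<lambda>x. (norm (u x))\<^sup>2)}"

definition L2_inner :: "(real^'d::finite) set \<Rightarrow> 'd cfun \<Rightarrow> 'd cfun \<Rightarrow> complex" where
  "L2_inner \<Omega> u v = (LINT x|lebesgue_on \<Omega>. u x * cnj (v x))"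

definition L2_norm :: "(real^'d::finite) set \<Rightarrow> 'd cfun \<Rightarrow> real" where
  "L2_norm \<Omega> u = sqrt (LINT x|lebesgue_on \<Omega>. (norm (u x))\<^sup>2)"

definition ae_eq :: "(real^'d::finite) set \<Rightarrow> 'd cfun \<Rightarrow> 'd cfun \<Rightarrow> bool" where
  "ae_eq \<Omega> u v \<longleftrightarrow> (AE x in lebesgue_on \<Omega>. u x = v x)"

definition L2_subspace :: "(real^'d::finite) set \<Rightarrow> 'd cfun set \<Rightarrow> bool" where
  "L2_subspace \<Omega> D \<longleftrightarrow>
     D \<subseteq> L2 \<Omega> \<and>
     (\<lambda>x. 0) \<in> D \<and>
     (\<forall>u\<in>D. \<forall>v\<in>D. (\<lambda>x. u x + v x) \<in> D) \<and>
     (\<forall>c. \<forall>u\<in>D. (\<lambda>x. c * u x) \<in> D) \<and>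
     (\<forall>u\<in>D. \<forall>v\<in>L2 \<Omega>. ae_eq \<Omega> u v \<longrightarrow> v \<in> D)"

text \<open>The support of (the class of) \<open>u\<close>: the complement in \<open>\<Omega>\<close> of the largest open subset of \<open>\<Omega>\<close>
  on which \<open>u\<close> vanishes almost everywhere.\<close>

definition ess_support :: "(real^'d::finite) set \<Rightarrow> 'd cfun \<Rightarrow> (real^'d) set" where
  "ess_support \<Omega> u = \<Omega> - \<Union>{U. open U \<and> U \<subseteq> \<Omega> \<and> ae_eq U u (\<lambda>x. 0)}"


section \<open>Smooth functions\<close>

definition partial :: "'d::finite \<Rightarrow> (real^'d \<Rightarrow> 'b::real_normed_vector) \<Rightarrow> real^'d \<Rightarrow> 'b" where
  "partial i f x = frechet_derivative f (at x) (axis i 1)"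

text \<open>\<open>iter_partial [i1, ..., ik] f\<close> is the iterated partial derivative of \<open>f\<close> of order \<open>k\<close> in the
  directions \<open>i1, ..., ik\<close>.  If all of these are (totally) differentiable everywhere, they are all
  continuous, so this is the usual notion of a \<open>C\<^sup>\<infinity>\<close> function.\<close>

primrec iter_partial ::
    "'d::finite list \<Rightarrow> (real^'d \<Rightarrow> 'b::real_normed_vector) \<Rightarrow> real^'d \<Rightarrow> 'b" where
  "iter_partial [] f = f"
| "iter_partial (i # is) f = partial i (iter_partial is f)"

definition smooth :: "(real^'d::finite \<Rightarrow> 'b::real_normed_vector) \<Rightarrow> bool" where
  "smooth f \<longleftrightarrow> (\<forall>is x. iter_partial is f differentiable (at x))"

definition Cb_infty :: "(real^'d::finite \<Rightarrow> real) set" where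
  "Cb_infty = {\<psi>. smooth \<psi> \<and> (\<forall>is. bounded (range (iter_partial is \<psi>)))}"

definition Cc_infty :: "(real^'d::finite) set \<Rightarrow> 'd cfun set" where
  "Cc_infty \<Omega> = {\<phi>. smooth \<phi> \<and> compact (closure {x. \<phi> x \<noteq> 0}) \<and> closure {x. \<phi> x \<noteq> 0} \<subseteq> \<Omega>}"


section \<open>The Sobolev space H1\<close>

definition is_weak_partial :: "(real^'d::finite) set \<Rightarrow> 'd \<Rightarrow> 'd cfun \<Rightarrow> 'd cfun \<Rightarrow> bool" where
  "is_weak_partial \<Omega> i u g \<longleftrightarrow>
     (\<forall>\<phi>\<in>Cc_infty \<Omega>. (LINT x|lebesgue_on \<Omega>. u x * partial i \<phi> x) =
                     - (LINT x|lebesgue_on \<Omega>. g x * \<phi> x))"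

definition H1 :: "(real^'d::finite) set \<Rightarrow> 'd cfun set" where
  "H1 \<Omega> = {u \<in> L2 \<Omega>. \<forall>i. \<exists>g\<in>L2 \<Omega>. is_weak_partial \<Omega> i u g}"

text \<open>A representative of the weak derivative, which is unique almost everywhere on \<open>\<Omega>\<close>.\<close>

definition weak_partial :: "(real^'d::finite) set \<Rightarrow> 'd \<Rightarrow> 'd cfun \<Rightarrow> 'd cfun" where
  "weak_partial \<Omega> i u = (SOME g. g \<in> L2 \<Omega> \<and> is_weak_partial \<Omega> i u g)"


section \<open>Sectorial forms\<close>

definition sector :: "real \<Rightarrow> complex set" where
  "sector \<theta> = {of_real r * exp (\<i> * of_real \<alpha>) | r \<alpha>. 0 \<le> r \<and> \<bar>\<alpha>\<bar> \<le> \<theta>}"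

text \<open>A form in \<open>L_2(\<Omega>)\<close> is given by its domain \<open>D\<close> and a function \<open>b\<close> of which only the values on
  \<open>D \<times> D\<close> are relevant.\<close>

type_synonym 'd form = "'d cfun \<Rightarrow> 'd cfun \<Rightarrow> complex"

definition sesquilinear_form :: "(real^'d::finite) set \<Rightarrow> 'd cfun set \<Rightarrow> 'd form \<Rightarrow> bool" where
  "sesquilinear_form \<Omega> D b \<longleftrightarrow>
     L2_subspace \<Omega> D \<and>
     (\<forall>u\<in>D. \<forall>u'\<in>D. \<forall>v\<in>D. \<forall>v'\<in>D. ae_eq \<Omega> u u' \<longrightarrow> ae_eq \<Omega> v v' \<longrightarrow> b u v = b u' v') \<and>
     (\<forall>u\<in>D. \<forall>u'\<in>D. \<forall>v\<in>D. b (\<lambda>x. u x + u' x) v = b u v + b u' v) \<and>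
     (\<forall>u\<in>D. \<forall>v\<in>D. \<forall>v'\<in>D. b u (\<lambda>x. v x + v' x) = b u v + b u v') \<and>
     (\<forall>c. \<forall>u\<in>D. \<forall>v\<in>D. b (\<lambda>x. c * u x) v = c * b u v) \<and>
     (\<forall>c. \<forall>u\<in>D. \<forall>v\<in>D. b u (\<lambda>x. c * v x) = cnj c * b u v)"

text \<open>Sectorial in the sense of Kato, with an arbitrary real vertex \<open>\<gamma>\<close>.\<close>

definition sectorial_form :: "(real^'d::finite) set \<Rightarrow> 'd cfun set \<Rightarrow> 'd form \<Rightarrow> bool" where
  "sectorial_form \<Omega> D b \<longleftrightarrow>
     sesquilinear_form \<Omega> D b \<and>
     (\<exists>\<theta> \<gamma>. 0 \<le> \<theta> \<and> \<theta> < pi / 2 \<and>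
        (\<forall>u\<in>D. b u u - of_real (\<gamma> * (L2_norm \<Omega> u)\<^sup>2) \<in> sector \<theta>))"

text \<open>Kato's \<open>b\<close>-convergence of a sequence in the form domain to an element of \<open>L_2(\<Omega>)\<close>.\<close>

definition form_converges ::
    "(real^'d::finite) set \<Rightarrow> 'd cfun set \<Rightarrow> 'd form \<Rightarrow> (nat \<Rightarrow> 'd cfun) \<Rightarrow> 'd cfun \<Rightarrow> bool" where
  "form_converges \<Omega> D b w u \<longleftrightarrow>
     (\<forall>n. w n \<in> D) \<and> u \<in> L2 \<Omega> \<and>
     (\<lambda>n. L2_norm \<Omega> (\<lambda>x. w n x - u x)) \<longlonglongrightarrow> 0 \<and>
     ((\<lambda>(n, m). b (\<lambda>x. w n x - w m x) (\<lambda>x. w n x - w m x)) \<longlongrightarrow> 0) (sequentially \<times>\<^sub>F sequentially)"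

definition closed_sectorial_form :: "(real^'d::finite) set \<Rightarrow> 'd cfun set \<Rightarrow> 'd form \<Rightarrow> bool" where
  "closed_sectorial_form \<Omega> D b \<longleftrightarrow>
     sectorial_form \<Omega> D b \<and>
     (\<forall>w u. form_converges \<Omega> D b w u \<longrightarrow>
        u \<in> D \<and> (\<lambda>n. b (\<lambda>x. w n x - u x) (\<lambda>x. w n x - u x)) \<longlonglongrightarrow> 0)"

definition form_extends :: "'d cfun set \<Rightarrow> 'd form \<Rightarrow> 'd cfun set \<Rightarrow> 'd form \<Rightarrow> bool" where
  "form_extends D' b' D b \<longleftrightarrow> D \<subseteq> D' \<and> (\<forall>u\<in>D. \<forall>v\<in>D. b' u v = b u v)"

definition closable_sectorial_form :: "(real^'d::finite) set \<Rightarrow> 'd cfun set \<Rightarrow> 'd form \<Rightarrow> bool" where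
  "closable_sectorial_form \<Omega> D b \<longleftrightarrow>
     sectorial_form \<Omega> D b \<and> (\<exists>D' b'. closed_sectorial_form \<Omega> D' b' \<and> form_extends D' b' D b)"

text \<open>The closure is the smallest closed extension.\<close>

definition is_form_closure ::
    "(real^'d::finite) set \<Rightarrow> 'd cfun set \<Rightarrow> 'd form \<Rightarrow> 'd cfun set \<Rightarrow> 'd form \<Rightarrow> bool" where
  "is_form_closure \<Omega> D b D' b' \<longleftrightarrow>
     closed_sectorial_form \<Omega> D' b' \<and> form_extends D' b' D b \<and>
     (\<forall>D'' b''. closed_sectorial_form \<Omega> D'' b'' \<longrightarrow> form_extends D'' b'' D b \<longrightarrow>
        form_extends D'' b'' D' b')"


section \<open>Associated operators and the relaxed form\<close>

text \<open>Operators in \<open>L_2(\<Omega>)\<close> are represented by their graphs.  The first one is the operator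
  associated with a sectorial form that need not be closable, the second one is the operator
  classically associated with a closed sectorial form.\<close>

definition form_operator ::
    "(real^'d::finite) set \<Rightarrow> 'd cfun set \<Rightarrow> 'd form \<Rightarrow> ('d cfun \<times> 'd cfun) set" where
  "form_operator \<Omega> D a = {(x, f). x \<in> L2 \<Omega> \<and> f \<in> L2 \<Omega> \<and>
     (\<exists>u. (\<forall>n. u n \<in> D) \<and>
          bounded (range (\<lambda>n. Re (a (u n) (u n)))) \<and>
          (\<lambda>n. L2_norm \<Omega> (\<lambda>y. u n y - x y)) \<longlonglongrightarrow> 0 \<and>
          (\<forall>v\<in>D. (\<lambda>n. a (u n) v) \<longlonglongrightarrow> L2_inner \<Omega> f v))}"

definition kato_operator ::
    "(real^'d::finite) set \<Rightarrow> 'd cfun set \<Rightarrow> 'd form \<Rightarrow> ('d cfun \<times> 'd cfun) set" where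
  "kato_operator \<Omega> D b = {(x, f). x \<in> D \<and> f \<in> L2 \<Omega> \<and> (\<forall>v\<in>D. b x v = L2_inner \<Omega> f v)}"

definition is_regular_part ::
    "(real^'d::finite) set \<Rightarrow> 'd cfun set \<Rightarrow> 'd form \<Rightarrow> 'd form \<Rightarrow> bool" where
  "is_regular_part \<Omega> D a r \<longleftrightarrow>
     closable_sectorial_form \<Omega> D r \<and>
     (\<exists>D' b'. is_form_closure \<Omega> D r D' b' \<and> kato_operator \<Omega> D' b' = form_operator \<Omega> D a)"

definition is_relaxed_form ::
    "(real^'d::finite) set \<Rightarrow> 'd cfun set \<Rightarrow> 'd form \<Rightarrow> 'd cfun set \<Rightarrow> 'd form \<Rightarrow> bool" where
  "is_relaxed_form \<Omega> D a D' b' \<longleftrightarrow>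
     (\<exists>r. is_regular_part \<Omega> D a r \<and> is_form_closure \<Omega> D r D' b')"


section \<open>Second-order differential forms in divergence form\<close>

definition L_infty :: "(real^'d::finite) set \<Rightarrow> 'd cfun set" where
  "L_infty \<Omega> = {f \<in> borel_measurable (lebesgue_on \<Omega>). \<exists>C. AE x in lebesgue_on \<Omega>. norm (f x) \<le> C}"

definition div_form :: "(real^'d::finite) set \<Rightarrow> ('d \<Rightarrow> 'd \<Rightarrow> 'd cfun) \<Rightarrow> 'd form" where
  "div_form \<Omega> c u v =
     (\<Sum>i\<in>UNIV. \<Sum>j\<in>UNIV.
        LINT x|lebesgue_on \<Omega>. weak_partial \<Omega> i u x * c i j x * cnj (weak_partial \<Omega> j v x))"

end

theory Submission
  imports Defs
begin

text \<open>
  Write \<open>A\<close> for the operator associated with the form.  For \<open>u\<close> in the domain of the relaxed form the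
  vectors \<open>\<lambda> (\<lambda> + A)\<^sup>-\<^sup>1 u\<close> stay bounded in the form norm and converge to \<open>u\<close> in \<open>L\<^sub>2\<close>, hence
  converge weakly in the form domain as \<open>\<lambda> \<rightarrow> \<infinity>\<close>.  If \<open>(u, v) = 0\<close>, evaluating the relaxed form at
  them and \<open>v\<close> gives \<open>- \<lambda>\<^sup>2 ((\<lambda> + A)\<^sup>-\<^sup>1 u, v)\<close>.  Davies' trick of testing the resolvent
  equation, which is accessible through the original form, with \<open>exp (s \<psi>)\<close> times the solution, where
  \<open>\<psi>\<close> vanishes on the support of \<open>u\<close> and is positive on that of \<open>v\<close>, bounds this quantity by a
  multiple of \<open>\<lambda> exp (- \<kappa> sqrt \<lambda>)\<close>.  Using resolvents instead of the semigroup keeps the argument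
  within Lax--Milgram theory.
\<close>

section \<open>Sectorial sesquilinear forms on spaces of functions\<close>

text \<open>The form itself may fail to be closable, so the completion of \<open>Da\<close> need not
  embed in \<open>L2\<close>, and the resolvent equation need have no exact solution in
  \<open>Da\<close>. What is available is a sequence in \<open>Da\<close> that solves it with
  residual tending to zero in the dual form norm and that converges in \<open>L2\<close>; this is
  what the definition of the associated operator asks for. The weighted estimate therefore has to be
  proved for the approximants, and must survive a limit taken in \<open>L2\<close> only. It does,
  because Davies' bound removes the form from the inequality and leaves weighted \<open>L2\<close>
  quantities. On the other side the relaxed form is known only through its operator, so it can be
  computed only at resolvent vectors. The rate comes from a balance: a weight
  \<open>exp (s * \<psi>)\<close> costs \<open>M * s^2\<close> against the resolvent parameter, so
  \<open>s\<close> may grow like its square root, and the resulting factor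
  \<open>exp (- \<kappa> * sqrt l)\<close> beats every power of \<open>l\<close>.\<close>

lemma scaled_am_gm:
  fixes p b c :: real
  assumes "0 \<le> b" "0 \<le> c" and H: "\<And>t. t > 0 \<Longrightarrow> p \<le> t\<^sup>2 * b\<^sup>2 + c\<^sup>2 / t\<^sup>2"
  shows "p \<le> 2 * b * c"
proof (rule field_le_epsilon)
  fix e :: real assume e: "e > 0"
  define d where "d = e / (b + c + 1)"
  have d: "0 < d" "d * (b + c + 1) = e"
    using e assms(1,2) by (auto simp: d_def field_simps)
  \<comment> \<open>The minimum over \<open>t\<close> is attained at \<open>t^2 = c / b\<close>; the
    shift by \<open>d\<close> keeps \<open>t\<close> positive and finite when \<open>b\<close> or
    \<open>c\<close> vanishes, at the price of an error of at most \<open>e\<close>.\<close>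
  define t where "t = sqrt ((c + d) / (b + d))"
  have t: "t > 0" "t\<^sup>2 = (c + d) / (b + d)"
    using d assms(1,2) by (auto simp: t_def)
  have 1: "t\<^sup>2 * b\<^sup>2 \<le> (c + d) * b"
  proof -
    have "t\<^sup>2 * b\<^sup>2 = (c + d) * b * (b / (b + d))" unfolding t by (simp add: power2_eq_square)
    also have "\<dots> \<le> (c + d) * b * 1"
      using assms d by (intro mult_left_mono) (auto simp: divide_simps)
    finally show ?thesis by simp
  qed
  have 2: "c\<^sup>2 / t\<^sup>2 \<le> (b + d) * c"
  proof -
    have "c\<^sup>2 / t\<^sup>2 = (b + d) * c * (c / (c + d))" unfolding t by (simp add: power2_eq_square)
    also have "\<dots> \<le> (b + d) * c * 1"
      using assms d by (intro mult_left_mono) (auto simp: divide_simps)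
    finally show ?thesis by simp
  qed
  have "p \<le> (c + d) * b + (b + d) * c" using H[OF t(1)] 1 2 by linarith
  also have "\<dots> = 2 * b * c + d * (b + c)" by (simp add: algebra_simps)
  also have "d * (b + c) \<le> e" using d by (simp add: algebra_simps)
  finally show "p \<le> 2 * b * c + e" by simp
qed

text \<open>Forms here are linear in the first and antilinear in the second argument, so this is the
  class of the functionals \<open>b u\<close> and of right-hand sides
  \<open>L2_inner \<Omega> f\<close>.\<close>

definition antilinear_on :: "('x \<Rightarrow> complex) set \<Rightarrow> (('x \<Rightarrow> complex) \<Rightarrow> complex) \<Rightarrow> bool" where
  "antilinear_on D g \<longleftrightarrow>
     (\<forall>u\<in>D. \<forall>v\<in>D. g (\<lambda>x. u x + v x) = g u + g v) \<and>
     (\<forall>s. \<forall>u\<in>D. g (\<lambda>x. s * u x) = cnj s * g u)"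

text \<open>Vectors are complex functions on an arbitrary type, so that one theory covers three
  cases: \<open>L2 \<Omega>\<close> with its inner product, the domain of a form on
  \<open>\<Omega>\<close>, and coordinate vectors indexed by \<open>'d\<close> at a single
  point.\<close>

locale sesquilinear =
  fixes D :: "('x \<Rightarrow> complex) set" and a :: "('x \<Rightarrow> complex) \<Rightarrow> ('x \<Rightarrow> complex) \<Rightarrow> complex"
  assumes nonempty: "D \<noteq> {}"
    and add_mem: "u \<in> D \<Longrightarrow> v \<in> D \<Longrightarrow> (\<lambda>x. u x + v x) \<in> D"
    and scale_mem: "u \<in> D \<Longrightarrow> (\<lambda>x. s * u x) \<in> D"
    and add_left: "u \<in> D \<Longrightarrow> u' \<in> D \<Longrightarrow> v \<in> D \<Longrightarrow> a (\<lambda>x. u x + u' x) v = a u v + a u' v"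
    and add_right: "u \<in> D \<Longrightarrow> v \<in> D \<Longrightarrow> v' \<in> D \<Longrightarrow> a u (\<lambda>x. v x + v' x) = a u v + a u v'"
    and scale_left: "u \<in> D \<Longrightarrow> v \<in> D \<Longrightarrow> a (\<lambda>x. s * u x) v = s * a u v"
    and scale_right: "u \<in> D \<Longrightarrow> v \<in> D \<Longrightarrow> a u (\<lambda>x. s * v x) = cnj s * a u v"
begin

lemma zero_mem: "(\<lambda>x. 0) \<in> D"
  using nonempty scale_mem[of _ 0] by auto

lemma diff_mem: "u \<in> D \<Longrightarrow> v \<in> D \<Longrightarrow> (\<lambda>x. u x - v x) \<in> D"
  using add_mem[of u "\<lambda>x. (-1) * v x"] scale_mem[of v "-1"] by simp

lemma diff_left: "u \<in> D \<Longrightarrow> u' \<in> D \<Longrightarrow> v \<in> D \<Longrightarrow> a (\<lambda>x. u x - u' x) v = a u v - a u' v"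
  using add_left[of u "\<lambda>x. (-1) * u' x" v] scale_mem[of u' "-1"] scale_left[of u' v "-1"] by simp

lemma diff_right: "u \<in> D \<Longrightarrow> v \<in> D \<Longrightarrow> v' \<in> D \<Longrightarrow> a u (\<lambda>x. v x - v' x) = a u v - a u v'"
  using add_right[of u v "\<lambda>x. (-1) * v' x"] scale_mem[of v' "-1"] scale_right[of u v' "-1"] by simp

lemma zero_left: "v \<in> D \<Longrightarrow> a (\<lambda>x. 0) v = 0"
  using scale_left[of v v 0] by simp

lemmas closure_rules = add_mem scale_mem diff_mem zero_mem
lemmas sesq_rules = add_left add_right diff_left diff_right scale_left scale_right

end

text \<open>The sector is encoded by the tangent \<open>T\<close> of its half-angle. Nothing forces
  \<open>Re (a u u)\<close> to be positive for nonzero \<open>u\<close>, so \<open>qnorm\<close>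
  below is only a seminorm; this allows degenerate coefficients and functions that vanish almost
  everywhere.\<close>

locale sectorial = sesquilinear +
  fixes T :: real
  assumes T_nonneg: "0 \<le> T"
    and re_nonneg: "u \<in> D \<Longrightarrow> 0 \<le> Re (a u u)"
    and im_le: "u \<in> D \<Longrightarrow> \<bar>Im (a u u)\<bar> \<le> T * Re (a u u)"
begin

definition qnorm :: "('a \<Rightarrow> complex) \<Rightarrow> real" where "qnorm u = sqrt (Re (a u u))"

lemma qnorm_nonneg [simp]: "u \<in> D \<Longrightarrow> 0 \<le> qnorm u"
  by (simp add: qnorm_def re_nonneg)

lemma qnorm_sq: "u \<in> D \<Longrightarrow> (qnorm u)\<^sup>2 = Re (a u u)"
  by (simp add: qnorm_def re_nonneg)

lemma norm_diag_le: "u \<in> D \<Longrightarrow> norm (a u u) \<le> (1 + T) * Re (a u u)"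
  using cmod_le[of "a u u"] im_le[of u] re_nonneg[of u] by (simp add: algebra_simps)

lemma qnorm_scale: "u \<in> D \<Longrightarrow> qnorm (\<lambda>x. s * u x) = norm s * qnorm u"
proof -
  assume u: "u \<in> D"
  have "a (\<lambda>x. s * u x) (\<lambda>x. s * u x) = (s * cnj s) * a u u"
    using u by (simp add: scale_left scale_right scale_mem)
  also have "\<dots> = of_real ((norm s)\<^sup>2) * a u u"
    by (metis complex_norm_square)
  finally show ?thesis by (simp add: qnorm_def real_sqrt_mult)
qed

lemma norm_le_aux:
  assumes "u \<in> D" "v \<in> D"
  shows "norm (a u v) \<le> (1 + T) * ((qnorm u)\<^sup>2 + (qnorm v)\<^sup>2)"
proof -
  let ?w = "\<lambda>s. (\<lambda>x. u x + s * v x)"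
  have w: "?w s \<in> D" for s using assms by (simp add: add_mem scale_mem)
  have e: "a (?w s) (?w s) = a u u + s * a v u + cnj s * a u v + (norm s)\<^sup>2 * a v v" for s
    using assms unfolding complex_norm_square
    by (simp add: closure_rules sesq_rules algebra_simps)
  \<comment> \<open>Polarisation reduces the mixed value to four diagonal ones, which sectoriality
    controls by their real parts; in the sum of these real parts the cross terms cancel.\<close>
  have pol: "4 * a u v = a (?w 1) (?w 1) - a (?w (-1)) (?w (-1)) + \<i> * a (?w \<i>) (?w \<i>) - \<i> * a (?w (-\<i>)) (?w (-\<i>))"
    unfolding e by (simp add: algebra_simps)
  have "4 * norm (a u v) = norm (4 * a u v)" by (simp add: norm_mult)
  also have "\<dots> \<le> norm (a (?w 1) (?w 1)) + norm (a (?w (-1)) (?w (-1)))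
     + norm (\<i> * a (?w \<i>) (?w \<i>)) + norm (\<i> * a (?w (-\<i>)) (?w (-\<i>)))"
    unfolding pol by (meson add_mono norm_triangle_ineq norm_triangle_ineq4 order_trans order_refl)
  also have "\<dots> \<le> (1 + T) * Re (a (?w 1) (?w 1)) + (1 + T) * Re (a (?w (-1)) (?w (-1)))
     + (1 + T) * Re (a (?w \<i>) (?w \<i>)) + (1 + T) * Re (a (?w (-\<i>)) (?w (-\<i>)))"
    using w norm_diag_le by (intro add_mono) (simp_all only: norm_mult norm_ii mult_1 [of "norm _"])
  also have "\<dots> = 4 * ((1 + T) * (Re (a u u) + Re (a v v)))"
    unfolding e by (simp add: algebra_simps)
  finally show ?thesis using assms by (simp only: qnorm_sq)
qed

text \<open>\<open>a u v\<close> is unchanged when \<open>u\<close> is scaled by \<open>t\<close>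
  and \<open>v\<close> by \<open>1 / t\<close>; optimising the additive bound over \<open>t\<close>
  makes it a product. The factor 2 is the cost of this and reappears in the Cauchy--Schwarz
  estimates below.\<close>

lemma norm_le:
  assumes "u \<in> D" "v \<in> D"
  shows "norm (a u v) \<le> 2 * (1 + T) * qnorm u * qnorm v"
proof -
  have "norm (a u v) / (1 + T) \<le> 2 * qnorm u * qnorm v"
  proof (rule scaled_am_gm)
    fix t :: real assume t: "t > 0"
    let ?u = "\<lambda>x. of_real t * u x" and ?v = "\<lambda>x. of_real (1 / t) * v x"
    have "a ?u ?v = a u v"
      unfolding scale_left[OF assms(1) scale_mem[OF assms(2)]] scale_right[OF assms] using t by simp
    then have "norm (a u v) \<le> (1 + T) * ((qnorm ?u)\<^sup>2 + (qnorm ?v)\<^sup>2)"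
      using norm_le_aux[of ?u ?v] scale_mem assms by metis
    also have "(qnorm ?u)\<^sup>2 + (qnorm ?v)\<^sup>2 = t\<^sup>2 * (qnorm u)\<^sup>2 + (qnorm v)\<^sup>2 / t\<^sup>2"
      unfolding qnorm_scale[OF assms(1)] qnorm_scale[OF assms(2)]
      using t by (simp add: power_mult_distrib power_divide norm_divide)
    finally show "norm (a u v) / (1 + T) \<le> t\<^sup>2 * (qnorm u)\<^sup>2 + (qnorm v)\<^sup>2 / t\<^sup>2"
      using T_nonneg by (simp add: field_simps)
  qed (use assms in auto)
  then show ?thesis using T_nonneg by (simp add: field_simps)
qed

text \<open>The midpoint is kept explicit: in a convex set it is bounded below by the infimum, so
  two near-minimisers of \<open>qnorm\<close> must be close.\<close>

lemma parallelogram: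
  assumes "u \<in> D" "v \<in> D"
  shows "(qnorm (\<lambda>x. u x - v x))\<^sup>2 = 2 * (qnorm u)\<^sup>2 + 2 * (qnorm v)\<^sup>2 - 4 * (qnorm (\<lambda>x. (1/2) * (u x + v x)))\<^sup>2"
  unfolding qnorm_scale[OF add_mem[OF assms]] power_mult_distrib
  using assms by (simp add: qnorm_sq closure_rules sesq_rules norm_divide field_simps)

text \<open>Solvability up to an arbitrarily small residual, since no completeness is assumed.
  Residuals are measured by the \<open>qnorm\<close> of the ambient form \<open>a\<close> whatever
  \<open>b\<close> is, which lets \<open>b\<close> be deformed while the norm stays fixed.\<close>

definition solvable :: "(('a \<Rightarrow> complex) \<Rightarrow> ('a \<Rightarrow> complex) \<Rightarrow> complex) \<Rightarrow> bool" where
  "solvable b \<longleftrightarrow> (\<forall>g r e. antilinear_on D g \<longrightarrow> (\<forall>v\<in>D. norm (g v) \<le> r * qnorm v) \<longrightarrow> 0 < e \<longrightarrow>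
     (\<exists>u\<in>D. \<forall>v\<in>D. norm (g v - b u v) \<le> e * qnorm v))"

lemma antilinear_on_residual:
  "antilinear_on D g \<Longrightarrow> sesquilinear D b \<Longrightarrow> u \<in> D \<Longrightarrow> antilinear_on D (\<lambda>v. g v - b u v)"
  unfolding antilinear_on_def by (simp add: sesquilinear.add_right sesquilinear.scale_right algebra_simps)

text \<open>The symmetric part is an inner product up to degeneracy, so near-minimisers of the
  quadratic energy \<open>F\<close> are approximate solutions: being within \<open>e^2\<close> of
  the infimum forces the first variation to be at most \<open>e\<close> in the dual norm.\<close>

lemma solvable_symmetric_part: "solvable (\<lambda>u v. (a u v + cnj (a v u)) / 2)"
  unfolding solvable_def
proof (intro allI impI)
  fix g :: "('a \<Rightarrow> complex) \<Rightarrow> complex" and r e :: real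
  assume g: "antilinear_on D g" and gr: "\<forall>v\<in>D. norm (g v) \<le> r * qnorm v" and e: "0 < e"
  define F where "F w = (qnorm w)\<^sup>2 - 2 * Re (g w)" for w
  have F_ge: "F w \<ge> - r\<^sup>2" if "w \<in> D" for w
  proof -
    have "Re (g w) \<le> r * qnorm w" using gr that complex_Re_le_cmod order_trans by blast
    moreover have "0 \<le> (qnorm w - r)\<^sup>2" by simp
    ultimately show ?thesis by (simp add: F_def power2_eq_square algebra_simps)
  qed
  have bdd: "bdd_below (F ` D)" using F_ge by (auto intro!: bdd_belowI)
  have "Inf (F ` D) < Inf (F ` D) + e\<^sup>2" using e by simp
  then have "\<exists>y\<in>F ` D. y < Inf (F ` D) + e\<^sup>2"
    using cInf_less_iff[of "F ` D"] nonempty bdd by blast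
  then obtain w where w: "w \<in> D" "F w < Inf (F ` D) + e\<^sup>2" by blast
  have "norm (g v - (a w v + cnj (a v w)) / 2) \<le> e * qnorm v" if v: "v \<in> D" for v
  proof -
    define z where "z = g v - (a w v + cnj (a v w)) / 2"
    have "norm z \<le> 2 * qnorm v * (e / 2)"
    proof (rule scaled_am_gm)
      fix t :: real assume t: "t > 0"
      \<comment> \<open>The phase of \<open>z\<close> turns \<open>cnj s * z\<close> into a
        nonnegative real; the size \<open>2 * t^2\<close> makes division by \<open>4 * t^2\<close>
        produce exactly the two terms required by \<open>scaled_am_gm\<close>.\<close>
      define s where "s = of_real (2 * t\<^sup>2) * sgn z"
      let ?u = "\<lambda>x. w x + s * v x"
      have u: "?u \<in> D" using v w by (simp add: add_mem scale_mem)
      have "a ?u ?u = a w w + s * a v w + cnj s * a w v + (norm s)\<^sup>2 * a v v"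
        using v w unfolding complex_norm_square by (simp add: closure_rules sesq_rules algebra_simps)
      then have "(qnorm ?u)\<^sup>2 = (qnorm w)\<^sup>2 + Re (s * a v w) + Re (cnj s * a w v) + (norm s)\<^sup>2 * (qnorm v)\<^sup>2"
        using u v w by (simp add: qnorm_sq)
      moreover have "g ?u = g w + cnj s * g v"
        using g v w scale_mem unfolding antilinear_on_def by simp
      ultimately have "F ?u = F w + (norm s)\<^sup>2 * (qnorm v)\<^sup>2 - 2 * Re (cnj s * z)"
        by (simp add: F_def z_def field_simps)
      moreover have "F w < F ?u + e\<^sup>2"
        using w(2) cINF_lower[OF bdd u] by linarith
      ultimately have 1: "2 * Re (cnj s * z) \<le> (norm s)\<^sup>2 * (qnorm v)\<^sup>2 + e\<^sup>2" by linarith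
      have "cnj s * z = of_real (2 * t\<^sup>2 * norm z)"
      proof (cases "z = 0")
        case False
        have "cnj s * z = of_real (2 * t\<^sup>2) * (z * cnj z) / of_real (norm z)"
          by (simp add: s_def sgn_eq)
        also have "\<dots> = of_real (2 * t\<^sup>2) * of_real ((norm z)\<^sup>2) / of_real (norm z)"
          by (simp only: complex_norm_square)
        finally show ?thesis using False by (simp add: power2_eq_square)
      qed simp
      then have "4 * t\<^sup>2 * norm z \<le> (norm s)\<^sup>2 * (qnorm v)\<^sup>2 + e\<^sup>2" using 1 by simp
      also have "\<dots> \<le> (2 * t\<^sup>2)\<^sup>2 * (qnorm v)\<^sup>2 + e\<^sup>2"
        by (intro add_right_mono mult_right_mono power_mono) (auto simp: s_def norm_mult norm_sgn norm_power)
      finally show "norm z \<le> t\<^sup>2 * (qnorm v)\<^sup>2 + (e / 2)\<^sup>2 / t\<^sup>2"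
        using t by (simp add: field_simps power2_eq_square)
    qed (use e v in auto)
    then show ?thesis by (simp add: z_def mult.commute)
  qed
  then show "\<exists>u\<in>D. \<forall>v\<in>D. norm (g v - (a u v + cnj (a v u)) / 2) \<le> e * qnorm v"
    using w(1) by blast
qed

text \<open>The residual of an approximate solution is again an antilinear functional, with half the
  bound; solving for it and adding the correction makes the residuals decay geometrically.\<close>

lemma solvable_iterate:
  assumes b: "sesquilinear D b"
    and step: "\<And>g r. antilinear_on D g \<Longrightarrow> 0 < r \<Longrightarrow> (\<forall>v\<in>D. norm (g v) \<le> r * qnorm v) \<Longrightarrow>
       \<exists>u\<in>D. \<forall>v\<in>D. norm (g v - b u v) \<le> r / 2 * qnorm v"
  shows "solvable b"
  unfolding solvable_def
proof (intro allI impI)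
  fix g :: "('a \<Rightarrow> complex) \<Rightarrow> complex" and r e :: real
  assume g: "antilinear_on D g" and gr: "\<forall>v\<in>D. norm (g v) \<le> r * qnorm v" and e: "0 < e"
  \<comment> \<open>\<open>r\<close> may be zero or negative (the latter when \<open>qnorm\<close>
    vanishes identically), whereas \<open>step\<close> wants a positive bound.\<close>
  define R where "R = max r 1"
  have R: "R > 0" "\<forall>v\<in>D. norm (g v) \<le> R * qnorm v"
    using gr by (auto simp: R_def intro!: order_trans[OF _ mult_right_mono[of r "max r 1"]])
  have it: "\<exists>u\<in>D. \<forall>v\<in>D. norm (g v - b u v) \<le> R / 2 ^ n * qnorm v" for n
  proof (induction n)
    case 0
    show ?case using R zero_mem by (intro bexI[of _ "\<lambda>x. 0"]) (auto simp: sesquilinear.zero_left[OF b])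
  next
    case (Suc n)
    then obtain u where u: "u \<in> D" "\<forall>v\<in>D. norm (g v - b u v) \<le> R / 2 ^ n * qnorm v" by blast
    from step[OF antilinear_on_residual[OF g b u(1)] _ u(2)] R(1)
    obtain w where w: "w \<in> D" "\<forall>v\<in>D. norm (g v - b u v - b w v) \<le> R / 2 ^ n / 2 * qnorm v" by auto
    show ?case
      using u(1) w by (intro bexI[of _ "\<lambda>x. u x + w x"]) (auto simp: sesquilinear.add_left[OF b] add_mem algebra_simps)
  qed
  obtain n where n: "R / 2 ^ n < e"
    using real_arch_pow[of 2 "R / e"] e by (auto simp: field_simps)
  obtain u where u: "u \<in> D" "\<forall>v\<in>D. norm (g v - b u v) \<le> R / 2 ^ n * qnorm v" using it by blast
  show "\<exists>u\<in>D. \<forall>v\<in>D. norm (g v - b u v) \<le> e * qnorm v"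
    using order_trans[OF u(2)[rule_format] mult_right_mono[OF less_imp_le[OF n] qnorm_nonneg]] u(1) by blast
qed

text \<open>Solve with \<open>b\<close> alone to accuracy \<open>r / 5\<close>. Coercivity gives
  \<open>qnorm u \<le> 6 / 5 * r\<close>, so the neglected term \<open>p u\<close> contributes at
  most \<open>6 / 25 * r\<close>; the total \<open>11 / 25 * r\<close> is below the half required by
  the iteration.\<close>

lemma solvable_perturb:
  assumes b: "sesquilinear D b" and p: "sesquilinear D p" and "solvable b"
    and diag: "\<And>u. u \<in> D \<Longrightarrow> Re (b u u) = (qnorm u)\<^sup>2"
    and small: "\<And>u v. u \<in> D \<Longrightarrow> v \<in> D \<Longrightarrow> norm (p u v) \<le> qnorm u * qnorm v / 5"
  shows "solvable (\<lambda>u v. b u v + p u v)"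
proof (rule solvable_iterate)
  show "sesquilinear D (\<lambda>u v. b u v + p u v)"
    using b p unfolding sesquilinear_def by (simp add: algebra_simps)
  fix g :: "('a \<Rightarrow> complex) \<Rightarrow> complex" and r :: real
  assume g: "antilinear_on D g" and r: "0 < r" and gr: "\<forall>v\<in>D. norm (g v) \<le> r * qnorm v"
  obtain u where u: "u \<in> D" "\<forall>v\<in>D. norm (g v - b u v) \<le> r / 5 * qnorm v"
    using \<open>solvable b\<close>[unfolded solvable_def, rule_format, OF g gr[rule_format], of "r / 5"] r by auto
  have "(qnorm u)\<^sup>2 \<le> norm (b u u)" using diag[OF u(1)] complex_Re_le_cmod[of "b u u"] by simp
  also have "\<dots> \<le> norm (g u) + norm (g u - b u u)" using norm_triangle_ineq4[of "g u" "g u - b u u"] by simp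
  also have "\<dots> \<le> r * qnorm u + r / 5 * qnorm u" using u gr by (intro add_mono) auto
  finally have "qnorm u * qnorm u \<le> (6 / 5 * r) * qnorm u" by (simp add: power2_eq_square)
  then have qu: "qnorm u \<le> 6 / 5 * r"
    using r qnorm_nonneg[OF u(1)] by (cases "qnorm u = 0") auto
  have "norm (g v - (b u v + p u v)) \<le> r / 2 * qnorm v" if v: "v \<in> D" for v
  proof -
    have "norm (g v - (b u v + p u v)) \<le> norm (g v - b u v) + norm (p u v)"
      using norm_triangle_ineq4[of "g v - b u v" "p u v"] by (simp add: algebra_simps)
    also have "\<dots> \<le> r / 5 * qnorm v + (6 / 5 * r) * qnorm v / 5"
      using u v small[OF u(1) v] mult_right_mono[OF qu qnorm_nonneg[OF v]] by (intro add_mono) auto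
    also have "\<dots> = (11 / 25 * r) * qnorm v" by (simp add: field_simps)
    also have "\<dots> \<le> r / 2 * qnorm v" using r v by (intro mult_right_mono) auto
    finally show ?thesis .
  qed
  then show "\<exists>u\<in>D. \<forall>v\<in>D. norm (g v - (b u v + p u v)) \<le> r / 2 * qnorm v" using u(1) by blast
qed

text \<open>The Lax--Milgram lemma without completeness, by the method of continuity: one moves from the
  symmetric part to the form itself in steps that are small compared with the coercivity.\<close>

theorem approximate_lax_milgram: "solvable a"
proof -
  define h where "h u v = (a u v + cnj (a v u)) / 2" for u v
  obtain N :: nat where N20: "20 * (1 + T) \<le> N" using real_arch_simple by blast
  then have N: "N > 0" "10 * (1 + T) \<le> N / 2" using T_nonneg by (auto intro: gr0I)
  have h: "sesquilinear D h"
    by unfold_locales (auto simp: h_def nonempty closure_rules sesq_rules algebra_simps add_divide_distrib)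
  \<comment> \<open>One step of the path from \<open>h\<close> to \<open>a\<close>. The difference
    \<open>a - h\<close> is the skew part, bounded by \<open>2 * (1 + T)\<close> in the form norm,
    so \<open>N\<close> at least \<open>10 * (1 + T)\<close> makes each step as small as
    \<open>solvable_perturb\<close> demands.\<close>
  define p where "p u v = of_real (1 / N) * (a u v - h u v)" for u v
  have p: "sesquilinear D p"
    using h sesquilinear_axioms unfolding sesquilinear_def p_def by (simp add: algebra_simps)
  have hd: "Re (h u u) = (qnorm u)\<^sup>2" if "u \<in> D" for u using that by (simp add: h_def qnorm_sq)
  \<comment> \<open>\<open>p\<close> has a purely imaginary diagonal, so all forms on the path share
    the real diagonal of \<open>h\<close>: coercivity does not deteriorate and a fixed step length
    suffices.\<close>
  have pd: "Re (p u u) = 0" if "u \<in> D" for u using that by (simp add: p_def h_def)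
  have small: "norm (p u v) \<le> qnorm u * qnorm v / 5" if "u \<in> D" "v \<in> D" for u v
  proof -
    have "p u v = of_real (1 / (2 * N)) * (a u v - cnj (a v u))"
      using N(1) by (simp add: p_def h_def field_simps)
    then have "norm (p u v) = 1 / (2 * N) * norm (a u v - cnj (a v u))" by (simp add: norm_mult norm_divide)
    also have "\<dots> \<le> 1 / (2 * N) * (norm (a u v) + norm (a v u))"
      by (intro mult_left_mono) (use norm_triangle_ineq4[of "a u v" "cnj (a v u)"] in auto)
    also have "\<dots> \<le> 1 / (2 * N) * (4 * (1 + T) * (qnorm u * qnorm v))"
      using norm_le[OF that] norm_le[OF that(2,1)] by (intro mult_left_mono) (auto simp: algebra_simps)
    also have "\<dots> = (2 * (1 + T) / N) * (qnorm u * qnorm v)"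
      using N(1) by (simp add: field_simps)
    also have "\<dots> \<le> 1 / 5 * (qnorm u * qnorm v)"
      using N by (intro mult_right_mono) (simp_all add: field_simps that)
    finally show ?thesis by simp
  qed
  have "sesquilinear D (\<lambda>u v. h u v + of_nat n * p u v) \<and> solvable (\<lambda>u v. h u v + of_nat n * p u v)" for n
  proof (induction n)
    case 0
    show ?case using h solvable_symmetric_part[folded h_def] by simp
  next
    case (Suc n)
    have e: "(\<lambda>u v. h u v + of_nat (Suc n) * p u v) = (\<lambda>u v. (h u v + of_nat n * p u v) + p u v)"
      by (simp add: algebra_simps)
    have "solvable (\<lambda>u v. (h u v + of_nat n * p u v) + p u v)"
    proof (rule solvable_perturb[OF _ p _ _ small])
      show "Re (h u u + of_nat n * p u u) = (qnorm u)\<^sup>2" if "u \<in> D" for u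
        using hd[OF that] pd[OF that] by simp
    qed (use Suc in blast)+
    moreover have "sesquilinear D (\<lambda>u v. (h u v + of_nat n * p u v) + p u v)"
      using Suc p unfolding sesquilinear_def by (simp add: algebra_simps)
    ultimately show ?case by (simp only: e)
  qed
  moreover have "(\<lambda>u v. h u v + of_nat N * p u v) = a"
    using N(1) by (intro ext) (simp add: p_def)
  ultimately show ?thesis by metis
qed

end

section \<open>The space of square integrable functions\<close>

lemma L2_measurable [measurable_dest]: "u \<in> L2 \<Omega> \<Longrightarrow> u \<in> borel_measurable (lebesgue_on \<Omega>)"
  by (simp add: L2_def)

lemma L2_integrable: "u \<in> L2 \<Omega> \<Longrightarrow> integrable (lebesgue_on \<Omega>) (\<lambda>x. (norm (u x))\<^sup>2)"
  by (simp add: L2_def)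

lemma norm_add_sq_le: "(norm (x + y :: 'a::real_normed_vector))\<^sup>2 \<le> 2 * (norm x)\<^sup>2 + 2 * (norm y)\<^sup>2"
proof -
  have "(norm (x + y))\<^sup>2 \<le> (norm x + norm y)\<^sup>2" by (intro power_mono norm_triangle_ineq norm_ge_zero)
  also have "\<dots> \<le> 2 * (norm x)\<^sup>2 + 2 * (norm y)\<^sup>2" using sum_squares_bound[of "norm x" "norm y"] by (simp add: power2_sum)
  finally show ?thesis .
qed

lemma L2_bounded_mult:
  assumes "u \<in> L2 \<Omega>" "m \<in> borel_measurable (lebesgue_on \<Omega>)" "AE x in lebesgue_on \<Omega>. norm (m x) \<le> C"
  shows "(\<lambda>x. m x * u x) \<in> L2 \<Omega>"
proof -
  note [measurable] = L2_measurable[OF assms(1)] assms(2)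
  have "integrable (lebesgue_on \<Omega>) (\<lambda>x. C\<^sup>2 * (norm (u x))\<^sup>2)" using L2_integrable[OF assms(1)] by simp
  then have "integrable (lebesgue_on \<Omega>) (\<lambda>x. (norm (m x * u x))\<^sup>2)"
  proof (rule Bochner_Integration.integrable_bound)
    show "AE x in lebesgue_on \<Omega>. norm ((norm (m x * u x))\<^sup>2) \<le> norm (C\<^sup>2 * (norm (u x))\<^sup>2)"
      using assms(3) by eventually_elim (auto simp: norm_mult power_mult_distrib intro!: mult_right_mono power_mono)
  qed measurable
  then show ?thesis unfolding L2_def by simp
qed

lemma L2_scale: "u \<in> L2 \<Omega> \<Longrightarrow> (\<lambda>x. c * u x) \<in> L2 \<Omega>"
  using L2_bounded_mult[of u \<Omega> "\<lambda>_. c" "norm c"] by simp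

lemma L2_add:
  assumes "u \<in> L2 \<Omega>" "v \<in> L2 \<Omega>"
  shows "(\<lambda>x. u x + v x) \<in> L2 \<Omega>"
proof -
  note [measurable] = L2_measurable[OF assms(1)] L2_measurable[OF assms(2)]
  have "integrable (lebesgue_on \<Omega>) (\<lambda>x. 2 * (norm (u x))\<^sup>2 + 2 * (norm (v x))\<^sup>2)"
    using assms[THEN L2_integrable] by simp
  then have "integrable (lebesgue_on \<Omega>) (\<lambda>x. (norm (u x + v x))\<^sup>2)"
    by (rule Bochner_Integration.integrable_bound) (auto intro!: AE_I2 norm_add_sq_le)
  then show ?thesis unfolding L2_def by simp
qed

lemma L2_zero [simp]: "(\<lambda>x. 0) \<in> L2 \<Omega>"
  by (simp add: L2_def)

lemma L2_mult_integrable: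
  assumes "u \<in> L2 \<Omega>" "v \<in> L2 \<Omega>"
  shows "integrable (lebesgue_on \<Omega>) (\<lambda>x. u x * v x)"
proof -
  note [measurable] = L2_measurable[OF assms(1)] L2_measurable[OF assms(2)]
  have "integrable (lebesgue_on \<Omega>) (\<lambda>x. (norm (u x))\<^sup>2 + (norm (v x))\<^sup>2)"
    using assms[THEN L2_integrable] by simp
  moreover have "norm (u x * v x) \<le> norm ((norm (u x))\<^sup>2 + (norm (v x))\<^sup>2)" for x
  proof -
    have "0 \<le> norm (u x) * norm (v x)" by simp
    then show ?thesis
      using sum_squares_bound[of "norm (u x)" "norm (v x)"] unfolding norm_mult real_norm_def by linarith
  qed
  ultimately show ?thesis
    by (intro Bochner_Integration.integrable_bound[where g = "\<lambda>x. u x * v x"] AE_I2) measurable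
qed

lemma L2_cnj: "u \<in> L2 \<Omega> \<Longrightarrow> (\<lambda>x. cnj (u x)) \<in> L2 \<Omega>"
  by (auto simp: L2_def intro: measurable_compose[OF _ borel_measurable_continuous_onI] continuous_intros)

lemma L2_inner_integrable: "u \<in> L2 \<Omega> \<Longrightarrow> v \<in> L2 \<Omega> \<Longrightarrow> integrable (lebesgue_on \<Omega>) (\<lambda>x. u x * cnj (v x))"
  by (intro L2_mult_integrable L2_cnj)

lemma L2_inner_diag: "L2_inner \<Omega> u u = of_real ((L2_norm \<Omega> u)\<^sup>2)"
  by (simp add: L2_inner_def L2_norm_def complex_norm_square[symmetric] flip: of_real_power)

text \<open>With \<open>T = 0\<close> the abstract Cauchy--Schwarz inequality specialises to the
  \<open>L2\<close> norm. On representatives this is a seminorm only, which \<open>sectorial\<close>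
  permits.\<close>

interpretation L2: sectorial "L2 \<Omega>" "L2_inner \<Omega>" 0 for \<Omega> :: "(real^'a::finite) set"
proof
  show "L2 \<Omega> \<noteq> {}" using L2_zero by blast
  fix u u' v v' :: "real^'a \<Rightarrow> complex" and s
  assume *: "u \<in> L2 \<Omega>" "v \<in> L2 \<Omega>"
  show "L2_inner \<Omega> (\<lambda>x. s * u x) v = s * L2_inner \<Omega> u v"
    by (simp add: L2_inner_def mult.assoc)
  have "L2_inner \<Omega> u (\<lambda>x. s * v x) = (LINT x|lebesgue_on \<Omega>. cnj s * (u x * cnj (v x)))"
    by (simp add: L2_inner_def mult.left_commute)
  then show "L2_inner \<Omega> u (\<lambda>x. s * v x) = cnj s * L2_inner \<Omega> u v"
    by (simp add: L2_inner_def)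
  show "L2_inner \<Omega> (\<lambda>x. u x + u' x) v = L2_inner \<Omega> u v + L2_inner \<Omega> u' v" if "u' \<in> L2 \<Omega>"
    unfolding L2_inner_def distrib_right
    by (rule Bochner_Integration.integral_add) (intro L2_inner_integrable * that)+
  show "L2_inner \<Omega> u (\<lambda>x. v x + v' x) = L2_inner \<Omega> u v + L2_inner \<Omega> u v'" if "v' \<in> L2 \<Omega>"
    unfolding L2_inner_def distrib_left complex_cnj_add
    by (rule Bochner_Integration.integral_add) (intro L2_inner_integrable * that)+
qed (simp_all add: L2_add L2_scale L2_inner_diag)

lemma L2_norm_eq: "L2.qnorm \<Omega> = L2_norm \<Omega>"
  by (auto simp: L2.qnorm_def L2_inner_diag L2_norm_def)

lemma L2_norm_nonneg [simp]: "0 \<le> L2_norm \<Omega> u"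
  by (simp add: L2_norm_def)

lemmas L2_inner_le = L2.norm_le[unfolded L2_norm_eq, simplified]
lemmas L2_norm_scale = L2.qnorm_scale[unfolded L2_norm_eq]
lemmas L2_diff = L2.diff_mem

text \<open>In this squared form the estimate costs nothing at midpoints: the factor
  \<open>1 / 4\<close> from halving cancels the factors 2, so balls are seen to be convex.\<close>

lemma L2_norm_add_sq:
  assumes "u \<in> L2 \<Omega>" "v \<in> L2 \<Omega>"
  shows "(L2_norm \<Omega> (\<lambda>x. u x + v x))\<^sup>2 \<le> 2 * (L2_norm \<Omega> u)\<^sup>2 + 2 * (L2_norm \<Omega> v)\<^sup>2"
proof -
  have "(\<integral>x. (norm (u x + v x))\<^sup>2 \<partial>lebesgue_on \<Omega>) \<le> (\<integral>x. 2 * (norm (u x))\<^sup>2 + 2 * (norm (v x))\<^sup>2 \<partial>lebesgue_on \<Omega>)"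
    by (intro Bochner_Integration.integral_mono norm_add_sq_le Bochner_Integration.integrable_add
        integrable_mult_right L2_integrable[OF assms(1)] L2_integrable[OF assms(2)] L2_integrable[OF L2_add[OF assms]])
  also have "\<dots> = 2 * (\<integral>x. (norm (u x))\<^sup>2 \<partial>lebesgue_on \<Omega>) + 2 * (\<integral>x. (norm (v x))\<^sup>2 \<partial>lebesgue_on \<Omega>)"
    using assms[THEN L2_integrable] by simp
  finally show ?thesis by (simp add: L2_norm_def)
qed

lemma L2_inner_tendsto:
  assumes "\<And>n. u n \<in> L2 \<Omega>" "x \<in> L2 \<Omega>" "\<And>n. v n \<in> L2 \<Omega>" "y \<in> L2 \<Omega>"
    and u: "(\<lambda>n. L2_norm \<Omega> (\<lambda>z. u n z - x z)) \<longlonglongrightarrow> 0"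
    and v: "(\<lambda>n. L2_norm \<Omega> (\<lambda>z. v n z - y z)) \<longlonglongrightarrow> 0"
  shows "(\<lambda>n. L2_inner \<Omega> (u n) (v n)) \<longlonglongrightarrow> L2_inner \<Omega> x y"
proof -
  let ?u = "\<lambda>n z. u n z - x z" and ?v = "\<lambda>n z. v n z - y z"
  note m = assms(1-4) L2_diff[OF assms(1,2)] L2_diff[OF assms(3,4)]
  have eq: "L2_inner \<Omega> (u n) (v n) - L2_inner \<Omega> x y
     = L2_inner \<Omega> (?u n) (?v n) + L2_inner \<Omega> x (?v n) + L2_inner \<Omega> (?u n) y" for n
    using m by (simp add: L2.sesq_rules algebra_simps)
  have "norm (L2_inner \<Omega> (u n) (v n) - L2_inner \<Omega> x y)
    \<le> 2 * L2_norm \<Omega> (?u n) * L2_norm \<Omega> (?v n) + 2 * L2_norm \<Omega> x * L2_norm \<Omega> (?v n) + 2 * L2_norm \<Omega> (?u n) * L2_norm \<Omega> y" for n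
    unfolding eq by (intro order_trans[OF norm_triangle_ineq] add_mono L2_inner_le m)
  moreover have "(\<lambda>n. 2 * L2_norm \<Omega> (?u n) * L2_norm \<Omega> (?v n) + 2 * L2_norm \<Omega> x * L2_norm \<Omega> (?v n) + 2 * L2_norm \<Omega> (?u n) * L2_norm \<Omega> y) \<longlonglongrightarrow> 0"
    by (auto intro!: tendsto_eq_intros u v)
  ultimately have "(\<lambda>n. L2_inner \<Omega> (u n) (v n) - L2_inner \<Omega> x y) \<longlonglongrightarrow> 0"
    by (rule Lim_null_comparison[OF always_eventually[OF allI]])
  then show ?thesis using LIM_zero_iff by blast
qed

text \<open>Riesz--Fischer: a rapidly converging subsequence converges almost everywhere, and the
  pointwise limit is the limit in norm by Fatou's lemma.\<close>

theorem L2_complete: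
  assumes u: "\<And>n. u n \<in> L2 \<Omega>"
    and cauchy: "\<And>e. e > 0 \<Longrightarrow> \<exists>N. \<forall>m\<ge>N. \<forall>n\<ge>N. L2_norm \<Omega> (\<lambda>x. u m x - u n x) \<le> e"
  shows "\<exists>x\<in>L2 \<Omega>. (\<lambda>n. L2_norm \<Omega> (\<lambda>z. u n z - x z)) \<longlonglongrightarrow> 0"
proof -
  define M where "M = lebesgue_on \<Omega>"
  note [measurable] = L2_measurable[OF u, folded M_def]
  have nn: "(\<integral>\<^sup>+z. ennreal ((norm (u m z - u n z))\<^sup>2) \<partial>M) = ennreal ((L2_norm \<Omega> (\<lambda>x. u m x - u n x))\<^sup>2)" for m n
    using L2_integrable[OF L2_diff[OF u u]]
    by (simp add: M_def L2_norm_def nn_integral_eq_integral)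
  have "\<exists>N. \<forall>m\<ge>N. \<forall>n\<ge>N. L2_norm \<Omega> (\<lambda>x. u m x - u n x) \<le> (1/2)^k" for k :: nat
    by (rule cauchy) simp
  then obtain N where N: "\<And>k m n. m \<ge> N k \<Longrightarrow> n \<ge> N k \<Longrightarrow> L2_norm \<Omega> (\<lambda>x. u m x - u n x) \<le> (1/2)^k"
    by metis
  \<comment> \<open>Partial sums of \<open>N\<close> are increasing and dominate \<open>N\<close>,
    so consecutive members of the subsequence differ by at most \<open>(1/2)^k\<close> in
    norm.\<close>
  define r where "r k = (\<Sum>i\<le>k. N i)" for k
  have r_mono: "r k \<le> r (Suc k)" and r_ge: "N k \<le> r k" for k
    by (auto simp: r_def intro: member_le_sum)
  define w where "w k = u (r k)" for k
  have [measurable]: "w k \<in> borel_measurable M" for k unfolding w_def by measurable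
  \<comment> \<open>The weight \<open>2^k\<close> is a compromise: the squared increments have
    integral at most \<open>(1/4)^k\<close>, so the integrals still sum, while
    \<open>g k z < 1\<close> bounds the increments by \<open>sqrt (1/2) ^ k\<close>, again
    summable.\<close>
  define g where "g k z = 2^k * (norm (w (Suc k) z - w k z))\<^sup>2" for k z
  have g: "(\<integral>\<^sup>+z. ennreal (g k z) \<partial>M) \<le> ennreal ((1/2)^k)" for k
  proof -
    have "(\<integral>\<^sup>+z. ennreal (g k z) \<partial>M) = ennreal (2^k) * (\<integral>\<^sup>+z. ennreal ((norm (w (Suc k) z - w k z))\<^sup>2) \<partial>M)"
      unfolding g_def by (subst nn_integral_cmult[symmetric]) (auto simp: ennreal_mult)
    also have "\<dots> = ennreal (2^k * (L2_norm \<Omega> (\<lambda>x. w (Suc k) x - w k x))\<^sup>2)"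
      unfolding w_def nn by (simp add: ennreal_mult)
    also have "\<dots> \<le> ennreal (2^k * ((1/2)^k)\<^sup>2)"
      unfolding w_def using N[of k "r (Suc k)" "r k"] r_ge[of k] r_mono[of k]
      by (intro ennreal_leI mult_left_mono power_mono) auto
    also have "2^k * ((1/2::real)^k)\<^sup>2 = (1/2)^k"
      by (simp add: power2_eq_square power_divide)
    finally show ?thesis .
  qed
  have "(\<integral>\<^sup>+z. (\<Sum>k. ennreal (g k z)) \<partial>M) = (\<Sum>k. \<integral>\<^sup>+z. ennreal (g k z) \<partial>M)"
    by (rule nn_integral_suminf) (auto simp: g_def)
  also have "\<dots> \<le> (\<Sum>k. ennreal ((1/2)^k))" by (intro suminf_le g) auto
  also have "\<dots> = ennreal (\<Sum>k. (1/2)^k)" by (intro suminf_ennreal_eq summable_sums) auto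
  finally have "(\<integral>\<^sup>+z. (\<Sum>k. ennreal (g k z)) \<partial>M) \<noteq> \<infinity>" by (auto simp: top_unique)
  then have "AE z in M. (\<Sum>k. ennreal (g k z)) \<noteq> \<infinity>"
    by (intro nn_integral_PInf_AE) (auto simp: g_def)
  then have conv: "AE z in M. convergent (\<lambda>k. w k z)"
  proof eventually_elim
    case (elim z)
    then have "summable (\<lambda>k. g k z)" by (intro summable_suminf_not_top) (auto simp: g_def)
    then have "(\<lambda>k. g k z) \<longlonglongrightarrow> 0" by (rule summable_LIMSEQ_zero)
    then have "eventually (\<lambda>k. g k z < 1) sequentially" by (rule order_tendstoD) simp
    then have "eventually (\<lambda>k. norm (w (Suc k) z - w k z) \<le> (sqrt (1/2))^k) sequentially"
    proof eventually_elim
      case (elim k)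
      then have "(norm (w (Suc k) z - w k z))\<^sup>2 \<le> (1/2)^k"
        by (simp add: g_def field_simps power_divide)
      then have "norm (w (Suc k) z - w k z) \<le> sqrt ((1/2)^k)" by (rule real_le_rsqrt)
      then show ?case by (simp add: real_sqrt_power)
    qed
    moreover have "summable (\<lambda>k. (sqrt (1/2))^k)"
      by (intro summable_geometric) (auto simp: real_sqrt_divide)
    ultimately have "summable (\<lambda>k. w (Suc k) z - w k z)" by (rule summable_comparison_test_ev)
    then have "convergent (\<lambda>n. \<Sum>k<n. w (Suc k) z - w k z)" by (simp add: summable_iff_convergent)
    then have "convergent (\<lambda>n. w n z - w 0 z)" by (simp add: sum_lessThan_telescope[of "\<lambda>k. w k z"])
    from convergent_add[OF this convergent_const[of "w 0 z"]] show ?case by simp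
  qed
  define x where "x z = lim (\<lambda>k. w k z)" for z
  have [measurable]: "x \<in> borel_measurable M" unfolding x_def by measurable
  have fatou: "(\<integral>\<^sup>+z. ennreal ((norm (x z - u m z))\<^sup>2) \<partial>M) \<le> ennreal (((1/2)^k)\<^sup>2)" if m: "m \<ge> N k" for k m
  proof -
    have "(\<integral>\<^sup>+z. ennreal ((norm (x z - u m z))\<^sup>2) \<partial>M) = (\<integral>\<^sup>+z. liminf (\<lambda>j. ennreal ((norm (w j z - u m z))\<^sup>2)) \<partial>M)"
    proof (rule nn_integral_cong_AE, use conv in eventually_elim)
      case (elim z)
      then have "(\<lambda>j. w j z) \<longlonglongrightarrow> x z" by (simp add: convergent_LIMSEQ_iff x_def)
      then have "(\<lambda>j. ennreal ((norm (w j z - u m z))\<^sup>2)) \<longlonglongrightarrow> ennreal ((norm (x z - u m z))\<^sup>2)"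
        by (intro tendsto_intros)
      from lim_imp_Liminf[OF trivial_limit_sequentially this] show ?case by simp
    qed
    also have "\<dots> \<le> liminf (\<lambda>j. \<integral>\<^sup>+z. ennreal ((norm (w j z - u m z))\<^sup>2) \<partial>M)"
      by (rule nn_integral_liminf) measurable
    also have "\<dots> \<le> ennreal (((1/2)^k)\<^sup>2)"
    proof (rule Liminf_le[OF _ eventually_sequentiallyI[of k]])
      fix j assume "k \<le> j"
      then have "r k \<le> r j" by (rule lift_Suc_mono_le[of r, OF r_mono])
      then have "N k \<le> r j" using r_ge[of k] by simp
      then show "(\<integral>\<^sup>+z. ennreal ((norm (w j z - u m z))\<^sup>2) \<partial>M) \<le> ennreal (((1/2)^k)\<^sup>2)"
        unfolding w_def nn using m N by (intro ennreal_leI power_mono) auto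
    qed simp
    finally show ?thesis .
  qed
  have diff: "(\<lambda>z. x z - u m z) \<in> L2 \<Omega>" if "m \<ge> N k" for k m
  proof -
    have "integrable M (\<lambda>z. (norm (x z - u m z))\<^sup>2)"
      using fatou[OF that] by (intro integrableI_bounded) (auto intro: order_le_less_trans)
    then show ?thesis by (simp add: L2_def M_def[symmetric])
  qed
  have x: "x \<in> L2 \<Omega>" using L2_add[OF diff[OF order_refl, of 0] u[of "N 0"]] by simp
  have le: "L2_norm \<Omega> (\<lambda>z. u m z - x z) \<le> (1/2)^k" if "m \<ge> N k" for k m
  proof -
    have "ennreal (\<integral>z. (norm (x z - u m z))\<^sup>2 \<partial>M) \<le> ennreal (((1/2)^k)\<^sup>2)"
      using fatou[OF that] L2_integrable[OF diff[OF that]]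
      by (subst nn_integral_eq_integral[symmetric]) (auto simp: M_def)
    then have "(\<integral>z. (norm (x z - u m z))\<^sup>2 \<partial>M) \<le> ((1/2)^k)\<^sup>2" by (simp add: ennreal_le_iff)
    then show ?thesis unfolding L2_norm_def M_def norm_minus_commute[of "u m _"]
      by (intro real_le_lsqrt) auto
  qed
  have "(\<lambda>n. L2_norm \<Omega> (\<lambda>z. u n z - x z)) \<longlonglongrightarrow> 0"
  proof (rule LIMSEQ_I)
    fix e :: real assume "e > 0"
    then obtain k where k: "(1/2)^k < e" using real_arch_pow_inv[of e "1/2"] by auto
    show "\<exists>no. \<forall>n\<ge>no. norm (L2_norm \<Omega> (\<lambda>z. u n z - x z) - 0) < e"
      using le[of k] k by (intro exI[of _ "N k"]) fastforce
  qed
  with x show ?thesis by blast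
qed

section \<open>Smooth functions\<close>

lemma partial_eq: "(f has_derivative f') (at x) \<Longrightarrow> partial i f x = f' (axis i 1)"
  unfolding partial_def by (simp add: frechet_derivative_at[symmetric])

text \<open>\<open>smooth\<close> quantifies over all lists of directions; exhibiting a set of
  differentiable functions that is stable under \<open>partial\<close> avoids any formula for higher
  derivatives.\<close>

lemma smooth_coinduct:
  assumes "f \<in> S"
    and "\<And>g x. g \<in> S \<Longrightarrow> g differentiable (at x)"
    and "\<And>g i. g \<in> S \<Longrightarrow> partial i g \<in> S"
  shows "smooth f"
proof -
  have "iter_partial is f \<in> S" for "is" by (induction "is") (auto intro: assms)
  then show ?thesis using assms(2) by (auto simp: smooth_def)
qed

lemma smooth_differentiable: "smooth f \<Longrightarrow> f differentiable (at x)"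
  unfolding smooth_def by (metis iter_partial.simps(1))

lemma iter_partial_append: "iter_partial (is @ js) f = iter_partial is (iter_partial js f)"
  by (induction "is") auto

lemma smooth_partial: "smooth f \<Longrightarrow> smooth (partial i f)"
  unfolding smooth_def
proof (intro allI)
  fix "is" x assume "\<forall>is x. iter_partial is f differentiable (at x)"
  then have "iter_partial (is @ [i]) f differentiable (at x)" by blast
  then show "iter_partial is (partial i f) differentiable (at x)" by (simp add: iter_partial_append)
qed

lemma smooth_has_derivative: "smooth f \<Longrightarrow> (f has_derivative frechet_derivative f (at x)) (at x)"
  using smooth_differentiable frechet_derivative_works by blast

lemma smooth_continuous_on: "smooth f \<Longrightarrow> continuous_on S f"
  by (meson continuous_at_imp_continuous_on differentiable_imp_continuous_within smooth_differentiable)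

lemma partial_add:
  "smooth f \<Longrightarrow> smooth g \<Longrightarrow> partial i (\<lambda>x. f x + g x) = (\<lambda>x. partial i f x + partial i g x)"
  by (rule ext, subst partial_eq[OF has_derivative_add[OF smooth_has_derivative smooth_has_derivative]])
    (auto simp: partial_def)

lemma partial_mult:
  fixes f g :: "real^'d::finite \<Rightarrow> 'b::real_normed_algebra"
  shows "smooth f \<Longrightarrow> smooth g \<Longrightarrow>
    partial i (\<lambda>x. f x * g x) = (\<lambda>x. f x * partial i g x + partial i f x * g x)"
  by (rule ext, subst partial_eq[OF has_derivative_mult[OF smooth_has_derivative smooth_has_derivative]])
    (auto simp: partial_def)

lemma partial_of_real:
  "smooth f \<Longrightarrow> partial i (\<lambda>x. of_real (f x) :: 'b::real_normed_algebra_1) = (\<lambda>x. of_real (partial i f x))"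
  by (rule ext, subst partial_eq[OF has_derivative_of_real[OF smooth_has_derivative]]) (auto simp: partial_def)

lemma partial_exp:
  fixes f :: "real^'d::finite \<Rightarrow> real"
  shows "smooth f \<Longrightarrow> partial i (\<lambda>x. exp (s * f x)) = (\<lambda>x. s * (partial i f x * exp (s * f x)))"
  by (rule ext, rule trans, rule partial_eq, (rule derivative_intros smooth_has_derivative | assumption)+)
    (simp add: partial_def)

lemma smooth_const [simp]: "smooth (\<lambda>x :: real^'d::finite. c :: 'b::real_normed_vector)"
proof (rule smooth_coinduct[of _ "range (\<lambda>c x. c)"])
  have "partial i (\<lambda>x :: real^'d. c :: 'b) = (\<lambda>x. 0)" for i c
    by (rule ext, rule partial_eq) simp
  then show "\<And>g i. g \<in> range (\<lambda>(c::'b) (x :: real^'d). c) \<Longrightarrow> partial i g \<in> range (\<lambda>c x. c)" by auto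
qed auto

lemma smooth_add:
  assumes "smooth f" "smooth g"
  shows "smooth (\<lambda>x. f x + g x)"
proof (rule smooth_coinduct[of _ "{\<lambda>x. f x + g x |f g. smooth f \<and> smooth g}"])
  show "partial i h \<in> {\<lambda>x. f x + g x |f g. smooth f \<and> smooth g}"
    if "h \<in> {\<lambda>x. f x + g x |f g. smooth f \<and> smooth g}" for h :: "real^'a \<Rightarrow> 'b" and i
    using that smooth_partial[of _ i] partial_add[of _ _ i] by fastforce
qed (use assms in \<open>auto intro: differentiable_add[OF smooth_differentiable smooth_differentiable]\<close>)

text \<open>The Leibniz rule turns one product into two, so sums have to be included to obtain a
  family stable under \<open>partial\<close>.\<close>

inductive_set mult_span :: "(real^'d::finite \<Rightarrow> 'b::real_normed_algebra) set" where
  mult: "smooth f \<Longrightarrow> smooth g \<Longrightarrow> (\<lambda>x. f x * g x) \<in> mult_span"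
| add: "h \<in> mult_span \<Longrightarrow> k \<in> mult_span \<Longrightarrow> (\<lambda>x. h x + k x) \<in> mult_span"

lemma mult_span_closed: "h \<in> mult_span \<Longrightarrow> (\<forall>x. h differentiable (at x)) \<and> partial i h \<in> mult_span"
proof (induction rule: mult_span.induct)
  case (mult f g)
  then show ?case
    by (auto simp: partial_mult smooth_differentiable intro!: differentiable_mult mult_span.intros smooth_partial)
next
  case (add h k)
  then have hk: "((\<lambda>x. h x + k x) has_derivative (\<lambda>y. frechet_derivative h (at x) y + frechet_derivative k (at x) y)) (at x)" for x
    by (intro has_derivative_add) (auto simp: frechet_derivative_works)
  then have "partial i (\<lambda>x. h x + k x) = (\<lambda>x. partial i h x + partial i k x)"
    by (intro ext, subst partial_eq[OF hk]) (simp add: partial_def)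
  with add show ?case by (auto intro: mult_span.add)
qed

lemma smooth_mult:
  fixes f g :: "real^'d::finite \<Rightarrow> 'b::real_normed_algebra"
  shows "smooth f \<Longrightarrow> smooth g \<Longrightarrow> smooth (\<lambda>x. f x * g x)"
  by (rule smooth_coinduct[of _ mult_span]) (use mult_span_closed mult_span.mult in blast)+

lemma smooth_of_real: "smooth f \<Longrightarrow> smooth (\<lambda>x. of_real (f x) :: 'b::real_normed_algebra_1)"
  by (rule smooth_coinduct[of _ "{\<lambda>x. of_real (f x) |f. smooth f}"])
    (auto simp: partial_of_real intro: smooth_partial differentiableI has_derivative_of_real smooth_has_derivative)

lemma smooth_exp:
  fixes f :: "real^'d::finite \<Rightarrow> real"
  assumes f: "smooth f"
  shows "smooth (\<lambda>x. exp (s * f x))"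
\<comment> \<open>Each derivative only changes the factor \<open>g\<close>, into
  \<open>s * (partial i f * g) + partial i g\<close>, so multiples of the fixed exponential are
  stable under differentiation.\<close>
proof (rule smooth_coinduct[of _ "{\<lambda>x. exp (s * f x) * g x |g. smooth g}"])
  have d: "(\<lambda>x. exp (s * f x)) differentiable (at x)" for x
    by (rule differentiableI) (rule derivative_intros smooth_has_derivative f)+
  show "h differentiable (at x)" if "h \<in> {\<lambda>x. exp (s * f x) * g x |g. smooth g}" for h x
    using that by (auto intro: differentiable_mult[OF d smooth_differentiable])
  show "partial i h \<in> {\<lambda>x. exp (s * f x) * g x |g. smooth g}"
    if h: "h \<in> {\<lambda>x. exp (s * f x) * g x |g. smooth g}" for h i
  proof -
    obtain g where g: "h = (\<lambda>x. exp (s * f x) * g x)" "smooth g" using h by blast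
    have "partial i h x = exp (s * f x) * (s * (partial i f x * g x) + partial i g x)" for x
    proof -
      have "(h has_derivative (\<lambda>y. exp (s * f x) * frechet_derivative g (at x) y
          + (exp (s * f x) * (s * frechet_derivative f (at x) y)) * g x)) (at x)"
        unfolding g(1)
        by (rule has_derivative_eq_rhs, (rule derivative_intros smooth_has_derivative f g)+) (simp add: algebra_simps)
      then show ?thesis by (subst partial_eq) (auto simp: partial_def algebra_simps)
    qed
    moreover have "smooth (\<lambda>x. s * (partial i f x * g x) + partial i g x)"
      using f g by (intro smooth_add smooth_mult smooth_const smooth_partial)
    ultimately show ?thesis
      by (intro CollectI exI[of _ "\<lambda>x. s * (partial i f x * g x) + partial i g x"]) auto
  qed
qed (auto intro!: exI[of _ "\<lambda>_. 1"])

lemma smooth_prod: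
  fixes f :: "'i \<Rightarrow> real^'d::finite \<Rightarrow> real"
  shows "(\<And>i. i \<in> I \<Longrightarrow> smooth (f i)) \<Longrightarrow> smooth (\<lambda>x. \<Prod>i\<in>I. f i x)"
  by (induction I rule: infinite_finite_induct) (auto intro!: smooth_mult)

lemma smooth_sum:
  fixes f :: "'i \<Rightarrow> real^'d::finite \<Rightarrow> real"
  shows "(\<And>i. i \<in> I \<Longrightarrow> smooth (f i)) \<Longrightarrow> smooth (\<lambda>x. \<Sum>i\<in>I. f i x)"
  by (induction I rule: infinite_finite_induct) (auto intro!: smooth_add)

subsection \<open>Bump functions\<close>

text \<open>\<open>exp (- s / t)\<close> continued by zero, together with the powers of
  \<open>1 / t\<close> that differentiation produces. The parameter \<open>s\<close> is used later:
  as it decreases to zero, \<open>flat s 0\<close> tends to the indicator of the positive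
  half-line.\<close>

definition flat :: "real \<Rightarrow> nat \<Rightarrow> real \<Rightarrow> real" where
  "flat s k t = (if t \<le> 0 then 0 else (1 / t) ^ k * exp (- s / t))"

lemma flat_has_derivative:
  assumes "s > 0"
  shows "(flat s k has_real_derivative (s * flat s (k + 2) t - k * flat s (k + 1) t)) (at t)"
proof -
  consider "t < 0" | "t > 0" | "t = 0" by linarith
  then show ?thesis
  proof cases
    case 1
    then have "eventually (\<lambda>y. y < 0) (nhds t)" by (intro eventually_nhds_in_open[of "{..<0}", simplified]) auto
    then have "eventually (\<lambda>y. flat s k y = 0) (nhds t)" by eventually_elim (simp add: flat_def)
    then have "(flat s k has_real_derivative 0) (at t)" by (subst DERIV_cong_ev[OF refl _ refl]) auto
    then show ?thesis using 1 by (simp add: flat_def)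
  next
    case 2
    then have "eventually (\<lambda>y. y > 0) (nhds t)" by (intro eventually_nhds_in_open[of "{0<..}", simplified]) auto
    then have ev: "eventually (\<lambda>y. flat s k y = (1 / y) ^ k * exp (- s / y)) (nhds t)"
      by eventually_elim (simp add: flat_def)
    have d: "((\<lambda>y. 1 / y) has_real_derivative - ((1 / t)\<^sup>2)) (at t)"
      using 2 by (auto intro!: derivative_eq_intros simp: power2_eq_square)
    have "((\<lambda>y. (1 / y) ^ k * exp (- s * (1 / y))) has_real_derivative
        (1 / t) ^ k * (exp (- s * (1 / t)) * (- s * - ((1 / t)\<^sup>2)))
        + (real k * (- ((1 / t)\<^sup>2) * (1 / t) ^ (k - Suc 0))) * exp (- s * (1 / t))) (at t)"
      by (intro DERIV_mult' DERIV_fun_exp DERIV_power DERIV_cmult d)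
    moreover have "(1 / t) ^ k * (exp (- s * (1 / t)) * (- s * - ((1 / t)\<^sup>2)))
        + (real k * (- ((1 / t)\<^sup>2) * (1 / t) ^ (k - Suc 0))) * exp (- s * (1 / t))
      = s * flat s (k + 2) t - k * flat s (k + 1) t"
      using 2 by (cases k) (simp_all add: flat_def power2_eq_square algebra_simps)
    ultimately have "((\<lambda>y. (1 / y) ^ k * exp (- s / y)) has_real_derivative
        (s * flat s (k + 2) t - k * flat s (k + 1) t)) (at t)" by simp
    then show ?thesis by (subst DERIV_cong_ev[OF refl ev refl])
  next
    case 3
    \<comment> \<open>The difference quotient at 0 from the right becomes
      \<open>y ^ Suc k / exp (s * y)\<close> after replacing the variable by its inverse, and tends
      to zero as \<open>y\<close> grows.\<close>
    have "((\<lambda>y. (s * y) ^ Suc k / exp (s * y)) \<longlongrightarrow> 0) at_top"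
      using assms by (intro filterlim_compose[OF tendsto_power_div_exp_0]
          filterlim_tendsto_pos_mult_at_top[OF tendsto_const] filterlim_ident)
    from tendsto_mult_right_zero[OF this, of "1 / s ^ Suc k"]
    have "((\<lambda>y. y ^ Suc k / exp (s * y)) \<longlongrightarrow> 0) at_top"
      using assms by (simp add: power_mult_distrib)
    from filterlim_compose[OF this filterlim_inverse_at_top_right]
    have "((\<lambda>y. inverse y ^ Suc k / exp (s * inverse y)) \<longlongrightarrow> 0) (at_right 0)" .
    moreover have "eventually (\<lambda>y. inverse y ^ Suc k / exp (s * inverse y) = flat s k y / y) (at_right 0)"
      by (rule eventually_at_right_less[THEN eventually_mono]) (simp add: flat_def exp_minus field_simps)
    ultimately have "((\<lambda>y. flat s k y / y) \<longlongrightarrow> 0) (at_right 0)"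
      by (rule Lim_transform_eventually)
    moreover have "((\<lambda>y. flat s k y / y) \<longlongrightarrow> 0) (at_left 0)"
      by (rule tendsto_eventually) (auto simp: flat_def eventually_at_left_field intro: exI[of _ "-1"])
    ultimately have "((\<lambda>y. flat s k y / y) \<longlongrightarrow> 0) (at 0)" by (simp add: filterlim_split_at)
    then show ?thesis using 3 by (simp add: has_field_derivative_iff flat_def)
  qed
qed

text \<open>Linear combinations of the \<open>flat s k\<close> along one coordinate. The affine
  argument allows both orientations, \<open>x $ i - a $ i\<close> and \<open>b $ i - x $ i\<close>,
  which describe two opposite faces of a box.\<close>

inductive_set flat_span :: "real \<Rightarrow> real \<Rightarrow> real \<Rightarrow> 'd \<Rightarrow> (real^'d::finite \<Rightarrow> real) set"
  for s p q :: real and i :: 'd where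
  base: "(\<lambda>x. c * flat s k (p * x $ i + q)) \<in> flat_span s p q i"
| add: "h \<in> flat_span s p q i \<Longrightarrow> k \<in> flat_span s p q i \<Longrightarrow> (\<lambda>x. h x + k x) \<in> flat_span s p q i"

lemma flat_span_closed:
  assumes "s > 0"
  shows "h \<in> flat_span s p q i \<Longrightarrow> (\<forall>x. h differentiable (at x)) \<and> partial j h \<in> flat_span s p q i"
proof (induction rule: flat_span.induct)
  case (base c k)
  let ?D = "\<lambda>x. s * flat s (k + 2) (p * x $ i + q) - k * flat s (k + 1) (p * x $ i + q)"
  have d: "((\<lambda>x. c * flat s k (p * x $ i + q)) has_derivative (\<lambda>y. c * (?D x * (p * y $ i)))) (at x)" for x :: "real^'a"
  proof -
    have "((\<lambda>x::real^'a. p * x $ i + q) has_derivative (\<lambda>y. p * y $ i)) (at x)"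
      by (auto intro!: derivative_eq_intros bounded_linear.has_derivative[OF bounded_linear_vec_nth])
    from has_derivative_compose[OF this flat_has_derivative[OF assms, unfolded has_field_derivative_def]]
    show ?thesis by (intro has_derivative_mult_right) (simp add: mult.commute)
  qed
  define e where "e = c * p * axis j (1::real) $ i"
  have "partial j (\<lambda>x. c * flat s k (p * x $ i + q)) = (\<lambda>x. c * (?D x * (p * axis j 1 $ i)))"
    by (intro ext, subst partial_eq[OF d]) simp
  also have "\<dots> = (\<lambda>x. (e * s) * flat s (k + 2) (p * x $ i + q) + (- e * k) * flat s (k + 1) (p * x $ i + q))"
    by (simp add: e_def algebra_simps)
  also have "\<dots> \<in> flat_span s p q i" by (intro flat_span.intros)
  finally show ?case using differentiableI[OF d] by blast
next
  case (add h k)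
  then have hk: "((\<lambda>x. h x + k x) has_derivative (\<lambda>y. frechet_derivative h (at x) y + frechet_derivative k (at x) y)) (at x)" for x
    by (intro has_derivative_add) (auto simp: frechet_derivative_works)
  then have "partial j (\<lambda>x. h x + k x) = (\<lambda>x. partial j h x + partial j k x)"
    by (intro ext, subst partial_eq[OF hk]) (simp add: partial_def)
  with add show ?case by (auto intro: flat_span.add)
qed

lemma smooth_flat:
  assumes "s > 0"
  shows "smooth (\<lambda>x :: real^'d::finite. flat s 0 (p * x $ i + q))"
  by (rule smooth_coinduct[of _ "flat_span s p q i"])
    (use flat_span_closed[OF assms] flat_span.base[of 1 s 0 p i q] in \<open>simp_all, blast+\<close>)

text \<open>Positive exactly on the open box. The case \<open>s = 1\<close> serves the separation of
  compact sets, and small positive \<open>s\<close> approximates the indicator of the box from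
  below.\<close>

definition bump :: "real \<Rightarrow> real^'d::finite \<Rightarrow> real^'d \<Rightarrow> real^'d \<Rightarrow> real" where
  "bump s a b x = (\<Prod>i\<in>UNIV. flat s 0 (x $ i - a $ i) * flat s 0 (b $ i - x $ i))"

lemma smooth_bump: "s > 0 \<Longrightarrow> smooth (bump s a b)"
proof -
  assume "s > 0"
  then have "smooth (\<lambda>x. flat s 0 (1 * x $ i + (- a $ i)) * flat s 0 ((-1) * x $ i + b $ i))" for i
    by (intro smooth_mult smooth_flat)
  then have "smooth (\<lambda>x. \<Prod>i\<in>UNIV. flat s 0 (1 * x $ i + (- a $ i)) * flat s 0 ((-1) * x $ i + b $ i))"
    by (intro smooth_prod)
  then show ?thesis by (simp add: bump_def[abs_def])
qed

lemma flat_0: "flat s 0 t = (if t \<le> 0 then 0 else exp (- s / t))"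
  by (simp add: flat_def)

lemma bump_nonneg: "0 \<le> bump s a b x"
  by (auto simp: bump_def flat_0 intro!: prod_nonneg)

lemma bump_pos:
  assumes "x \<in> box a b"
  shows "0 < bump s a b x"
proof -
  have "\<not> x $ i - a $ i \<le> 0" "\<not> b $ i - x $ i \<le> 0" for i
    using assms by (auto simp: mem_box_cart not_le)
  then show ?thesis unfolding bump_def flat_0 by (intro prod_pos) simp
qed

lemma bump_eq_0:
  assumes "x \<notin> box a b"
  shows "bump s a b x = 0"
proof -
  obtain i where "x $ i - a $ i \<le> 0 \<or> b $ i - x $ i \<le> 0"
    using assms by (auto simp: mem_box_cart not_less)
  then show ?thesis unfolding bump_def by (intro prod_zero[OF finite]) (auto simp: flat_0)
qed

lemma bump_le_1: "s > 0 \<Longrightarrow> bump s a b x \<le> 1"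
  unfolding bump_def by (rule prod_le_1) (auto simp: flat_0 intro!: mult_le_one)

lemma bump_tendsto: "(\<lambda>n. bump (1 / Suc n) a b x) \<longlonglongrightarrow> indicator (box a b) x"
proof (cases "x \<in> box a b")
  case True
  have *: "(\<lambda>n. flat (1 / Suc n) 0 t) \<longlonglongrightarrow> 1" if "t > 0" for t
  proof -
    have "(\<lambda>n. exp (- (1 / Suc n) / t)) \<longlonglongrightarrow> exp (- 0 / t)"
      using that by (intro tendsto_intros LIMSEQ_Suc[OF lim_1_over_n]) auto
    then show ?thesis using that by (simp add: flat_0)
  qed
  have "(\<lambda>n. bump (1 / Suc n) a b x) \<longlonglongrightarrow> (\<Prod>i\<in>(UNIV::'a set). 1 * 1)"
    unfolding bump_def using True by (intro tendsto_prod tendsto_mult *) (auto simp: mem_box_cart)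
  then show ?thesis using True by simp
qed (simp add: bump_eq_0)

lemma bump_Cc_infty:
  assumes "s > 0" "cbox a b \<subseteq> \<Omega>"
  shows "(\<lambda>x. of_real (bump s a b x)) \<in> Cc_infty \<Omega>"
proof -
  have "{x. complex_of_real (bump s a b x) \<noteq> 0} \<subseteq> cbox a b"
    using bump_eq_0 box_subset_cbox by fastforce
  then have *: "closure {x. complex_of_real (bump s a b x) \<noteq> 0} \<subseteq> cbox a b"
    by (intro closure_minimal) auto
  then have "compact (closure {x. complex_of_real (bump s a b x) \<noteq> 0})"
    unfolding compact_eq_bounded_closed using bounded_subset[OF bounded_cbox] by blast
  with * show ?thesis using assms by (auto simp: Cc_infty_def intro!: smooth_of_real smooth_bump)
qed

lemma partial_eq_0:
  assumes "open U" "x \<in> U" "\<And>y. y \<in> U \<Longrightarrow> f y = 0"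
  shows "partial i f x = 0"
proof -
  have "(f has_derivative (\<lambda>y. 0)) (at x)"
    by (rule has_derivative_transform_within_open[of "\<lambda>y. 0"]) (use assms in auto)
  then show ?thesis by (simp add: partial_eq)
qed

text \<open>All iterated derivatives vanish off \<open>K\<close> because its complement is open, and
  they are continuous on the compact set \<open>K\<close>.\<close>

lemma Cb_inftyI:
  assumes f: "smooth f" and K: "compact K" "\<And>x. x \<notin> K \<Longrightarrow> f x = 0"
  shows "f \<in> Cb_infty"
proof -
  have "iter_partial is f x = 0" if "x \<notin> K" for "is" x
    using that
  proof (induction "is" arbitrary: x)
    case (Cons i "is")
    show ?case unfolding iter_partial.simps
      by (rule partial_eq_0[of "- K"]) (use Cons K compact_imp_closed in auto)
  qed (use K in auto)
  then have *: "range (iter_partial is f) \<subseteq> insert 0 (iter_partial is f ` K)" for "is" by blast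
  have "bounded (range (iter_partial is f))" for "is"
  proof (rule bounded_subset[OF _ *])
    have "continuous_on K (iter_partial is f)"
      using f unfolding smooth_def
      by (meson continuous_at_imp_continuous_on differentiable_imp_continuous_within)
    then show "bounded (insert 0 (iter_partial is f ` K))"
      using K compact_imp_bounded compact_continuous_image by (subst bounded_insert) blast
  qed
  with f show ?thesis by (simp add: Cb_infty_def)
qed

text \<open>Each point of \<open>L\<close> has a box around it whose closure misses
  \<open>K\<close>; finitely many suffice, and the sum of their bumps is positive on
  \<open>L\<close>, hence bounded below there by compactness.\<close>

lemma smooth_separation:
  fixes K L :: "(real^'d::finite) set"
  assumes K: "compact K" and L: "compact L" and "K \<inter> L = {}"
  obtains \<psi> \<delta> where "\<psi> \<in> Cb_infty" "\<And>x. 0 \<le> \<psi> x" "\<And>x. x \<in> K \<Longrightarrow> \<psi> x = 0" "\<delta> > 0" "\<And>x. x \<in> L \<Longrightarrow> \<delta> \<le> \<psi> x"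
proof -
  have op: "open (- K)" using K compact_imp_closed by blast
  have "\<exists>a b. x \<in> box a b \<and> cbox a b \<subseteq> - K" if "x \<in> L" for x
  proof -
    have "x \<in> - K" using that assms(3) by blast
    from open_contains_cbox[OF op this] show ?thesis by metis
  qed
  then obtain A B where AB: "\<And>x. x \<in> L \<Longrightarrow> x \<in> box (A x) (B x) \<and> cbox (A x) (B x) \<subseteq> - K" by metis
  obtain F where F: "F \<subseteq> L" "finite F" "L \<subseteq> (\<Union>x\<in>F. box (A x) (B x))"
    by (rule compactE_image[OF L, of L "\<lambda>x. box (A x) (B x)"]) (use AB in auto)
  define \<psi> where "\<psi> y = (\<Sum>x\<in>F. bump 1 (A x) (B x) y)" for y
  have sm: "smooth \<psi>" unfolding \<psi>_def by (intro smooth_sum smooth_bump) auto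
  have nonneg: "0 \<le> \<psi> x" for x unfolding \<psi>_def by (intro sum_nonneg bump_nonneg)
  have pos: "0 < \<psi> y" if y: "y \<in> L" for y
  proof -
    obtain x where x: "x \<in> F" "y \<in> box (A x) (B x)" using F y by blast
    show ?thesis unfolding \<psi>_def
      by (rule sum_pos2[of F x]) (use F x in \<open>auto intro: bump_pos bump_nonneg\<close>)
  qed
  have zero: "\<psi> y = 0" if "y \<notin> (\<Union>x\<in>F. cbox (A x) (B x))" for y
    unfolding \<psi>_def using that box_subset_cbox by (intro sum.neutral) (auto intro!: bump_eq_0)
  have "\<psi> \<in> Cb_infty"
    using F by (intro Cb_inftyI[OF sm _ zero, of "\<Union>x\<in>F. cbox (A x) (B x)"] compact_UN) auto
  moreover have "\<psi> x = 0" if "x \<in> K" for x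
    using AB F(1) that by (intro zero) blast
  moreover obtain \<delta> where "\<delta> > 0" "\<And>x. x \<in> L \<Longrightarrow> \<delta> \<le> \<psi> x"
  proof (cases "L = {}")
    case False
    obtain x0 where "x0 \<in> L" "\<forall>x\<in>L. \<psi> x0 \<le> \<psi> x"
      using continuous_attains_inf[OF L False smooth_continuous_on[OF sm]] by blast
    then show ?thesis using that[of "\<psi> x0"] pos by blast
  qed (use that[of 1] in auto)
  ultimately show ?thesis using that nonneg by blast
qed

section \<open>Weak derivatives\<close>

lemma L2_indicator:
  assumes "open \<Omega>" "bounded S" "S \<in> sets lebesgue"
  shows "indicator S \<in> L2 \<Omega>"
proof -
  have "integrable lebesgue (indicator S :: _ \<Rightarrow> real)"
    using bounded_set_imp_lmeasurable[OF assms(2,3)] by (auto simp: fmeasurable_def intro: integrable_real_indicator)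
  then have "integrable (lebesgue_on \<Omega>) (indicator S :: _ \<Rightarrow> real)"
    using assms(1) integrable_mult_indicator[of \<Omega> lebesgue "indicator S :: _ \<Rightarrow> real"]
    by (subst integrable_restrict_space) auto
  moreover have "(norm (indicator S x :: complex))\<^sup>2 = indicator S x" for x by (simp add: indicator_def)
  moreover have "indicator S \<in> borel_measurable (lebesgue_on \<Omega>)"
    using assms(3) by (intro measurable_restrict_space1) auto
  ultimately show ?thesis by (simp add: L2_def)
qed

lemma smooth_measurable:
  fixes f :: "real^'d::finite \<Rightarrow> 'b::euclidean_space"
  assumes "open \<Omega>" "smooth f"
  shows "f \<in> borel_measurable (lebesgue_on \<Omega>)"
  using assms by (intro continuous_imp_measurable_on_sets_lebesgue smooth_continuous_on) auto

lemma Cc_infty_L2: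
  assumes "open \<Omega>" "\<phi> \<in> Cc_infty \<Omega>"
  shows "\<phi> \<in> L2 \<Omega>"
proof -
  define K where "K = closure {x. \<phi> x \<noteq> 0}"
  have K: "compact K" "smooth \<phi>" using assms(2) by (auto simp: Cc_infty_def K_def)
  have eq: "\<phi> = (\<lambda>x. \<phi> x * indicator K x)"
    using closure_subset[of "{x. \<phi> x \<noteq> 0}"] by (force simp: K_def indicator_def)
  have "bounded (\<phi> ` K)"
    using K by (intro compact_imp_bounded compact_continuous_image smooth_continuous_on)
  then obtain B where B: "\<And>x. x \<in> K \<Longrightarrow> norm (\<phi> x) \<le> B" by (auto simp: bounded_iff)
  have "norm (\<phi> x) \<le> max B 0" for x
    using B[of x] closure_subset[of "{x. \<phi> x \<noteq> 0}"] by (cases "\<phi> x = 0") (auto simp: K_def)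
  then have "(\<lambda>x. \<phi> x * indicator K x) \<in> L2 \<Omega>"
    using K assms(1) by (intro L2_bounded_mult smooth_measurable L2_indicator)
      (auto intro: compact_imp_bounded lmeasurable_compact fmeasurableD)
  with eq show ?thesis by simp
qed

lemma partial_Cc_infty:
  assumes "\<phi> \<in> Cc_infty \<Omega>"
  shows "partial i \<phi> \<in> Cc_infty \<Omega>"
proof -
  define K where "K = closure {x. \<phi> x \<noteq> 0}"
  have K: "compact K" "K \<subseteq> \<Omega>" "smooth \<phi>" using assms by (auto simp: Cc_infty_def K_def)
  have "partial i \<phi> x = 0" if "x \<notin> K" for x
    using that K(1) closure_subset[of "{x. \<phi> x \<noteq> 0}"]
    by (intro partial_eq_0[of "- K"]) (auto simp: K_def)
  then have *: "closure {x. partial i \<phi> x \<noteq> 0} \<subseteq> K"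
    using K(1) by (intro closure_minimal compact_imp_closed) auto
  then have "compact (closure {x. partial i \<phi> x \<noteq> 0})"
    using K(1) unfolding compact_eq_bounded_closed using bounded_subset by blast
  with * K show ?thesis by (auto simp: Cc_infty_def smooth_partial)
qed

lemma mult_Cc_infty:
  assumes "\<phi> \<in> Cc_infty \<Omega>" "smooth m"
  shows "(\<lambda>x. m x * \<phi> x) \<in> Cc_infty \<Omega>"
proof -
  have *: "closure {x. m x * \<phi> x \<noteq> 0} \<subseteq> closure {x. \<phi> x \<noteq> 0}" by (intro closure_mono) auto
  then have "compact (closure {x. m x * \<phi> x \<noteq> 0})"
    using assms(1) unfolding compact_eq_bounded_closed Cc_infty_def using bounded_subset by blast
  with * assms show ?thesis by (auto simp: Cc_infty_def smooth_mult)
qed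

text \<open>Bumps converge to indicators of boxes, so the integral of \<open>g\<close> over every
  box with closure in \<open>\<Omega>\<close> vanishes; Lebesgue's differentiation theorem then
  recovers \<open>g\<close> from averages over small cubes.\<close>

lemma fundamental_lemma:
  fixes \<Omega> :: "(real^'d::finite) set"
  assumes \<Omega>: "open \<Omega>" and g: "g \<in> L2 \<Omega>"
    and zero: "\<And>\<phi>. \<phi> \<in> Cc_infty \<Omega> \<Longrightarrow> (LINT x|lebesgue_on \<Omega>. g x * \<phi> x) = 0"
  shows "AE x in lebesgue_on \<Omega>. g x = 0"
proof -
  have sets [simp]: "\<Omega> \<in> sets lebesgue" using \<Omega> by auto
  have box: "(LINT x|lebesgue_on \<Omega>. g x * indicator (box a b) x) = 0" if ab: "cbox a b \<subseteq> \<Omega>" for a b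
  proof -
    have "(\<lambda>n. LINT x|lebesgue_on \<Omega>. g x * of_real (bump (1 / Suc n) a b x))
        \<longlonglongrightarrow> (LINT x|lebesgue_on \<Omega>. g x * indicator (box a b) x)"
    proof (rule integral_dominated_convergence)
      have i: "indicator (box a b) \<in> L2 \<Omega>" by (intro L2_indicator \<Omega> bounded_box) auto
      show "integrable (lebesgue_on \<Omega>) (\<lambda>x. norm (g x * indicator (box a b) x))"
        by (intro integrable_norm L2_mult_integrable g i)
      show "(\<lambda>x. g x * indicator (box a b) x) \<in> borel_measurable (lebesgue_on \<Omega>)"
        by (intro borel_measurable_times L2_measurable g i)
      show "(\<lambda>x. g x * of_real (bump (1 / Suc n) a b x)) \<in> borel_measurable (lebesgue_on \<Omega>)" for n
        by (intro borel_measurable_times L2_measurable g smooth_measurable \<Omega> smooth_of_real smooth_bump) auto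
      show "AE x in lebesgue_on \<Omega>. (\<lambda>n. g x * of_real (bump (1 / Suc n) a b x)) \<longlonglongrightarrow> g x * indicator (box a b) x"
      proof (rule AE_I2)
        fix x
        have "(\<lambda>n. complex_of_real (bump (1 / Suc n) a b x)) \<longlonglongrightarrow> of_real (indicator (box a b) x)"
          by (intro tendsto_of_real bump_tendsto)
        then show "(\<lambda>n. g x * of_real (bump (1 / Suc n) a b x)) \<longlonglongrightarrow> g x * indicator (box a b) x"
          by (intro tendsto_intros) (simp add: of_real_indicator)
      qed
      show "AE x in lebesgue_on \<Omega>. norm (g x * of_real (bump (1 / Suc n) a b x)) \<le> norm (g x * indicator (box a b) x)" for n
      proof (rule AE_I2)
        fix x show "norm (g x * of_real (bump (1 / Suc n) a b x)) \<le> norm (g x * indicator (box a b) x)"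
          using bump_nonneg[of "1 / Suc n" a b x] bump_le_1[of "1 / Suc n" a b x] bump_eq_0[of x a b "1 / Suc n"]
          by (cases "x \<in> box a b") (auto simp: norm_mult intro: mult_left_le)
      qed
    qed
    moreover have "(LINT x|lebesgue_on \<Omega>. g x * of_real (bump (1 / Suc n) a b x)) = 0" for n
      by (intro zero bump_Cc_infty ab) auto
    ultimately have "(\<lambda>n. 0) \<longlonglongrightarrow> (LINT x|lebesgue_on \<Omega>. g x * indicator (box a b) x)" by (simp only:)
    then show ?thesis by (simp add: LIMSEQ_const_iff)
  qed
  \<comment> \<open>Extension by zero, since the differentiation theorem is applied to a function
    integrable on every box of the whole space.\<close>
  define F where "F x = indicator \<Omega> x *\<^sub>R g x" for x
  have F_abs: "F absolutely_integrable_on S" if S: "bounded S" "S \<in> sets lebesgue" for S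
  proof -
    have "integrable (lebesgue_on \<Omega>) (\<lambda>x. g x * indicator S x)"
      by (intro L2_mult_integrable g L2_indicator \<Omega> S)
    then have "integrable lebesgue (\<lambda>x. indicator \<Omega> x *\<^sub>R (g x * indicator S x))"
      by (subst (asm) integrable_restrict_space) auto
    moreover have "indicator \<Omega> x *\<^sub>R (g x * indicator S x) = indicator S x *\<^sub>R F x" for x
      by (simp add: F_def indicator_def)
    ultimately show ?thesis by (simp add: set_integrable_def)
  qed
  have F0: "integral (cbox a b) F = 0" if ab: "cbox a b \<subseteq> \<Omega>" for a b
  proof -
    have "integral (cbox a b) F = integral (box a b) F" by (simp add: integral_open_interval)
    also have "\<dots> = (LINT x:box a b|lebesgue. F x)"
      by (intro set_lebesgue_integral_eq_integral(2)[symmetric] F_abs bounded_box) auto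
    also have "\<dots> = (LINT x|lebesgue. indicator \<Omega> x *\<^sub>R (g x * indicator (box a b) x))"
      unfolding set_lebesgue_integral_def F_def by (intro Bochner_Integration.integral_cong) (auto simp: indicator_def)
    also have "\<dots> = (LINT x|lebesgue_on \<Omega>. g x * indicator (box a b) x)"
      by (subst integral_restrict_space) auto
    finally show ?thesis using box[OF ab] by simp
  qed
  have "F integrable_on cbox a b" for a b
    by (intro set_lebesgue_integral_eq_integral(1) F_abs bounded_cbox) auto
  then obtain N where N: "negligible N" "\<And>x e. \<lbrakk>x \<notin> N; 0 < e\<rbrakk> \<Longrightarrow> \<exists>d>0. \<forall>h. 0 < h \<and> h < d \<longrightarrow>
      norm (integral (cbox x (x + h *\<^sub>R One)) F /\<^sub>R h ^ DIM(real^'d) - F x) < e"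
    using integrable_ccontinuous_explicit[of F thesis] by blast
  have g0: "g x = 0" if x: "x \<in> \<Omega>" "x \<notin> N" for x
  proof (rule ccontr)
    assume "g x \<noteq> 0"
    then have "0 < norm (F x)" using x by (simp add: F_def)
    from N(2)[OF x(2) this] obtain d where d: "d > 0" "\<And>h. 0 < h \<and> h < d \<Longrightarrow>
      norm (integral (cbox x (x + h *\<^sub>R One)) F /\<^sub>R h ^ DIM(real^'d) - F x) < norm (F x)" by blast
    obtain r where r: "r > 0" "ball x r \<subseteq> \<Omega>" using \<Omega> x(1) by (meson open_contains_ball)
    \<comment> \<open>Small enough for the differentiation estimate and for the cube of side
      \<open>h\<close> with corner \<open>x\<close> to lie in the ball inside
      \<open>\<Omega>\<close>; the added 1 makes the latter inequality strict.\<close>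
    define h where "h = min (d / 2) (r / (2 * norm (One :: real^'d) + 1))"
    have h: "0 < h" "h < d" using d r by (auto simp: h_def add_nonneg_pos)
    have hr: "h * norm (One :: real^'d) < r"
    proof -
      have "h * (2 * norm (One :: real^'d) + 1) \<le> r"
        by (subst pos_le_divide_eq[symmetric]) (auto simp: h_def add_nonneg_pos)
      moreover have "0 \<le> h * norm (One :: real^'d)" using h(1) by simp
      ultimately show ?thesis using h(1) unfolding distrib_left by linarith
    qed
    have "cbox x (x + h *\<^sub>R One) \<subseteq> ball x r"
    proof
      fix y assume y: "y \<in> cbox x (x + h *\<^sub>R One)"
      have "norm (y - x) \<le> norm (h *\<^sub>R One :: real^'d)"
        using y by (intro norm_le_componentwise) (auto simp: mem_box inner_diff_left inner_add_left)
      then show "y \<in> ball x r" using hr h by (simp add: dist_norm norm_minus_commute)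
    qed
    then have "integral (cbox x (x + h *\<^sub>R One)) F = 0" using r by (intro F0) auto
    with d(2)[of h] h show False by simp
  qed
  have "AE x in lebesgue. x \<notin> N" using N(1) by (simp add: negligible_iff_null_sets AE_not_in)
  then have "AE x in lebesgue. x \<in> \<Omega> \<longrightarrow> g x = 0" by eventually_elim (use g0 in blast)
  then show ?thesis by (subst AE_restrict_space_iff) auto
qed

lemma H1_weak_partial:
  assumes "u \<in> H1 \<Omega>"
  shows weak_partial_L2: "weak_partial \<Omega> i u \<in> L2 \<Omega>"
    and is_weak_partial_weak_partial: "is_weak_partial \<Omega> i u (weak_partial \<Omega> i u)"
proof -
  have "\<exists>g. g \<in> L2 \<Omega> \<and> is_weak_partial \<Omega> i u g" using assms by (auto simp: H1_def)
  from someI_ex[OF this] show "weak_partial \<Omega> i u \<in> L2 \<Omega>" "is_weak_partial \<Omega> i u (weak_partial \<Omega> i u)"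
    by (auto simp: weak_partial_def)
qed

text \<open>\<open>weak_partial\<close> is an arbitrary choice, so computations with it go through
  this lemma: exhibit some weak derivative, then identify it almost everywhere.\<close>

lemma weak_partial_unique:
  assumes \<Omega>: "open \<Omega>" and "u \<in> H1 \<Omega>" and g: "g \<in> L2 \<Omega>" "is_weak_partial \<Omega> i u g"
  shows "AE x in lebesgue_on \<Omega>. weak_partial \<Omega> i u x = g x"
proof -
  note w = H1_weak_partial[OF assms(2), of i]
  have "AE x in lebesgue_on \<Omega>. weak_partial \<Omega> i u x - g x = 0"
  proof (rule fundamental_lemma[OF \<Omega> L2_diff[OF w(1) g(1)]])
    fix \<phi> assume \<phi>: "\<phi> \<in> Cc_infty \<Omega>"
    have "(LINT x|lebesgue_on \<Omega>. (weak_partial \<Omega> i u x - g x) * \<phi> x)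
      = (LINT x|lebesgue_on \<Omega>. weak_partial \<Omega> i u x * \<phi> x) - (LINT x|lebesgue_on \<Omega>. g x * \<phi> x)"
      unfolding left_diff_distrib
      by (intro Bochner_Integration.integral_diff L2_mult_integrable w g Cc_infty_L2 \<Omega> \<phi>)
    also have "\<dots> = 0" using w(2) g(2) \<phi> by (simp add: is_weak_partial_def)
    finally show "(LINT x|lebesgue_on \<Omega>. (weak_partial \<Omega> i u x - g x) * \<phi> x) = 0" .
  qed
  then show ?thesis by simp
qed

lemma is_weak_partial_add:
  assumes "open \<Omega>" "u \<in> L2 \<Omega>" "v \<in> L2 \<Omega>" "g \<in> L2 \<Omega>" "h \<in> L2 \<Omega>"
    and "is_weak_partial \<Omega> i u g" "is_weak_partial \<Omega> i v h"
  shows "is_weak_partial \<Omega> i (\<lambda>x. u x + v x) (\<lambda>x. g x + h x)"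
  unfolding is_weak_partial_def
proof
  fix \<phi> assume \<phi>: "\<phi> \<in> Cc_infty \<Omega>"
  note l = Cc_infty_L2[OF assms(1) \<phi>] Cc_infty_L2[OF assms(1) partial_Cc_infty[OF \<phi>]]
  have "(LINT x|lebesgue_on \<Omega>. (u x + v x) * partial i \<phi> x)
      = (LINT x|lebesgue_on \<Omega>. u x * partial i \<phi> x) + (LINT x|lebesgue_on \<Omega>. v x * partial i \<phi> x)"
    unfolding distrib_right by (intro Bochner_Integration.integral_add L2_mult_integrable assms l)
  moreover have "(LINT x|lebesgue_on \<Omega>. (g x + h x) * \<phi> x)
      = (LINT x|lebesgue_on \<Omega>. g x * \<phi> x) + (LINT x|lebesgue_on \<Omega>. h x * \<phi> x)"
    unfolding distrib_right by (intro Bochner_Integration.integral_add L2_mult_integrable assms l)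
  ultimately show "(LINT x|lebesgue_on \<Omega>. (u x + v x) * partial i \<phi> x) = - (LINT x|lebesgue_on \<Omega>. (g x + h x) * \<phi> x)"
    using assms \<phi> by (simp add: is_weak_partial_def)
qed

lemma is_weak_partial_scale:
  "is_weak_partial \<Omega> i u g \<Longrightarrow> is_weak_partial \<Omega> i (\<lambda>x. s * u x) (\<lambda>x. s * g x)"
  by (simp add: is_weak_partial_def mult.assoc)

lemma weak_partial_add:
  assumes "open \<Omega>" "u \<in> H1 \<Omega>" "v \<in> H1 \<Omega>" "(\<lambda>x. u x + v x) \<in> H1 \<Omega>"
  shows "AE x in lebesgue_on \<Omega>. weak_partial \<Omega> i (\<lambda>x. u x + v x) x = weak_partial \<Omega> i u x + weak_partial \<Omega> i v x"
  using assms by (intro weak_partial_unique is_weak_partial_add L2_add H1_weak_partial) (auto simp: H1_def)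

lemma weak_partial_scale:
  assumes "open \<Omega>" "u \<in> H1 \<Omega>" "(\<lambda>x. s * u x) \<in> H1 \<Omega>"
  shows "AE x in lebesgue_on \<Omega>. weak_partial \<Omega> i (\<lambda>x. s * u x) x = s * weak_partial \<Omega> i u x"
  using assms by (intro weak_partial_unique is_weak_partial_scale L2_scale H1_weak_partial) auto

text \<open>The factor \<open>m\<close> is moved to the test function, where the classical product
  rule applies. That the product stays in \<open>H1\<close> is a premise, to be supplied by the
  invariance of the form domain under exponential weights.\<close>

lemma weak_partial_mult:
  fixes m :: "real^'d::finite \<Rightarrow> real"
  assumes \<Omega>: "open \<Omega>" and u: "u \<in> H1 \<Omega>" and mu: "(\<lambda>x. of_real (m x) * u x) \<in> H1 \<Omega>"
    and m: "smooth m" "\<And>x. norm (m x) \<le> C" "\<And>x. norm (partial i m x) \<le> C'"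
  shows "AE x in lebesgue_on \<Omega>. weak_partial \<Omega> i (\<lambda>x. of_real (m x) * u x) x
    = of_real (m x) * weak_partial \<Omega> i u x + of_real (partial i m x) * u x"
proof (rule weak_partial_unique[OF \<Omega> mu])
  define g where "g = weak_partial \<Omega> i u"
  have g: "g \<in> L2 \<Omega>" "is_weak_partial \<Omega> i u g" and uL: "u \<in> L2 \<Omega>"
    using H1_weak_partial[OF u] u by (auto simp: g_def H1_def)
  have sm: "smooth (\<lambda>x. of_real (m x) :: complex)" "smooth (\<lambda>x. of_real (partial i m x) :: complex)"
    using m(1) by (auto intro: smooth_of_real smooth_partial)
  have L: "(\<lambda>x. of_real (m x) * f x) \<in> L2 \<Omega>" "(\<lambda>x. of_real (partial i m x) * f x) \<in> L2 \<Omega>" if "f \<in> L2 \<Omega>" for f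
    by (rule L2_bounded_mult[OF that smooth_measurable[OF \<Omega> sm(1)], of C], use m in simp)
      (rule L2_bounded_mult[OF that smooth_measurable[OF \<Omega> sm(2)], of C'], use m in simp)
  show "(\<lambda>x. of_real (m x) * weak_partial \<Omega> i u x + of_real (partial i m x) * u x) \<in> L2 \<Omega>"
    by (intro L2_add L uL g[unfolded g_def])
  show "is_weak_partial \<Omega> i (\<lambda>x. of_real (m x) * u x) (\<lambda>x. of_real (m x) * weak_partial \<Omega> i u x + of_real (partial i m x) * u x)"
    unfolding is_weak_partial_def g_def[symmetric]
  proof
    fix \<phi> assume \<phi>: "\<phi> \<in> Cc_infty \<Omega>"
    have sp: "smooth \<phi>" using \<phi> by (simp add: Cc_infty_def)
    have m\<phi>: "(\<lambda>x. of_real (m x) * \<phi> x) \<in> Cc_infty \<Omega>" by (intro mult_Cc_infty \<phi> sm)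
    note l = Cc_infty_L2[OF \<Omega> \<phi>] Cc_infty_L2[OF \<Omega> partial_Cc_infty[OF \<phi>]]
       Cc_infty_L2[OF \<Omega> m\<phi>] Cc_infty_L2[OF \<Omega> partial_Cc_infty[OF m\<phi>]]
    have p: "partial i (\<lambda>x. of_real (m x) * \<phi> x) = (\<lambda>x. of_real (m x) * partial i \<phi> x + of_real (partial i m x) * \<phi> x)"
      by (simp add: partial_mult[OF sm(1) sp] partial_of_real m)
    have "(LINT x|lebesgue_on \<Omega>. of_real (m x) * u x * partial i \<phi> x)
       = (LINT x|lebesgue_on \<Omega>. u x * partial i (\<lambda>x. of_real (m x) * \<phi> x) x - (of_real (partial i m x) * u x) * \<phi> x)"
      unfolding p by (simp add: algebra_simps)
    also have "\<dots> = (LINT x|lebesgue_on \<Omega>. u x * partial i (\<lambda>x. of_real (m x) * \<phi> x) x)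
        - (LINT x|lebesgue_on \<Omega>. (of_real (partial i m x) * u x) * \<phi> x)"
      by (intro Bochner_Integration.integral_diff L2_mult_integrable uL l L)
    also have "\<dots> = - (LINT x|lebesgue_on \<Omega>. g x * (of_real (m x) * \<phi> x))
        - (LINT x|lebesgue_on \<Omega>. (of_real (partial i m x) * u x) * \<phi> x)"
      using g(2) m\<phi> by (simp add: is_weak_partial_def)
    also have "\<dots> = - ((LINT x|lebesgue_on \<Omega>. (of_real (m x) * g x) * \<phi> x)
        + (LINT x|lebesgue_on \<Omega>. (of_real (partial i m x) * u x) * \<phi> x))"
      by (simp add: algebra_simps)
    also have "\<dots> = - (LINT x|lebesgue_on \<Omega>. (of_real (m x) * g x + of_real (partial i m x) * u x) * \<phi> x)"
      unfolding distrib_right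
      by (subst Bochner_Integration.integral_add) (auto intro!: L2_mult_integrable uL l L g)
    finally show "(LINT x|lebesgue_on \<Omega>. of_real (m x) * u x * partial i \<phi> x)
       = - (LINT x|lebesgue_on \<Omega>. (of_real (m x) * g x + of_real (partial i m x) * u x) * \<phi> x)" .
  qed
qed

section \<open>Divergence form and weighted resolvent estimate\<close>

lemma sector_Re_Im:
  assumes "z \<in> sector \<theta>" "0 \<le> \<theta>" "\<theta> < pi / 2"
  shows "0 \<le> Re z" "\<bar>Im z\<bar> \<le> tan \<theta> * Re z"
proof -
  obtain r \<alpha> where z: "z = of_real r * exp (\<i> * of_real \<alpha>)" "0 \<le> r" "\<bar>\<alpha>\<bar> \<le> \<theta>"
    using assms(1) by (auto simp: sector_def)
  have RI: "Re z = r * cos \<alpha>" "Im z = r * sin \<alpha>"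
    by (simp_all add: z cis_conv_exp[symmetric])
  have c: "cos \<alpha> > 0" using z(3) assms by (intro cos_gt_zero_pi) auto
  show "0 \<le> Re z" using c z(2) by (simp add: RI)
  have "tan \<bar>\<alpha>\<bar> \<le> tan \<theta>"
    using z(3) assms by (cases "\<bar>\<alpha>\<bar> = \<theta>") (auto intro!: less_imp_le[OF tan_monotone])
  then have "\<bar>sin \<alpha>\<bar> \<le> tan \<theta> * cos \<alpha>"
    using c sin_ge_zero[of "\<bar>\<alpha>\<bar>"] z(3) assms by (auto simp: tan_def abs_if field_simps split: if_splits)
  then show "\<bar>Im z\<bar> \<le> tan \<theta> * Re z"
    using z(2) by (simp add: RI abs_mult mult.left_commute mult_left_mono)
qed

text \<open>Coordinate vectors are functions on \<open>'d\<close>, so that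
  \<open>sectorial UNIV\<close> applies to the coefficient matrix at a single point.\<close>

definition matrix_form :: "('d \<Rightarrow> 'd \<Rightarrow> complex) \<Rightarrow> ('d::finite \<Rightarrow> complex) \<Rightarrow> ('d \<Rightarrow> complex) \<Rightarrow> complex" where
  "matrix_form A \<xi> \<eta> = (\<Sum>i\<in>UNIV. \<Sum>j\<in>UNIV. \<xi> i * A i j * cnj (\<eta> j))"

lemma sesquilinear_matrix_form: "sesquilinear UNIV (matrix_form A)"
  by unfold_locales
    (auto simp: matrix_form_def algebra_simps sum.distrib sum_distrib_left)

lemma matrix_form_bound:
  fixes A :: "'d::finite \<Rightarrow> 'd \<Rightarrow> complex"
  assumes "\<And>i j. norm (A i j) \<le> C" "\<And>i. norm (\<xi> i) \<le> r"
  shows "norm (matrix_form A \<xi> \<xi>) \<le> (real CARD('d))\<^sup>2 * C * r\<^sup>2"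
proof -
  have r: "0 \<le> r" and C: "0 \<le> C" using assms norm_ge_zero order_trans by metis+
  have "norm (matrix_form A \<xi> \<xi>) \<le> (\<Sum>i\<in>(UNIV::'d set). \<Sum>j\<in>(UNIV::'d set). r * C * r)"
    unfolding matrix_form_def
    by (intro sum_norm_le) (auto simp: norm_mult intro!: mult_mono assms r C mult_nonneg_nonneg)
  also have "\<dots> = (real CARD('d))\<^sup>2 * C * r\<^sup>2" by (simp add: power2_eq_square)
  finally show ?thesis .
qed

text \<open>The condition on the coefficients is stored as the abstract predicate
  \<open>sectorial\<close> at almost every point. Thus the generalised Cauchy--Schwarz inequality is
  available pointwise, in the seminorm of the possibly degenerate matrix.\<close>

locale elliptic_form =
  fixes \<Omega> :: "(real^'d::finite) set" and c :: "'d \<Rightarrow> 'd \<Rightarrow> real^'d \<Rightarrow> complex"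
    and T :: real and Da :: "(real^'d \<Rightarrow> complex) set"
  assumes open_\<Omega>: "open \<Omega>" and c_L_infty: "c i j \<in> L_infty \<Omega>" and T_nonneg: "0 \<le> T"
    and matrix_sectorial: "AE x in lebesgue_on \<Omega>. sectorial UNIV (matrix_form (\<lambda>i j. c i j x)) T"
    and Da_subspace: "L2_subspace \<Omega> Da" and Da_H1: "Da \<subseteq> H1 \<Omega>"
    and Da_exp: "\<psi> \<in> Cb_infty \<Longrightarrow> w \<in> Da \<Longrightarrow> (\<lambda>x. of_real (exp (\<rho> * \<psi> x)) * w x) \<in> Da"
begin

abbreviation mform where "mform x \<equiv> matrix_form (\<lambda>i j. c i j x)"
definition grad where "grad u x = (\<lambda>i. weak_partial \<Omega> i u x)"

lemma mform_sectorial: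
  assumes "sectorial UNIV (mform x) T"
  shows "0 \<le> Re (mform x \<xi> \<xi>)" and "\<bar>Im (mform x \<xi> \<xi>)\<bar> \<le> T * Re (mform x \<xi> \<xi>)"
  using sectorial.re_nonneg[OF assms, of \<xi>] sectorial.im_le[OF assms, of \<xi>] by simp_all

lemma Da_L2: "u \<in> Da \<Longrightarrow> u \<in> L2 \<Omega>"
  using Da_subspace by (auto simp: L2_subspace_def)

lemma weak_partial_Da: "u \<in> Da \<Longrightarrow> weak_partial \<Omega> i u \<in> L2 \<Omega>"
  using Da_H1 by (auto intro: weak_partial_L2)

lemma mform_integrable:
  assumes "\<And>i. (\<lambda>x. U x i) \<in> L2 \<Omega>" "\<And>i. (\<lambda>x. V x i) \<in> L2 \<Omega>"
  shows "integrable (lebesgue_on \<Omega>) (\<lambda>x. mform x (U x) (V x))"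
proof -
  have "(\<lambda>x. c i j x * U x i) \<in> L2 \<Omega>" for i j
    using c_L_infty[of i j] by (auto simp: L_infty_def intro: L2_bounded_mult assms)
  then have "integrable (lebesgue_on \<Omega>) (\<lambda>x. (c i j x * U x i) * cnj (V x j))" for i j
    by (intro L2_inner_integrable assms)
  then show ?thesis unfolding matrix_form_def
    by (intro Bochner_Integration.integrable_sum) (simp add: mult.commute)
qed

lemma grad_integrable: "u \<in> Da \<Longrightarrow> v \<in> Da \<Longrightarrow> integrable (lebesgue_on \<Omega>) (\<lambda>x. mform x (grad u x) (grad v x))"
  by (intro mform_integrable) (auto simp: grad_def weak_partial_Da)

lemma div_form_eq:
  assumes "u \<in> Da" "v \<in> Da"
  shows "div_form \<Omega> c u v = (LINT x|lebesgue_on \<Omega>. mform x (grad u x) (grad v x))"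
proof -
  have "(\<lambda>x. c i j x * weak_partial \<Omega> i u x) \<in> L2 \<Omega>" for i j
    using c_L_infty[of i j] by (auto simp: L_infty_def intro: L2_bounded_mult assms weak_partial_Da)
  then have *: "integrable (lebesgue_on \<Omega>) (\<lambda>x. (c i j x * weak_partial \<Omega> i u x) * cnj (weak_partial \<Omega> j v x))" for i j
    by (intro L2_inner_integrable weak_partial_Da assms)
  have *: "integrable (lebesgue_on \<Omega>) (\<lambda>x. weak_partial \<Omega> i u x * c i j x * cnj (weak_partial \<Omega> j v x))" for i j
    using *[of i j] by (simp add: mult.commute[of "c i j _"])
  show ?thesis unfolding div_form_def matrix_form_def grad_def
    by (subst Bochner_Integration.integral_sum, (intro Bochner_Integration.integrable_sum *)+)
      (subst Bochner_Integration.integral_sum, (rule *)+, simp)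
qed

lemma grad_add:
  assumes "u \<in> Da" "v \<in> Da" "(\<lambda>x. u x + v x) \<in> Da"
  shows "AE x in lebesgue_on \<Omega>. grad (\<lambda>x. u x + v x) x = (\<lambda>i. grad u x i + grad v x i)"
proof -
  have "AE x in lebesgue_on \<Omega>. \<forall>i\<in>(UNIV::'d set). weak_partial \<Omega> i (\<lambda>x. u x + v x) x = weak_partial \<Omega> i u x + weak_partial \<Omega> i v x"
    using assms Da_H1 by (intro AE_finite_allI weak_partial_add open_\<Omega>) auto
  then show ?thesis by eventually_elim (auto simp: grad_def)
qed

lemma grad_scale:
  assumes "u \<in> Da" "(\<lambda>x. s * u x) \<in> Da"
  shows "AE x in lebesgue_on \<Omega>. grad (\<lambda>x. s * u x) x = (\<lambda>i. s * grad u x i)"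
proof -
  have "AE x in lebesgue_on \<Omega>. \<forall>i\<in>(UNIV::'d set). weak_partial \<Omega> i (\<lambda>x. s * u x) x = s * weak_partial \<Omega> i u x"
    using assms Da_H1 by (intro AE_finite_allI weak_partial_scale open_\<Omega>) auto
  then show ?thesis by eventually_elim (auto simp: grad_def)
qed

lemma div_form_AE_eq:
  assumes "u \<in> Da" "v \<in> Da" "integrable (lebesgue_on \<Omega>) f"
    and "AE x in lebesgue_on \<Omega>. mform x (grad u x) (grad v x) = f x"
  shows "div_form \<Omega> c u v = (LINT x|lebesgue_on \<Omega>. f x)"
  unfolding div_form_eq[OF assms(1,2)]
  using assms grad_integrable[OF assms(1,2)] by (intro integral_cong_AE) auto

text \<open>Weak gradients of representatives are additive and homogeneous almost everywhere only,
  so the algebraic laws are obtained under the integral; sectoriality with the same \<open>T\<close>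
  follows by integrating the pointwise inequalities.\<close>

sublocale form: sectorial Da "div_form \<Omega> c" T
proof unfold_locales
  have add: "(\<lambda>x. u x + v x) \<in> Da" if "u \<in> Da" "v \<in> Da" for u v
    using Da_subspace that by (auto simp: L2_subspace_def)
  have scale: "(\<lambda>x. s * u x) \<in> Da" if "u \<in> Da" for s u
    using Da_subspace that by (auto simp: L2_subspace_def)
  note m = sesquilinear.add_left[OF sesquilinear_matrix_form] sesquilinear.add_right[OF sesquilinear_matrix_form]
    sesquilinear.scale_left[OF sesquilinear_matrix_form] sesquilinear.scale_right[OF sesquilinear_matrix_form]
  show "Da \<noteq> {}" using Da_subspace by (auto simp: L2_subspace_def)
  show "(\<lambda>x. u x + v x) \<in> Da" if "u \<in> Da" "v \<in> Da" for u v by (rule add[OF that])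
  show "(\<lambda>x. s * u x) \<in> Da" if "u \<in> Da" for s u by (rule scale[OF that])
  show "div_form \<Omega> c (\<lambda>x. u x + u' x) v = div_form \<Omega> c u v + div_form \<Omega> c u' v" if "u \<in> Da" "u' \<in> Da" "v \<in> Da" for u u' v
  proof -
    have "div_form \<Omega> c (\<lambda>x. u x + u' x) v
      = (LINT x|lebesgue_on \<Omega>. mform x (grad u x) (grad v x) + mform x (grad u' x) (grad v x))"
      using grad_add[OF that(1,2) add[OF that(1,2)]]
      by (intro div_form_AE_eq add that Bochner_Integration.integrable_add grad_integrable) (auto simp: m elim: eventually_mono)
    also have "\<dots> = div_form \<Omega> c u v + div_form \<Omega> c u' v"
      unfolding div_form_eq[OF that(1,3)] div_form_eq[OF that(2,3)]
      by (intro Bochner_Integration.integral_add grad_integrable that)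
    finally show ?thesis .
  qed
  show "div_form \<Omega> c u (\<lambda>x. v x + v' x) = div_form \<Omega> c u v + div_form \<Omega> c u v'" if "u \<in> Da" "v \<in> Da" "v' \<in> Da" for u v v'
  proof -
    have "div_form \<Omega> c u (\<lambda>x. v x + v' x)
      = (LINT x|lebesgue_on \<Omega>. mform x (grad u x) (grad v x) + mform x (grad u x) (grad v' x))"
      using grad_add[OF that(2,3) add[OF that(2,3)]]
      by (intro div_form_AE_eq add that Bochner_Integration.integrable_add grad_integrable) (auto simp: m elim: eventually_mono)
    also have "\<dots> = div_form \<Omega> c u v + div_form \<Omega> c u v'"
      unfolding div_form_eq[OF that(1,2)] div_form_eq[OF that(1,3)]
      by (intro Bochner_Integration.integral_add grad_integrable that)
    finally show ?thesis .
  qed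
  show "div_form \<Omega> c (\<lambda>x. s * u x) v = s * div_form \<Omega> c u v" if "u \<in> Da" "v \<in> Da" for s u v
  proof -
    have "div_form \<Omega> c (\<lambda>x. s * u x) v = (LINT x|lebesgue_on \<Omega>. s * mform x (grad u x) (grad v x))"
      using grad_scale[OF that(1) scale[OF that(1)], where s = s]
      by (intro div_form_AE_eq scale that integrable_mult_right grad_integrable) (auto simp: m elim: eventually_mono)
    then show ?thesis by (simp add: div_form_eq[OF that])
  qed
  show "div_form \<Omega> c u (\<lambda>x. s * v x) = cnj s * div_form \<Omega> c u v" if "u \<in> Da" "v \<in> Da" for s u v
  proof -
    have "div_form \<Omega> c u (\<lambda>x. s * v x) = (LINT x|lebesgue_on \<Omega>. cnj s * mform x (grad u x) (grad v x))"
      using grad_scale[OF that(2) scale[OF that(2)], where s = s]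
      by (intro div_form_AE_eq scale that integrable_mult_right grad_integrable) (auto simp: m elim: eventually_mono)
    then show ?thesis by (simp add: div_form_eq[OF that])
  qed
  fix u assume u: "u \<in> Da"
  let ?f = "\<lambda>x. mform x (grad u x) (grad u x)"
  note i = grad_integrable[OF u u]
  have re: "Re (div_form \<Omega> c u u) = (LINT x|lebesgue_on \<Omega>. Re (?f x))"
    unfolding div_form_eq[OF u u] by (rule integral_bounded_linear[OF bounded_linear_Re i, symmetric])
  have im: "Im (div_form \<Omega> c u u) = (LINT x|lebesgue_on \<Omega>. Im (?f x))"
    unfolding div_form_eq[OF u u] by (rule integral_bounded_linear[OF bounded_linear_Im i, symmetric])
  show "0 \<le> Re (div_form \<Omega> c u u)"
    unfolding re
    by (intro integral_nonneg_AE eventually_mono[OF matrix_sectorial]) (rule mform_sectorial)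
  have "\<bar>Im (div_form \<Omega> c u u)\<bar> \<le> (LINT x|lebesgue_on \<Omega>. \<bar>Im (?f x)\<bar>)"
    unfolding im by (rule integral_abs_bound)
  also have "\<dots> \<le> (LINT x|lebesgue_on \<Omega>. T * Re (?f x))"
    by (intro integral_mono_AE integrable_abs integrable_Im integrable_mult_right integrable_Re i
        eventually_mono[OF matrix_sectorial]) (rule mform_sectorial)
  finally show "\<bar>Im (div_form \<Omega> c u u)\<bar> \<le> T * Re (div_form \<Omega> c u u)" by (simp add: re)
qed (rule T_nonneg)

text \<open>If \<open>w\<close> has gradient \<open>\<xi>\<close>, the weighted function has
  gradient \<open>m * (\<xi> + s * \<eta>)\<close>, where \<open>\<eta>\<close> is \<open>w\<close>
  times the gradient of \<open>\<psi>\<close>. Cauchy--Schwarz bounds the mixed term by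
  \<open>2 * X * Y\<close> with \<open>X = qnorm \<xi>\<close> and
  \<open>Y = (1 + T) * \<bar>s\<bar> * qnorm \<eta>\<close>; the pure term \<open>X^2\<close>
  absorbs it up to \<open>- Y^2\<close>, in which no derivative of \<open>w\<close> remains.\<close>

lemma mform_weighted_lower:
  assumes "sectorial UNIV (mform x) T" "0 \<le> m"
  shows "- ((1 + T)\<^sup>2 * s\<^sup>2 * (m * Re (mform x \<eta> \<eta>)))
    \<le> Re (mform x \<xi> (\<lambda>i. of_real m * (\<xi> i + of_real s * \<eta> i)))"
proof -
  interpret S: sectorial UNIV "mform x" T by fact
  let ?K = "1 + T"
  have "norm (mform x \<xi> \<eta>) \<le> 2 * ?K * S.qnorm \<xi> * S.qnorm \<eta>" by (rule S.norm_le) auto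
  then have "\<bar>s * Re (mform x \<xi> \<eta>)\<bar> \<le> \<bar>s\<bar> * (2 * ?K * S.qnorm \<xi> * S.qnorm \<eta>)"
    unfolding abs_mult using abs_Re_le_cmod order_trans by (intro mult_left_mono) auto
  moreover have "\<bar>s\<bar> * (2 * ?K * S.qnorm \<xi> * S.qnorm \<eta>) = 2 * S.qnorm \<xi> * (?K * \<bar>s\<bar> * S.qnorm \<eta>)"
    by (simp only: mult_ac)
  moreover have "\<dots> \<le> (S.qnorm \<xi>)\<^sup>2 + (?K * \<bar>s\<bar> * S.qnorm \<eta>)\<^sup>2"
    by (rule sum_squares_bound)
  moreover have "(?K * \<bar>s\<bar> * S.qnorm \<eta>)\<^sup>2 = ?K\<^sup>2 * s\<^sup>2 * Re (mform x \<eta> \<eta>)"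
    by (simp add: power_mult_distrib S.qnorm_sq)
  ultimately have "- (?K\<^sup>2 * s\<^sup>2 * Re (mform x \<eta> \<eta>)) \<le> Re (mform x \<xi> \<xi>) + s * Re (mform x \<xi> \<eta>)"
    unfolding S.qnorm_sq[OF UNIV_I] by linarith
  from mult_left_mono[OF this assms(2)] show ?thesis
    by (simp add: S.scale_right S.add_right algebra_simps)
qed

text \<open>The parallelogram inequality, from nonnegativity at \<open>\<xi> - s * \<eta>\<close>;
  it serves to show that multiplication by a weight is bounded in the form norm.\<close>

lemma mform_weighted_upper:
  assumes "sectorial UNIV (mform x) T"
  shows "Re (mform x (\<lambda>i. of_real m * (\<xi> i + of_real s * \<eta> i)) (\<lambda>i. of_real m * (\<xi> i + of_real s * \<eta> i)))
    \<le> m\<^sup>2 * (2 * Re (mform x \<xi> \<xi>) + 2 * s\<^sup>2 * Re (mform x \<eta> \<eta>))"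
proof -
  interpret S: sectorial UNIV "mform x" T by fact
  have "0 \<le> Re (mform x (\<lambda>i. \<xi> i - of_real s * \<eta> i) (\<lambda>i. \<xi> i - of_real s * \<eta> i))" by (rule S.re_nonneg) simp
  then have "Re (mform x (\<lambda>i. \<xi> i + of_real s * \<eta> i) (\<lambda>i. \<xi> i + of_real s * \<eta> i))
     \<le> 2 * Re (mform x \<xi> \<xi>) + 2 * s\<^sup>2 * Re (mform x \<eta> \<eta>)"
    by (simp add: S.sesq_rules power2_eq_square algebra_simps)
  from mult_left_mono[OF this, of "m\<^sup>2"] show ?thesis
    by (simp add: S.scale_left S.scale_right power2_eq_square mult.assoc)
qed

lemma c_bounded:
  obtains C where "0 \<le> C" "AE x in lebesgue_on \<Omega>. \<forall>i j. norm (c i j x) \<le> C"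
proof -
  have "\<forall>i j. \<exists>C. AE x in lebesgue_on \<Omega>. norm (c i j x) \<le> C" using c_L_infty by (simp add: L_infty_def)
  then obtain B where B: "\<And>i j. AE x in lebesgue_on \<Omega>. norm (c i j x) \<le> B i j" by metis
  define C where "C = (\<Sum>i\<in>UNIV. \<Sum>j\<in>UNIV. \<bar>B i j\<bar>)"
  have BC: "B i j \<le> C" for i j
  proof -
    have "\<bar>B i j\<bar> \<le> (\<Sum>j\<in>UNIV. \<bar>B i j\<bar>)" by (intro member_le_sum) auto
    also have "\<dots> \<le> C" unfolding C_def by (intro member_le_sum[of i UNIV "\<lambda>i. \<Sum>j\<in>UNIV. \<bar>B i j\<bar>"] sum_nonneg) auto
    finally show ?thesis by simp
  qed
  from B have "AE x in lebesgue_on \<Omega>. norm (c i j x) \<le> C" for i j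
    by (rule eventually_mono) (rule order_trans[OF _ BC])
  then have "AE x in lebesgue_on \<Omega>. \<forall>i\<in>(UNIV::'d set). \<forall>j\<in>(UNIV::'d set). norm (c i j x) \<le> C"
    by (intro AE_finite_allI) auto
  moreover have "0 \<le> C" unfolding C_def by (intro sum_nonneg) auto
  ultimately show ?thesis using that[of C] by simp
qed

section \<open>Exponential weights and Davies' perturbation method\<close>

context
  fixes \<psi> :: "real^'d \<Rightarrow> real"
  assumes \<psi>: "\<psi> \<in> Cb_infty"
begin

abbreviation weight where "weight s x \<equiv> exp (s * \<psi> x)"
definition wmult where "wmult s w = (\<lambda>x. of_real (weight s x) * w x)"

lemma \<psi>_smooth: "smooth \<psi>" and \<psi>_bounded: "bounded (range \<psi>)" and \<psi>_partial_bounded: "bounded (range (partial i \<psi>))"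
proof -
  show "smooth \<psi>" using \<psi> by (simp add: Cb_infty_def)
  have "bounded (range (iter_partial is \<psi>))" for "is" using \<psi> by (simp add: Cb_infty_def)
  from this[of "[]"] this[of "[i]"] show "bounded (range \<psi>)" "bounded (range (partial i \<psi>))" by auto
qed

lemma \<psi>_gradient_bound: obtains G where "0 \<le> G" "\<And>i x. \<bar>partial i \<psi> x\<bar> \<le> G"
proof -
  have "\<forall>i. \<exists>B. \<forall>x. \<bar>partial i \<psi> x\<bar> \<le> B" using \<psi>_partial_bounded by (auto simp: bounded_iff)
  then obtain B where B: "\<And>i x. \<bar>partial i \<psi> x\<bar> \<le> B i" by metis
  have "\<bar>partial i \<psi> x\<bar> \<le> (\<Sum>i\<in>UNIV. \<bar>B i\<bar>)" for i x
  proof -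
    have "\<bar>partial i \<psi> x\<bar> \<le> \<bar>B i\<bar>" using B[of i x] by simp
    also have "\<dots> \<le> (\<Sum>i\<in>UNIV. \<bar>B i\<bar>)" by (intro member_le_sum) auto
    finally show ?thesis .
  qed
  then show ?thesis using that[of "\<Sum>i\<in>UNIV. \<bar>B i\<bar>"] by (simp add: sum_nonneg)
qed

lemma weight_bound: obtains B where "0 < B" "\<And>x. weight s x \<le> B"
proof -
  obtain b where b: "\<And>x. \<bar>\<psi> x\<bar> \<le> b" using \<psi>_bounded by (auto simp: bounded_iff)
  have "s * \<psi> x \<le> \<bar>s\<bar> * b" for x
    using mult_left_mono[OF b[of x], of "\<bar>s\<bar>"] abs_ge_self[of "s * \<psi> x"] by (simp add: abs_mult)
  then show ?thesis using that[of "exp (\<bar>s\<bar> * b)"] by simp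
qed

lemma weight_smooth: "smooth (weight s)"
  by (rule smooth_exp[OF \<psi>_smooth])

lemma wmult_L2: "w \<in> L2 \<Omega> \<Longrightarrow> wmult s w \<in> L2 \<Omega>"
proof -
  obtain B where "\<And>x. weight s x \<le> B" using weight_bound[where s = s] by blast
  then show "w \<in> L2 \<Omega> \<Longrightarrow> wmult s w \<in> L2 \<Omega>"
    unfolding wmult_def
    by (intro L2_bounded_mult[of w \<Omega> _ B] smooth_measurable open_\<Omega> smooth_of_real weight_smooth) auto
qed

lemma wmult_Da: "w \<in> Da \<Longrightarrow> wmult s w \<in> Da"
  unfolding wmult_def by (rule Da_exp[OF \<psi>])

definition psi_grad where "psi_grad w x = (\<lambda>i. of_real (partial i \<psi> x) * w x)"

lemma grad_wmult:
  assumes w: "w \<in> Da"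
  shows "AE x in lebesgue_on \<Omega>. grad (wmult s w) x
    = (\<lambda>i. of_real (weight s x) * (grad w x i + of_real s * psi_grad w x i))"
proof -
  obtain B where B: "0 < B" "\<And>x. weight s x \<le> B" using weight_bound by metis
  obtain G where G: "0 \<le> G" "\<And>i x. \<bar>partial i \<psi> x\<bar> \<le> G" using \<psi>_gradient_bound by metis
  have p: "partial i (weight s) = (\<lambda>x. s * (partial i \<psi> x * weight s x))" for i
    by (rule partial_exp[OF \<psi>_smooth])
  have "\<bar>partial i (weight s) x\<bar> \<le> \<bar>s\<bar> * (G * B)" for i x
    unfolding p using B G by (auto simp: abs_mult intro!: mult_left_mono mult_mono)
  then have "AE x in lebesgue_on \<Omega>. \<forall>i\<in>(UNIV::'d set). weak_partial \<Omega> i (wmult s w) x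
    = of_real (weight s x) * weak_partial \<Omega> i w x + of_real (partial i (weight s) x) * w x"
    using B w Da_H1 wmult_Da[OF w, of s] unfolding wmult_def
    by (intro AE_finite_allI weak_partial_mult[where C = B and C' = "\<bar>s\<bar> * (G * B)"] open_\<Omega> weight_smooth) auto
  then show ?thesis
    by eventually_elim (auto simp: grad_def psi_grad_def p algebra_simps)
qed

text \<open>Boundedness of the coefficients and of the gradient of \<open>\<psi>\<close> makes this
  expression a term of order zero in \<open>w\<close>, with \<open>M\<close> independent of
  \<open>w\<close>.\<close>

lemma psi_grad_bound:
  obtains M where "0 \<le> M" "\<And>w. AE x in lebesgue_on \<Omega>. Re (mform x (psi_grad w x) (psi_grad w x)) \<le> M * (norm (w x))\<^sup>2"
proof -
  obtain C where C: "0 \<le> C" "AE x in lebesgue_on \<Omega>. \<forall>i j. norm (c i j x) \<le> C" by (rule c_bounded)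
  obtain G where G: "0 \<le> G" "\<And>i x. \<bar>partial i \<psi> x\<bar> \<le> G" using \<psi>_gradient_bound by metis
  show ?thesis
  proof (rule that[of "(real CARD('d))\<^sup>2 * C * G\<^sup>2"])
    show "AE x in lebesgue_on \<Omega>. Re (mform x (psi_grad w x) (psi_grad w x)) \<le> (real CARD('d))\<^sup>2 * C * G\<^sup>2 * (norm (w x))\<^sup>2" for w
      using C(2)
    proof eventually_elim
      case (elim x)
      have "norm (mform x (psi_grad w x) (psi_grad w x)) \<le> (real CARD('d))\<^sup>2 * C * (G * norm (w x))\<^sup>2"
        using elim G by (intro matrix_form_bound) (auto simp: psi_grad_def norm_mult intro!: mult_right_mono)
      then show ?case using complex_Re_le_cmod order_trans by (fastforce simp: power_mult_distrib mult_ac)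
    qed
  qed (use C in auto)
qed

lemma Re_L2_inner_wmult:
  assumes "w \<in> L2 \<Omega>"
  shows "integrable (lebesgue_on \<Omega>) (\<lambda>x. weight s x * (norm (w x))\<^sup>2)"
    and "Re (L2_inner \<Omega> w (wmult s w)) = (LINT x|lebesgue_on \<Omega>. weight s x * (norm (w x))\<^sup>2)"
proof -
  have eq: "Re (w x * cnj (wmult s w x)) = weight s x * (norm (w x))\<^sup>2" for x
    unfolding wmult_def cmod_power2 by (simp add: power2_eq_square algebra_simps)
  have i: "integrable (lebesgue_on \<Omega>) (\<lambda>x. w x * cnj (wmult s w x))"
    by (intro L2_inner_integrable wmult_L2 assms)
  show "integrable (lebesgue_on \<Omega>) (\<lambda>x. weight s x * (norm (w x))\<^sup>2)"
    using integrable_Re[OF i] unfolding eq .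
  show "Re (L2_inner \<Omega> w (wmult s w)) = (LINT x|lebesgue_on \<Omega>. weight s x * (norm (w x))\<^sup>2)"
    unfolding L2_inner_def eq[symmetric] by (rule integral_bounded_linear[OF bounded_linear_Re i, symmetric])
qed

text \<open>Davies' perturbation estimate: conjugating the form with \<open>exp (s \<psi> / 2)\<close> costs only a
  term of order zero, because sectoriality absorbs the mixed gradient term.\<close>

lemma davies_lower:
  obtains M where "0 < M"
    "\<And>w s. w \<in> Da \<Longrightarrow> - (M * s\<^sup>2 * Re (L2_inner \<Omega> w (wmult s w))) \<le> Re (div_form \<Omega> c w (wmult s w))"
proof -
  obtain M where M: "0 \<le> M" "\<And>w. AE x in lebesgue_on \<Omega>. Re (mform x (psi_grad w x) (psi_grad w x)) \<le> M * (norm (w x))\<^sup>2"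
    using psi_grad_bound by blast
  show ?thesis
  \<comment> \<open>Enlarging \<open>M\<close> by 1 ensures a strictly positive constant, by which
    the choice of \<open>s\<close> in terms of the resolvent parameter will divide.\<close>
  proof (rule that[of "(1 + T)\<^sup>2 * (M + 1)"])
    show "0 < (1 + T)\<^sup>2 * (M + 1)" using T_nonneg M by simp
    fix w s assume w: "w \<in> Da"
    note i = grad_integrable[OF w wmult_Da[OF w, of s]]
    let ?M = "(1 + T)\<^sup>2 * (M + 1) * s\<^sup>2"
    have "- (?M * Re (L2_inner \<Omega> w (wmult s w))) = (LINT x|lebesgue_on \<Omega>. - (?M * (weight s x * (norm (w x))\<^sup>2)))"
      by (simp add: Re_L2_inner_wmult[OF Da_L2[OF w]])
    also have "\<dots> \<le> (LINT x|lebesgue_on \<Omega>. Re (mform x (grad w x) (grad (wmult s w) x)))"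
    proof (rule integral_mono_AE)
      show "integrable (lebesgue_on \<Omega>) (\<lambda>x. - (?M * (weight s x * (norm (w x))\<^sup>2)))"
        by (intro Bochner_Integration.integrable_minus integrable_mult_right Re_L2_inner_wmult Da_L2 w)
      show "integrable (lebesgue_on \<Omega>) (\<lambda>x. Re (mform x (grad w x) (grad (wmult s w) x)))"
        by (rule integrable_Re[OF i])
      show "AE x in lebesgue_on \<Omega>. - (?M * (weight s x * (norm (w x))\<^sup>2)) \<le> Re (mform x (grad w x) (grad (wmult s w) x))"
        using matrix_sectorial grad_wmult[OF w, of s] M(2)[of w]
      proof eventually_elim
        case (elim x)
        have "Re (mform x (psi_grad w x) (psi_grad w x)) \<le> (M + 1) * (norm (w x))\<^sup>2"
          using elim(3) by (simp add: distrib_right add_increasing2)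
        then have "(1 + T)\<^sup>2 * s\<^sup>2 * (weight s x * Re (mform x (psi_grad w x) (psi_grad w x)))
           \<le> (1 + T)\<^sup>2 * s\<^sup>2 * (weight s x * ((M + 1) * (norm (w x))\<^sup>2))"
          by (intro mult_left_mono) auto
        then show ?case using mform_weighted_lower[OF elim(1), of "weight s x" s "psi_grad w x" "grad w x"]
          unfolding elim(2) by (simp add: mult_ac)
      qed
    qed
    also have "\<dots> = Re (div_form \<Omega> c w (wmult s w))"
      unfolding div_form_eq[OF w wmult_Da[OF w]] by (rule integral_bounded_linear[OF bounded_linear_Re i])
    finally show "- (?M * Re (L2_inner \<Omega> w (wmult s w))) \<le> Re (div_form \<Omega> c w (wmult s w))" .
  qed
qed

text \<open>The residual in the approximate resolvent equation is controlled relative to the form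
  norm of the test function, so testing with weighted approximants requires that their form norms
  stay bounded. The constant may depend on \<open>s\<close>, but not on \<open>w\<close>.\<close>

lemma div_form_wmult_bound:
  obtains C where "0 \<le> C"
    "\<And>w. w \<in> Da \<Longrightarrow> Re (div_form \<Omega> c (wmult s w) (wmult s w)) \<le> C * (Re (div_form \<Omega> c w w) + (L2_norm \<Omega> w)\<^sup>2)"
proof -
  obtain M where M: "0 \<le> M" "\<And>w. AE x in lebesgue_on \<Omega>. Re (mform x (psi_grad w x) (psi_grad w x)) \<le> M * (norm (w x))\<^sup>2"
    using psi_grad_bound by blast
  obtain B where B: "0 < B" "\<And>x. weight s x \<le> B" using weight_bound by metis
  define C where "C = B\<^sup>2 * (2 + 2 * s\<^sup>2 * M)"
  show ?thesis
  proof (rule that[of C])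
    show "0 \<le> C" using M by (simp add: C_def)
    fix w assume w: "w \<in> Da"
    note i = grad_integrable[OF wmult_Da[OF w, of s] wmult_Da[OF w, of s]] and i' = grad_integrable[OF w w]
    have "Re (div_form \<Omega> c (wmult s w) (wmult s w))
      = (LINT x|lebesgue_on \<Omega>. Re (mform x (grad (wmult s w) x) (grad (wmult s w) x)))"
      unfolding div_form_eq[OF wmult_Da[OF w] wmult_Da[OF w]]
      by (rule integral_bounded_linear[OF bounded_linear_Re i, symmetric])
    also have "\<dots> \<le> (LINT x|lebesgue_on \<Omega>. C * (Re (mform x (grad w x) (grad w x)) + (norm (w x))\<^sup>2))"
    proof (rule integral_mono_AE)
      show "integrable (lebesgue_on \<Omega>) (\<lambda>x. Re (mform x (grad (wmult s w) x) (grad (wmult s w) x)))"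
        by (rule integrable_Re[OF i])
      show "integrable (lebesgue_on \<Omega>) (\<lambda>x. C * (Re (mform x (grad w x) (grad w x)) + (norm (w x))\<^sup>2))"
        by (intro integrable_mult_right Bochner_Integration.integrable_add integrable_Re i' L2_integrable Da_L2 w)
      show "AE x in lebesgue_on \<Omega>. Re (mform x (grad (wmult s w) x) (grad (wmult s w) x))
          \<le> C * (Re (mform x (grad w x) (grad w x)) + (norm (w x))\<^sup>2)"
        using matrix_sectorial grad_wmult[OF w, of s] M(2)[of w]
      proof eventually_elim
        case (elim x)
        let ?q = "Re (mform x (grad w x) (grad w x))" and ?p = "Re (mform x (psi_grad w x) (psi_grad w x))"
        have q: "0 \<le> ?q" "0 \<le> ?p" by (rule mform_sectorial[OF elim(1)])+
        have "Re (mform x (grad (wmult s w) x) (grad (wmult s w) x)) \<le> (weight s x)\<^sup>2 * (2 * ?q + 2 * s\<^sup>2 * ?p)"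
          unfolding elim(2) by (rule mform_weighted_upper[OF elim(1)])
        also have "\<dots> \<le> B\<^sup>2 * (2 * ?q + 2 * s\<^sup>2 * (M * (norm (w x))\<^sup>2))"
          using B(2) elim(3) q by (intro mult_mono add_mono power_mono mult_left_mono) auto
        also have "\<dots> \<le> B\<^sup>2 * ((2 + 2 * s\<^sup>2 * M) * ?q + (2 + 2 * s\<^sup>2 * M) * (norm (w x))\<^sup>2)"
          using q M by (intro mult_left_mono add_mono) (auto simp: distrib_right)
        also have "\<dots> = C * (?q + (norm (w x))\<^sup>2)" by (simp add: C_def algebra_simps)
        finally show ?case .
      qed
    qed
    also have "\<dots> = C * ((LINT x|lebesgue_on \<Omega>. Re (mform x (grad w x) (grad w x))) + (LINT x|lebesgue_on \<Omega>. (norm (w x))\<^sup>2))"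
      using i' L2_integrable[OF Da_L2[OF w]] by simp
    also have "(LINT x|lebesgue_on \<Omega>. Re (mform x (grad w x) (grad w x))) = Re (div_form \<Omega> c w w)"
      unfolding div_form_eq[OF w w] by (rule integral_bounded_linear[OF bounded_linear_Re i'])
    also have "(LINT x|lebesgue_on \<Omega>. (norm (w x))\<^sup>2) = (L2_norm \<Omega> w)\<^sup>2"
      by (simp add: L2_norm_def)
    finally show "Re (div_form \<Omega> c (wmult s w) (wmult s w)) \<le> C * (Re (div_form \<Omega> c w w) + (L2_norm \<Omega> w)\<^sup>2)" .
  qed
qed

end

end

section \<open>Pointwise comparison in \<open>L2\<close> and essential supports\<close>

lemma L2_norm_mono:
  assumes "w \<in> L2 \<Omega>" "w' \<in> L2 \<Omega>" "0 \<le> B" "AE x in lebesgue_on \<Omega>. norm (w' x) \<le> B * norm (w x)"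
  shows "L2_norm \<Omega> w' \<le> B * L2_norm \<Omega> w"
proof -
  have "(LINT x|lebesgue_on \<Omega>. (norm (w' x))\<^sup>2) \<le> (LINT x|lebesgue_on \<Omega>. B\<^sup>2 * (norm (w x))\<^sup>2)"
  proof (rule integral_mono_AE)
    show "AE x in lebesgue_on \<Omega>. (norm (w' x))\<^sup>2 \<le> B\<^sup>2 * (norm (w x))\<^sup>2"
      using assms(4) by eventually_elim (metis norm_ge_zero power_mono power_mult_distrib)
  qed (use assms in \<open>auto intro: L2_integrable\<close>)
  also have "\<dots> = B\<^sup>2 * (LINT x|lebesgue_on \<Omega>. (norm (w x))\<^sup>2)" by simp
  finally show ?thesis using assms(3)
    by (metis L2_norm_def real_sqrt_abs real_sqrt_le_iff real_sqrt_mult abs_of_nonneg)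
qed

lemma L2_inner_cong_AE:
  assumes "u \<in> L2 \<Omega>" "v \<in> L2 \<Omega>" "u' \<in> L2 \<Omega>" "v' \<in> L2 \<Omega>"
    and "AE x in lebesgue_on \<Omega>. u x * cnj (v x) = u' x * cnj (v' x)"
  shows "L2_inner \<Omega> u v = L2_inner \<Omega> u' v'"
  unfolding L2_inner_def
  by (rule integral_cong_AE[OF _ _ assms(5)]) (intro borel_measurable_integrable L2_inner_integrable assms)+

text \<open>The defining union of open sets may be uncountable; Lindelof's theorem reduces it to a
  countable one, so that null sets can be combined.\<close>

lemma ess_support_AE:
  assumes "open \<Omega>"
  shows "AE x in lebesgue_on \<Omega>. x \<notin> ess_support \<Omega> u \<longrightarrow> u x = 0"
proof -
  define F where "F = {U. open U \<and> U \<subseteq> \<Omega> \<and> ae_eq U u (\<lambda>x. 0)}"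
  obtain F' where F': "F' \<subseteq> F" "countable F'" "\<Union>F' = \<Union>F"
    using Lindelof[of F] by (auto simp: F_def)
  have "AE x in lebesgue. x \<in> U \<longrightarrow> u x = 0" if "U \<in> F'" for U
  proof -
    have "U \<in> F" using that F' by blast
    then have U: "U \<in> sets lebesgue" "AE x in lebesgue_on U. u x = 0" by (auto simp: F_def ae_eq_def)
    then show ?thesis by (subst (asm) AE_restrict_space_iff) auto
  qed
  then have "AE x in lebesgue. \<forall>U\<in>F'. x \<in> U \<longrightarrow> u x = 0" by (subst AE_ball_countable[OF F'(2)]) auto
  then have "AE x in lebesgue. x \<in> \<Omega> \<longrightarrow> x \<notin> ess_support \<Omega> u \<longrightarrow> u x = 0"
    by eventually_elim (use F'(3) in \<open>auto simp: ess_support_def F_def[symmetric]\<close>)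
  then show ?thesis using assms by (subst AE_restrict_space_iff) auto
qed

section \<open>Approximate resolvents and their decay off the diagonal\<close>

context elliptic_form
begin

text \<open>Approximate Lax--Milgram for the form shifted by \<open>l\<close>. Testing the
  difference of two approximants with itself shows that they are Cauchy in the form norm; as the
  form domain need not be complete, only the limit in \<open>L2\<close> is retained, together with
  the bound and the small residual.\<close>

lemma approximate_resolvent:
  assumes f: "f \<in> L2 \<Omega>" and l: "0 < l"
  obtains u x B where "\<And>n. u n \<in> Da" "x \<in> L2 \<Omega>" "(\<lambda>n. L2_norm \<Omega> (\<lambda>y. u n y - x y)) \<longlonglongrightarrow> 0"
    "\<And>n. Re (div_form \<Omega> c (u n) (u n)) + l * (L2_norm \<Omega> (u n))\<^sup>2 \<le> B"
    "\<And>n v. v \<in> Da \<Longrightarrow> norm (L2_inner \<Omega> f v - (div_form \<Omega> c (u n) v + of_real l * L2_inner \<Omega> (u n) v))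
       \<le> 1 / Suc n * sqrt (Re (div_form \<Omega> c v v) + l * (L2_norm \<Omega> v)\<^sup>2)"
proof -
  define a where "a u v = div_form \<Omega> c u v + of_real l * L2_inner \<Omega> u v" for u v
  have a_diag: "Re (a u u) = Re (div_form \<Omega> c u u) + l * (L2_norm \<Omega> u)\<^sup>2" "Im (a u u) = Im (div_form \<Omega> c u u)" for u
    by (simp_all add: a_def L2_inner_diag)
  interpret S: sectorial Da a T
  proof
    show "Da \<noteq> {}" by (rule form.nonempty)
    fix u assume u: "u \<in> Da"
    show "0 \<le> Re (a u u)" using form.re_nonneg[OF u] l by (simp add: a_diag)
    have "T * Re (div_form \<Omega> c u u) \<le> T * Re (a u u)"
      using l T_nonneg by (intro mult_left_mono) (auto simp: a_diag)
    with form.im_le[OF u] show "\<bar>Im (a u u)\<bar> \<le> T * Re (a u u)" by (simp add: a_diag(2))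
  qed (use T_nonneg in \<open>auto simp: a_def form.closure_rules form.sesq_rules L2.sesq_rules Da_L2 algebra_simps\<close>)
  have q: "S.qnorm v = sqrt (Re (div_form \<Omega> c v v) + l * (L2_norm \<Omega> v)\<^sup>2)" for v
    by (simp add: S.qnorm_def a_diag)
  \<comment> \<open>The shift by \<open>l\<close> makes the form norm dominate the \<open>L2\<close>
    norm, hence \<open>L2_inner \<Omega> f\<close> is a bounded functional for it.\<close>
  have L2_le: "sqrt l * L2_norm \<Omega> v \<le> S.qnorm v" if "v \<in> Da" for v
  proof -
    have "sqrt l * L2_norm \<Omega> v = sqrt (l * (L2_norm \<Omega> v)\<^sup>2)" by (simp add: real_sqrt_mult)
    also have "\<dots> \<le> S.qnorm v" unfolding q using form.re_nonneg[OF that] by simp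
    finally show ?thesis .
  qed
  have g: "antilinear_on Da (\<lambda>v. L2_inner \<Omega> f v)"
    unfolding antilinear_on_def using f by (simp add: L2.sesq_rules Da_L2)
  have gb: "norm (L2_inner \<Omega> f v) \<le> (2 * L2_norm \<Omega> f / sqrt l) * S.qnorm v" if "v \<in> Da" for v
  proof -
    have "norm (L2_inner \<Omega> f v) \<le> 2 * L2_norm \<Omega> f * L2_norm \<Omega> v"
      by (intro L2_inner_le f Da_L2 that)
    also have "\<dots> = (2 * L2_norm \<Omega> f / sqrt l) * (sqrt l * L2_norm \<Omega> v)" using l by simp
    also have "\<dots> \<le> (2 * L2_norm \<Omega> f / sqrt l) * S.qnorm v"
      using l by (intro mult_left_mono L2_le that) auto
    finally show ?thesis .
  qed
  have "\<exists>u\<in>Da. \<forall>v\<in>Da. norm (L2_inner \<Omega> f v - a u v) \<le> 1 / Suc n * S.qnorm v" for n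
    using S.approximate_lax_milgram[unfolded S.solvable_def, rule_format, OF g gb, of "1 / Suc n"] by auto
  then obtain u where u: "\<And>n. u n \<in> Da"
    "\<And>n v. v \<in> Da \<Longrightarrow> norm (L2_inner \<Omega> f v - a (u n) v) \<le> 1 / Suc n * S.qnorm v" by metis
  have cauchy: "S.qnorm (\<lambda>x. u m x - u n x) \<le> 1 / Suc m + 1 / Suc n" for m n
  proof -
    let ?d = "\<lambda>x. u m x - u n x"
    have d: "?d \<in> Da" by (intro S.diff_mem u)
    have "a ?d ?d = (L2_inner \<Omega> f ?d - a (u n) ?d) - (L2_inner \<Omega> f ?d - a (u m) ?d)"
      using S.diff_left[OF u(1) u(1) d] by simp
    then have "norm (a ?d ?d) \<le> norm (L2_inner \<Omega> f ?d - a (u n) ?d) + norm (L2_inner \<Omega> f ?d - a (u m) ?d)"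
      using norm_triangle_ineq4[of "L2_inner \<Omega> f ?d - a (u n) ?d" "L2_inner \<Omega> f ?d - a (u m) ?d"] by (simp only:)
    also have "\<dots> \<le> 1 / Suc n * S.qnorm ?d + 1 / Suc m * S.qnorm ?d" by (intro add_mono u d)
    finally have "(S.qnorm ?d)\<^sup>2 \<le> (1 / Suc m + 1 / Suc n) * S.qnorm ?d"
      unfolding S.qnorm_sq[OF d] using complex_Re_le_cmod[of "a ?d ?d"] by (simp add: algebra_simps)
    then have "S.qnorm ?d * S.qnorm ?d \<le> (1 / Suc m + 1 / Suc n) * S.qnorm ?d" by (simp add: power2_eq_square)
    then show ?thesis
      using S.qnorm_nonneg[OF d] by (cases "S.qnorm ?d = 0") (auto simp: mult_le_cancel_right)
  qed
  have "\<exists>x\<in>L2 \<Omega>. (\<lambda>n. L2_norm \<Omega> (\<lambda>z. u n z - x z)) \<longlonglongrightarrow> 0"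
  proof (rule L2_complete)
    show "u n \<in> L2 \<Omega>" for n by (intro Da_L2 u)
    fix e :: real assume e: "e > 0"
    obtain N :: nat where N: "1 / Suc N < sqrt l * e / 2"
      using nat_approx_posE[of "sqrt l * e / 2"] e l by auto
    have "L2_norm \<Omega> (\<lambda>x. u m x - u n x) \<le> e" if "m \<ge> N" "n \<ge> N" for m n
    proof -
      have "1 / Suc m \<le> 1 / Suc N" "1 / Suc n \<le> 1 / Suc N" using that by (auto intro!: divide_left_mono)
      then have "S.qnorm (\<lambda>x. u m x - u n x) \<le> sqrt l * e" using cauchy[of m n] N by simp
      then have "sqrt l * L2_norm \<Omega> (\<lambda>x. u m x - u n x) \<le> sqrt l * e"
        using L2_le[OF S.diff_mem[OF u(1)[of m] u(1)[of n]]] by simp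
      then show ?thesis using l by simp
    qed
    then show "\<exists>N. \<forall>m\<ge>N. \<forall>n\<ge>N. L2_norm \<Omega> (\<lambda>x. u m x - u n x) \<le> e" by blast
  qed
  then obtain x where x: "x \<in> L2 \<Omega>" "(\<lambda>n. L2_norm \<Omega> (\<lambda>z. u n z - x z)) \<longlonglongrightarrow> 0" by blast
  have bound: "S.qnorm (u n) \<le> 2 * L2_norm \<Omega> f / sqrt l + 1" for n
  proof -
    have "norm (a (u n) (u n)) \<le> norm (L2_inner \<Omega> f (u n)) + norm (L2_inner \<Omega> f (u n) - a (u n) (u n))"
      using norm_triangle_ineq4[of "L2_inner \<Omega> f (u n)" "L2_inner \<Omega> f (u n) - a (u n) (u n)"] by simp
    also have "\<dots> \<le> (2 * L2_norm \<Omega> f / sqrt l) * S.qnorm (u n) + 1 / Suc n * S.qnorm (u n)"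
      by (intro add_mono gb u)
    also have "\<dots> \<le> (2 * L2_norm \<Omega> f / sqrt l) * S.qnorm (u n) + 1 * S.qnorm (u n)"
      by (intro add_mono mult_right_mono S.qnorm_nonneg u) auto
    finally have "S.qnorm (u n) * S.qnorm (u n) \<le> (2 * L2_norm \<Omega> f / sqrt l + 1) * S.qnorm (u n)"
      using complex_Re_le_cmod[of "a (u n) (u n)"] S.qnorm_sq[OF u(1)[of n]]
      by (simp add: power2_eq_square distrib_right)
    then show ?thesis
      using S.qnorm_nonneg[OF u(1)[of n]] l
      by (cases "S.qnorm (u n) = 0") (auto simp: mult_le_cancel_right)
  qed
  show ?thesis
  proof (rule that[OF u(1) x, of "(2 * L2_norm \<Omega> f / sqrt l + 1)\<^sup>2"])
    show "Re (div_form \<Omega> c (u n) (u n)) + l * (L2_norm \<Omega> (u n))\<^sup>2 \<le> (2 * L2_norm \<Omega> f / sqrt l + 1)\<^sup>2" for n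
      using power_mono[OF bound S.qnorm_nonneg[OF u(1)], of n 2] unfolding S.qnorm_sq[OF u(1)] a_diag .
    show "norm (L2_inner \<Omega> f v - (div_form \<Omega> c (u n) v + of_real l * L2_inner \<Omega> (u n) v))
       \<le> 1 / Suc n * sqrt (Re (div_form \<Omega> c v v) + l * (L2_norm \<Omega> v)\<^sup>2)" if "v \<in> Da" for n v
      using u(2)[OF that, of n] unfolding q a_def .
  qed
qed

lemma wmult_tendsto:
  assumes \<psi>: "\<psi> \<in> Cb_infty" and u: "\<And>n. u n \<in> L2 \<Omega>" "x \<in> L2 \<Omega>" "(\<lambda>n. L2_norm \<Omega> (\<lambda>y. u n y - x y)) \<longlonglongrightarrow> 0"
  shows "(\<lambda>n. L2_norm \<Omega> (\<lambda>y. wmult \<psi> s (u n) y - wmult \<psi> s x y)) \<longlonglongrightarrow> 0"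
proof -
  obtain B where B: "0 < B" "\<And>x. exp (s * \<psi> x) \<le> B" using weight_bound[OF \<psi>] by metis
  have le: "norm (L2_norm \<Omega> (\<lambda>y. wmult \<psi> s (u n) y - wmult \<psi> s x y)) \<le> B * L2_norm \<Omega> (\<lambda>y. u n y - x y)" for n
    unfolding real_norm_def abs_of_nonneg[OF L2_norm_nonneg]
  proof (rule L2_norm_mono)
    show "(\<lambda>y. u n y - x y) \<in> L2 \<Omega>" "(\<lambda>y. wmult \<psi> s (u n) y - wmult \<psi> s x y) \<in> L2 \<Omega>"
      by (intro L2_diff u wmult_L2 \<psi>)+
    show "AE y in lebesgue_on \<Omega>. norm (wmult \<psi> s (u n) y - wmult \<psi> s x y) \<le> B * norm (u n y - x y)"
      using B by (auto simp: wmult_def[OF \<psi>] norm_mult intro!: mult_right_mono simp flip: right_diff_distrib)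
  qed (use B in auto)
  show ?thesis
    by (rule Lim_null_comparison[OF always_eventually[OF allI[OF le]]]) (rule tendsto_mult_right_zero[OF u(3)])
qed

text \<open>\<open>x\<close> plays the role of the resolvent applied to \<open>f\<close>, expressed
  as membership in the graph; the same \<open>x\<close> serves all weights. The weighted inequality
  comes from testing the approximate equation with \<open>wmult \<psi> s (u n)\<close>: once the
  form term has been replaced by its lower bound, only \<open>L2\<close> inner products remain
  besides the vanishing residual, and these pass to the limit.\<close>

lemma resolvent:
  assumes f: "f \<in> L2 \<Omega>" and l: "0 < l"
  obtains x where "(x, \<lambda>y. f y - of_real l * x y) \<in> form_operator \<Omega> Da (div_form \<Omega> c)" "x \<in> L2 \<Omega>"
    "\<And>\<psi> M s. \<psi> \<in> Cb_infty \<Longrightarrow>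
      (\<And>w. w \<in> Da \<Longrightarrow> - (M * s\<^sup>2 * Re (L2_inner \<Omega> w (wmult \<psi> s w))) \<le> Re (div_form \<Omega> c w (wmult \<psi> s w))) \<Longrightarrow>
      (l - M * s\<^sup>2) * Re (L2_inner \<Omega> x (wmult \<psi> s x)) \<le> Re (L2_inner \<Omega> f (wmult \<psi> s x))"
proof -
  obtain u x B where u: "\<And>n. u n \<in> Da" and x: "x \<in> L2 \<Omega>" and ux: "(\<lambda>n. L2_norm \<Omega> (\<lambda>y. u n y - x y)) \<longlonglongrightarrow> 0"
    and B: "\<And>n. Re (div_form \<Omega> c (u n) (u n)) + l * (L2_norm \<Omega> (u n))\<^sup>2 \<le> B"
    and res: "\<And>n v. v \<in> Da \<Longrightarrow> norm (L2_inner \<Omega> f v - (div_form \<Omega> c (u n) v + of_real l * L2_inner \<Omega> (u n) v))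
       \<le> 1 / Suc n * sqrt (Re (div_form \<Omega> c v v) + l * (L2_norm \<Omega> v)\<^sup>2)"
    using approximate_resolvent[OF f l] by blast
  note uL = Da_L2[OF u]
  have inv: "(\<lambda>n. 1 / real (Suc n)) \<longlonglongrightarrow> 0" by (rule LIMSEQ_Suc[OF lim_1_over_n])
  show ?thesis
  proof (rule that[of x, OF _ x])
    have fx: "(\<lambda>y. f y - of_real l * x y) \<in> L2 \<Omega>" by (intro L2_diff f L2_scale x)
    have B': "\<bar>Re (div_form \<Omega> c (u n) (u n))\<bar> \<le> B" "(L2_norm \<Omega> (u n))\<^sup>2 \<le> B / l" for n
    proof -
      have "0 \<le> l * (L2_norm \<Omega> (u n))\<^sup>2" using l by simp
      then show "\<bar>Re (div_form \<Omega> c (u n) (u n))\<bar> \<le> B"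
        using B[of n] form.re_nonneg[OF u, of n] by linarith
      show "(L2_norm \<Omega> (u n))\<^sup>2 \<le> B / l"
        using B[of n] form.re_nonneg[OF u, of n] l by (simp add: field_simps)
    qed
    from B'(1) have bdd: "bounded (range (\<lambda>n. Re (div_form \<Omega> c (u n) (u n))))" by (auto simp: bounded_iff)
    have "(\<lambda>n. div_form \<Omega> c (u n) v) \<longlonglongrightarrow> L2_inner \<Omega> (\<lambda>y. f y - of_real l * x y) v" if v: "v \<in> Da" for v
    proof -
      have "(\<lambda>n. L2_inner \<Omega> f v - (div_form \<Omega> c (u n) v + of_real l * L2_inner \<Omega> (u n) v)) \<longlonglongrightarrow> 0"
        by (rule Lim_null_comparison[OF always_eventually[OF allI], OF res[OF v]])
          (rule tendsto_mult_left_zero[OF inv])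
      moreover have "(\<lambda>n. L2_inner \<Omega> (u n) v) \<longlonglongrightarrow> L2_inner \<Omega> x v"
        by (rule L2_inner_tendsto) (use uL x ux v Da_L2 in \<open>auto simp: L2_norm_def\<close>)
      ultimately have "(\<lambda>n. L2_inner \<Omega> f v - (L2_inner \<Omega> f v - (div_form \<Omega> c (u n) v + of_real l * L2_inner \<Omega> (u n) v))
          - of_real l * L2_inner \<Omega> (u n) v) \<longlonglongrightarrow> L2_inner \<Omega> f v - 0 - of_real l * L2_inner \<Omega> x v"
        by (intro tendsto_intros)
      then show ?thesis using f x L2_scale[OF x] Da_L2[OF v] by (simp add: L2.diff_left L2.scale_left)
    qed
    then show "(x, \<lambda>y. f y - of_real l * x y) \<in> form_operator \<Omega> Da (div_form \<Omega> c)"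
      unfolding form_operator_def using x fx u bdd ux by blast
    fix \<psi> :: "real^'d \<Rightarrow> real" and M s :: real
    assume \<psi>: "\<psi> \<in> Cb_infty"
      and M: "\<And>w. w \<in> Da \<Longrightarrow> - (M * s\<^sup>2 * Re (L2_inner \<Omega> w (wmult \<psi> s w))) \<le> Re (div_form \<Omega> c w (wmult \<psi> s w))"
    let ?m = "wmult \<psi> s"
    have mu: "?m (u n) \<in> Da" for n by (rule wmult_Da[OF \<psi> u])
    have mL: "?m w \<in> L2 \<Omega>" if "w \<in> L2 \<Omega>" for w by (rule wmult_L2[OF \<psi> that])
    note mux = wmult_tendsto[OF \<psi> uL x ux]
    obtain C where C: "0 \<le> C"
      "\<And>w. w \<in> Da \<Longrightarrow> Re (div_form \<Omega> c (?m w) (?m w)) \<le> C * (Re (div_form \<Omega> c w w) + (L2_norm \<Omega> w)\<^sup>2)"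
      using div_form_wmult_bound[OF \<psi>, of s] by blast
    obtain W where W: "0 < W" "\<And>x. exp (s * \<psi> x) \<le> W" using weight_bound[OF \<psi>] by metis
    \<comment> \<open>Bound for the shifted form at the weighted approximants, uniform in
      \<open>n\<close>: the first summand uses \<open>div_form_wmult_bound\<close>, the second the
      bound \<open>W\<close> of the weight.\<close>
    define R where "R = C * (B + B / l) + l * (W\<^sup>2 * (B / l))"
    have R: "Re (div_form \<Omega> c (?m (u n)) (?m (u n))) + l * (L2_norm \<Omega> (?m (u n)))\<^sup>2 \<le> R" for n
    proof -
      have 1: "Re (div_form \<Omega> c (u n) (u n)) \<le> B" "(L2_norm \<Omega> (u n))\<^sup>2 \<le> B / l"
        using B'[of n] by auto
      have "L2_norm \<Omega> (?m (u n)) \<le> W * L2_norm \<Omega> (u n)"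
        using W by (intro L2_norm_mono uL mL) (auto simp: wmult_def[OF \<psi>] norm_mult intro!: mult_right_mono)
      then have "(L2_norm \<Omega> (?m (u n)))\<^sup>2 \<le> (W * L2_norm \<Omega> (u n))\<^sup>2" by (intro power_mono) auto
      also have "\<dots> \<le> W\<^sup>2 * (B / l)" unfolding power_mult_distrib using 1 by (intro mult_left_mono) auto
      finally have 2: "(L2_norm \<Omega> (?m (u n)))\<^sup>2 \<le> W\<^sup>2 * (B / l)" .
      have "Re (div_form \<Omega> c (?m (u n)) (?m (u n))) \<le> C * (Re (div_form \<Omega> c (u n) (u n)) + (L2_norm \<Omega> (u n))\<^sup>2)"
        by (rule C(2)[OF u])
      also have "\<dots> \<le> C * (B + B / l)" using 1 C(1) by (intro mult_left_mono add_mono)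
      finally show ?thesis unfolding R_def using 2 l by (intro add_mono mult_left_mono) auto
    qed
    have "(l - M * s\<^sup>2) * Re (L2_inner \<Omega> (u n) (?m (u n))) \<le> Re (L2_inner \<Omega> f (?m (u n))) + 1 / Suc n * sqrt R" for n
    proof -
      let ?z = "L2_inner \<Omega> f (?m (u n)) - (div_form \<Omega> c (u n) (?m (u n)) + of_real l * L2_inner \<Omega> (u n) (?m (u n)))"
      have "norm ?z \<le> 1 / Suc n * sqrt R"
        using res[OF mu, of n n] mult_left_mono[OF real_sqrt_le_mono[OF R[of n]], of "1 / Suc n"] by simp
      then have "- Re ?z \<le> 1 / Suc n * sqrt R" using abs_Re_le_cmod[of ?z] by linarith
      then show ?thesis using M[OF u, of n] by (simp add: algebra_simps)
    qed
    moreover have "(\<lambda>n. (l - M * s\<^sup>2) * Re (L2_inner \<Omega> (u n) (?m (u n)))) \<longlonglongrightarrow> (l - M * s\<^sup>2) * Re (L2_inner \<Omega> x (?m x))"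
      by (intro tendsto_intros L2_inner_tendsto uL x mL ux mux)
    moreover have "(\<lambda>n. Re (L2_inner \<Omega> f (?m (u n))) + 1 / Suc n * sqrt R) \<longlonglongrightarrow> Re (L2_inner \<Omega> f (?m x)) + 0"
    proof (intro tendsto_add tendsto_Re L2_inner_tendsto f uL x mL mux tendsto_mult_left_zero[OF inv])
      show "(\<lambda>n. L2_norm \<Omega> (\<lambda>z. f z - f z)) \<longlonglongrightarrow> 0" by (simp add: L2_norm_def)
    qed
    ultimately show "(l - M * s\<^sup>2) * Re (L2_inner \<Omega> x (?m x)) \<le> Re (L2_inner \<Omega> f (?m x))"
      by (intro tendsto_le[OF sequentially_bot]) (auto intro: always_eventually)
  qed
qed

text \<open>The weight \<open>exp (s * \<psi> / 2)\<close> is 1 where \<open>f\<close> lives and at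
  least \<open>exp (s * \<delta> / 2)\<close> where \<open>v\<close> lives. The weighted estimate
  bounds the weighted \<open>x\<close> by a multiple of the norm of \<open>f\<close> alone, and
  transferring the inverse weight to \<open>v\<close> gains the exponential factor. Both constants
  are independent of \<open>l\<close>.\<close>

lemma resolvent_off_diagonal:
  assumes f: "f \<in> L2 \<Omega>" and v: "v \<in> L2 \<Omega>" and K: "compact K" "compact L" "K \<inter> L = {}"
    and supp: "AE x in lebesgue_on \<Omega>. x \<notin> K \<longrightarrow> f x = 0" "AE x in lebesgue_on \<Omega>. x \<notin> L \<longrightarrow> v x = 0"
  obtains C \<kappa> where "0 < \<kappa>" "\<And>l. 0 < l \<Longrightarrow> \<exists>x. (x, \<lambda>y. f y - of_real l * x y) \<in> form_operator \<Omega> Da (div_form \<Omega> c)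
       \<and> norm (L2_inner \<Omega> x v) \<le> C / l * exp (- \<kappa> * sqrt l)"
proof -
  obtain \<psi> \<delta> where \<psi>: "\<psi> \<in> Cb_infty" and \<psi>K: "\<And>x. x \<in> K \<Longrightarrow> \<psi> x = 0"
    and \<delta>: "\<delta> > 0" "\<And>x. x \<in> L \<Longrightarrow> \<delta> \<le> \<psi> x"
    using smooth_separation[OF K] by metis
  obtain M where M: "0 < M"
    "\<And>w s. w \<in> Da \<Longrightarrow> - (M * s\<^sup>2 * Re (L2_inner \<Omega> w (wmult \<psi> s w))) \<le> Re (div_form \<Omega> c w (wmult \<psi> s w))"
    using davies_lower[OF \<psi>] by blast
  \<comment> \<open>With \<open>s = sqrt (l / (2 * M))\<close> as below,
    \<open>\<kappa> * sqrt l\<close> equals \<open>s / 2 * \<delta>\<close>.\<close>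
  define \<kappa> where "\<kappa> = \<delta> / 2 * sqrt (1 / (2 * M))"
  \<comment> \<open>The leading 2 and a factor 2 of the 4 come from \<open>L2_inner_le\<close>; the
    other factor 2 of the 4 compensates for the \<open>l / 2\<close> left in the weighted
    estimate.\<close>
  define C where "C = 2 * (4 * L2_norm \<Omega> f) * L2_norm \<Omega> v"
  show ?thesis
  proof (rule that[of \<kappa> C])
    show "0 < \<kappa>" using \<delta> M by (simp add: \<kappa>_def)
    fix l :: real assume l: "0 < l"
    obtain x where x: "(x, \<lambda>y. f y - of_real l * x y) \<in> form_operator \<Omega> Da (div_form \<Omega> c)" "x \<in> L2 \<Omega>"
      and weighted: "\<And>\<psi> M s. \<psi> \<in> Cb_infty \<Longrightarrow>
      (\<And>w. w \<in> Da \<Longrightarrow> - (M * s\<^sup>2 * Re (L2_inner \<Omega> w (wmult \<psi> s w))) \<le> Re (div_form \<Omega> c w (wmult \<psi> s w))) \<Longrightarrow>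
      (l - M * s\<^sup>2) * Re (L2_inner \<Omega> x (wmult \<psi> s x)) \<le> Re (L2_inner \<Omega> f (wmult \<psi> s x))"
      by (rule resolvent[OF f l]) blast
    note est = weighted[OF \<psi> M(2)]
    \<comment> \<open>Davies' loss \<open>M * s^2\<close> is set to \<open>l / 2\<close>: this is
      the largest order of \<open>s\<close> for which a fixed part of \<open>l\<close>
      survives.\<close>
    define s where "s = sqrt (l / (2 * M))"
    have s: "0 \<le> s" "M * s\<^sup>2 = l / 2" using l M by (auto simp: s_def)
    note mL = wmult_L2[OF \<psi>]
    define N where "N = L2_norm \<Omega> (wmult \<psi> (s / 2) x)"
    have "Re (L2_inner \<Omega> x (wmult \<psi> s x)) = (LINT y|lebesgue_on \<Omega>. exp (s * \<psi> y) * (norm (x y))\<^sup>2)"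
      by (rule Re_L2_inner_wmult[OF \<psi> x(2)])
    also have "\<dots> = (LINT y|lebesgue_on \<Omega>. (norm (wmult \<psi> (s / 2) x y))\<^sup>2)"
      by (intro Bochner_Integration.integral_cong)
        (auto simp: wmult_def[OF \<psi>] norm_mult power_mult_distrib exp_double[symmetric])
    also have "\<dots> = N\<^sup>2" by (simp add: N_def L2_norm_def)
    finally have N: "Re (L2_inner \<Omega> x (wmult \<psi> s x)) = N\<^sup>2" .
    \<comment> \<open>\<open>\<psi>\<close> vanishes on \<open>K\<close>, so next to
      \<open>f\<close> the weights for \<open>s\<close> and \<open>s / 2\<close> agree; this brings
      the right-hand side down to first order in \<open>N\<close>.\<close>
    have "L2_inner \<Omega> f (wmult \<psi> s x) = L2_inner \<Omega> f (wmult \<psi> (s / 2) x)"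
      using supp(1) by (intro L2_inner_cong_AE f mL x) (auto elim!: eventually_mono simp: wmult_def[OF \<psi>] \<psi>K)
    then have "Re (L2_inner \<Omega> f (wmult \<psi> s x)) \<le> norm (L2_inner \<Omega> f (wmult \<psi> (s / 2) x))"
      using complex_Re_le_cmod by simp
    also have "\<dots> \<le> 2 * L2_norm \<Omega> f * N" unfolding N_def by (intro L2_inner_le f mL x)
    finally have "l / 2 * N\<^sup>2 \<le> 2 * L2_norm \<Omega> f * N" using est[of s] unfolding N s by simp
    then have NN: "N * N \<le> (4 * L2_norm \<Omega> f / l) * N" using l by (simp add: field_simps power2_eq_square)
    have N_le: "N \<le> 4 * L2_norm \<Omega> f / l"
    proof (cases "N = 0")
      case False
      then have "0 < N" by (simp add: N_def less_le)
      with NN show ?thesis by (rule mult_right_le_imp_le)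
    qed (use l in simp)
    have v_le: "L2_norm \<Omega> (wmult \<psi> (- s / 2) v) \<le> exp (- \<kappa> * sqrt l) * L2_norm \<Omega> v"
    proof (rule L2_norm_mono[OF v mL[OF v]])
      have ks: "\<kappa> * sqrt l = s / 2 * \<delta>"
        by (simp add: \<kappa>_def s_def real_sqrt_divide real_sqrt_mult mult_ac)
      show "AE y in lebesgue_on \<Omega>. norm (wmult \<psi> (- s / 2) v y) \<le> exp (- \<kappa> * sqrt l) * norm (v y)"
        using supp(2)
      proof eventually_elim
        case (elim y)
        show ?case
        proof (cases "y \<in> L")
          case True
          then have "s / 2 * \<delta> \<le> s / 2 * \<psi> y" using \<delta> s by (intro mult_left_mono) auto
          then show ?thesis by (auto simp: wmult_def[OF \<psi>] norm_mult ks intro!: mult_right_mono)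
        qed (use elim in \<open>simp add: wmult_def[OF \<psi>]\<close>)
      qed
    qed auto
    have "L2_inner \<Omega> x v = L2_inner \<Omega> (wmult \<psi> (s / 2) x) (wmult \<psi> (- s / 2) v)"
    proof (intro L2_inner_cong_AE x v mL AE_I2)
      fix y
      have "complex_of_real (exp (s / 2 * \<psi> y)) * of_real (exp (- s / 2 * \<psi> y)) = 1"
        by (simp flip: of_real_mult exp_add)
      then show "x y * cnj (v y) = wmult \<psi> (s / 2) x y * cnj (wmult \<psi> (- s / 2) v y)"
        by (simp add: wmult_def[OF \<psi>] del: of_real_exp)
    qed
    then have "norm (L2_inner \<Omega> x v) \<le> 2 * N * L2_norm \<Omega> (wmult \<psi> (- s / 2) v)"
      unfolding N_def by (simp add: L2_inner_le mL x v)
    also have "\<dots> \<le> 2 * (4 * L2_norm \<Omega> f / l) * (exp (- \<kappa> * sqrt l) * L2_norm \<Omega> v)"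
      using N_le l by (intro mult_mono v_le) (auto simp: N_def)
    also have "\<dots> = C / l * exp (- \<kappa> * sqrt l)" by (simp add: C_def)
    finally show "\<exists>x. (x, \<lambda>y. f y - of_real l * x y) \<in> form_operator \<Omega> Da (div_form \<Omega> c)
       \<and> norm (L2_inner \<Omega> x v) \<le> C / l * exp (- \<kappa> * sqrt l)" using x(1) by blast
  qed
qed

end

section \<open>Closed forms\<close>

text \<open>A closed form may have any real vertex. Adding \<open>g\<close> times the inner product
  makes the theory for vertex 0 applicable and lets the form norm dominate the \<open>L2\<close>
  norm.\<close>

locale shifted_closed_form =
  fixes \<Omega> :: "(real^'d::finite) set" and D :: "(real^'d \<Rightarrow> complex) set"
    and b :: "(real^'d \<Rightarrow> complex) \<Rightarrow> (real^'d \<Rightarrow> complex) \<Rightarrow> complex" and g T :: real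
  assumes closed: "closed_sectorial_form \<Omega> D b" and g_nonneg: "0 \<le> g"
    and shifted: "sectorial D (\<lambda>u v. b u v + of_real g * L2_inner \<Omega> u v) T"
    and coercive: "u \<in> D \<Longrightarrow> (L2_norm \<Omega> u)\<^sup>2 \<le> Re (b u u + of_real g * L2_inner \<Omega> u u)"

lemma closed_sectorial_form_shift:
  assumes "closed_sectorial_form \<Omega> D b"
  obtains g T where "shifted_closed_form \<Omega> D b g T"
proof -
  have sq: "sesquilinear_form \<Omega> D b" using assms by (simp add: closed_sectorial_form_def sectorial_form_def)
  obtain \<theta> \<gamma> where \<theta>: "0 \<le> \<theta>" "\<theta> < pi / 2"
    and sec: "\<And>u. u \<in> D \<Longrightarrow> b u u - of_real (\<gamma> * (L2_norm \<Omega> u)\<^sup>2) \<in> sector \<theta>"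
    using assms unfolding closed_sectorial_form_def sectorial_form_def by blast
  have DL: "D \<subseteq> L2 \<Omega>" and D: "(\<lambda>x. 0) \<in> D" "\<And>u v. u \<in> D \<Longrightarrow> v \<in> D \<Longrightarrow> (\<lambda>x. u x + v x) \<in> D"
    "\<And>u s. u \<in> D \<Longrightarrow> (\<lambda>x. s * u x) \<in> D"
    using sq by (auto simp: sesquilinear_form_def L2_subspace_def)
  have b: "\<And>u u' v. u \<in> D \<Longrightarrow> u' \<in> D \<Longrightarrow> v \<in> D \<Longrightarrow> b (\<lambda>x. u x + u' x) v = b u v + b u' v"
    "\<And>u v v'. u \<in> D \<Longrightarrow> v \<in> D \<Longrightarrow> v' \<in> D \<Longrightarrow> b u (\<lambda>x. v x + v' x) = b u v + b u v'"
    "\<And>u v s. u \<in> D \<Longrightarrow> v \<in> D \<Longrightarrow> b (\<lambda>x. s * u x) v = s * b u v"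
    "\<And>u v s. u \<in> D \<Longrightarrow> v \<in> D \<Longrightarrow> b u (\<lambda>x. s * v x) = cnj s * b u v"
    using sq by (auto simp: sesquilinear_form_def)
  \<comment> \<open>\<open>\<bar>\<gamma>\<bar>\<close> moves the vertex to a nonnegative number,
    and the extra 1 yields coercivity; the angle can be kept, since the shift leaves the imaginary
    part alone and only enlarges the real part.\<close>
  define g where "g = \<bar>\<gamma>\<bar> + 1"
  let ?a = "\<lambda>u v. b u v + of_real g * L2_inner \<Omega> u v"
  have T: "0 \<le> tan \<theta>" using \<theta> by (cases "\<theta> = 0") (auto intro!: less_imp_le[OF tan_gt_zero])
  have re: "Re (?a u u) = Re (b u u) + g * (L2_norm \<Omega> u)\<^sup>2" and im: "Im (?a u u) = Im (b u u)" for u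
    by (simp_all add: L2_inner_diag)
  have co: "(L2_norm \<Omega> u)\<^sup>2 \<le> Re (?a u u)" "\<bar>Im (?a u u)\<bar> \<le> tan \<theta> * Re (?a u u)" if u: "u \<in> D" for u
  proof -
    note z = sector_Re_Im[OF sec[OF u] \<theta>]
    have "- \<gamma> * (L2_norm \<Omega> u)\<^sup>2 \<le> \<bar>\<gamma>\<bar> * (L2_norm \<Omega> u)\<^sup>2" by (intro mult_right_mono) auto
    then have 1: "Re (b u u) - \<gamma> * (L2_norm \<Omega> u)\<^sup>2 + (L2_norm \<Omega> u)\<^sup>2 \<le> Re (?a u u)"
      unfolding re by (simp add: g_def distrib_right)
    show "(L2_norm \<Omega> u)\<^sup>2 \<le> Re (?a u u)" using 1 z(1) by simp
    have "tan \<theta> * (Re (b u u) - \<gamma> * (L2_norm \<Omega> u)\<^sup>2) \<le> tan \<theta> * Re (?a u u)"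
      using 1 zero_le_power2[of "L2_norm \<Omega> u"] by (intro mult_left_mono T) linarith
    then show "\<bar>Im (?a u u)\<bar> \<le> tan \<theta> * Re (?a u u)" unfolding im using z(2) by simp
  qed
  have "sectorial D ?a (tan \<theta>)"
  proof
    fix u assume u: "u \<in> D"
    show "0 \<le> Re (?a u u)" using co(1)[OF u] zero_le_power2[of "L2_norm \<Omega> u"] by linarith
    show "\<bar>Im (?a u u)\<bar> \<le> tan \<theta> * Re (?a u u)" by (rule co(2)[OF u])
  qed (use D b DL T in \<open>auto simp: L2.sesq_rules subsetD[OF DL] algebra_simps\<close>)
  then have "shifted_closed_form \<Omega> D b g (tan \<theta>)"
    by unfold_locales (use assms co in \<open>auto simp: g_def sectorial_def sesquilinear_def sectorial_axioms_def\<close>)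
  then show ?thesis by (rule that)
qed

section \<open>Null sequences for closed forms\<close>

context shifted_closed_form
begin

abbreviation shift where "shift u v \<equiv> b u v + of_real g * L2_inner \<Omega> u v"

sublocale S: sectorial D shift T by (rule shifted)

lemma D_L2: "u \<in> D \<Longrightarrow> u \<in> L2 \<Omega>"
  using closed by (auto simp: closed_sectorial_form_def sectorial_form_def sesquilinear_form_def L2_subspace_def)

lemma L2_norm_le_qnorm: "u \<in> D \<Longrightarrow> L2_norm \<Omega> u \<le> S.qnorm u"
  using coercive[of u] by (simp add: S.qnorm_def real_le_rsqrt)

lemma form_bound:
  assumes "u \<in> D" "v \<in> D"
  shows "norm (b u v) \<le> (2 * (1 + T) + 2 * g) * S.qnorm u * S.qnorm v"
proof -
  have "norm (b u v) \<le> norm (shift u v) + norm (of_real g * L2_inner \<Omega> u v)"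
    using norm_triangle_ineq4[of "shift u v" "of_real g * L2_inner \<Omega> u v"] by simp
  also have "\<dots> \<le> 2 * (1 + T) * S.qnorm u * S.qnorm v + g * (2 * L2_norm \<Omega> u * L2_norm \<Omega> v)"
    using g_nonneg S.norm_le[OF assms] L2_inner_le[OF assms[THEN D_L2]]
    by (intro add_mono) (auto simp: norm_mult intro!: mult_left_mono)
  also have "\<dots> \<le> 2 * (1 + T) * S.qnorm u * S.qnorm v + g * (2 * S.qnorm u * S.qnorm v)"
    using g_nonneg by (intro add_left_mono mult_left_mono mult_mono L2_norm_le_qnorm assms) (auto simp: assms)
  finally show ?thesis by (simp add: algebra_simps)
qed

lemma form_diff_left: "u \<in> D \<Longrightarrow> u' \<in> D \<Longrightarrow> v \<in> D \<Longrightarrow> b (\<lambda>x. u x - u' x) v = b u v - b u' v"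
  using S.diff_left[of u u' v] by (simp add: L2.diff_left D_L2 algebra_simps)

lemma form_scale_left: "u \<in> D \<Longrightarrow> v \<in> D \<Longrightarrow> b (\<lambda>x. s * u x) v = s * b u v"
  using S.scale_left[of u v s] by (simp add: L2.scale_left D_L2 algebra_simps)

lemma form_add_left: "u \<in> D \<Longrightarrow> u' \<in> D \<Longrightarrow> v \<in> D \<Longrightarrow> b (\<lambda>x. u x + u' x) v = b u v + b u' v"
  using S.add_left[of u u' v] by (simp add: L2.add_left D_L2 algebra_simps)

text \<open>Closedness applied with limit 0: a form-Cauchy sequence that is null in
  \<open>L2\<close> is null in the form norm. A Cauchy bound by a sum \<open>F n + F m\<close>
  passes directly to the product filter.\<close>

lemma qnorm_Cauchy_null:
  assumes w: "\<And>n. w n \<in> D" and null: "(\<lambda>n. L2_norm \<Omega> (w n)) \<longlonglongrightarrow> 0"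
    and F: "F \<longlonglongrightarrow> 0" "\<And>n m. (S.qnorm (\<lambda>x. w n x - w m x))\<^sup>2 \<le> F n + F m"
  shows "(\<lambda>n. S.qnorm (w n)) \<longlonglongrightarrow> 0"
proof -
  define C where "C = 2 * (1 + T) + 2 * g"
  have C: "0 \<le> C" using g_nonneg S.T_nonneg by (simp add: C_def)
  have d: "(\<lambda>x. w n x - w m x) \<in> D" for n m by (intro S.diff_mem w)
  have le: "norm (b (\<lambda>x. w n x - w m x) (\<lambda>x. w n x - w m x)) \<le> C * (F n + F m)" for n m
  proof -
    have "norm (b (\<lambda>x. w n x - w m x) (\<lambda>x. w n x - w m x)) \<le> C * (S.qnorm (\<lambda>x. w n x - w m x))\<^sup>2"
      using form_bound[OF d d, of n m n m] by (simp add: C_def power2_eq_square)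
    also have "\<dots> \<le> C * (F n + F m)" by (intro mult_left_mono F C)
    finally show ?thesis .
  qed
  have "((\<lambda>p. C * (F (fst p) + F (snd p))) \<longlongrightarrow> C * (0 + 0)) (sequentially \<times>\<^sub>F sequentially)"
    by (intro tendsto_intros filterlim_compose[OF F(1) filterlim_fst] filterlim_compose[OF F(1) filterlim_snd])
  then have "((\<lambda>p. C * (F (fst p) + F (snd p))) \<longlongrightarrow> 0) (sequentially \<times>\<^sub>F sequentially)" by simp
  then have "((\<lambda>(n, m). b (\<lambda>x. w n x - w m x) (\<lambda>x. w n x - w m x)) \<longlongrightarrow> 0) (sequentially \<times>\<^sub>F sequentially)"
    by (rule Lim_null_comparison[rotated]) (simp add: always_eventually case_prod_beta le)
  then have "form_converges \<Omega> D b w (\<lambda>x. 0)"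
    unfolding form_converges_def using w null by simp
  then have "(\<lambda>n. b (w n) (w n)) \<longlonglongrightarrow> 0"
    using closed unfolding closed_sectorial_form_def by fastforce
  then have "(\<lambda>n. sqrt (Re (b (w n) (w n)) + g * (L2_norm \<Omega> (w n))\<^sup>2)) \<longlonglongrightarrow> sqrt (Re 0 + g * 0\<^sup>2)"
    by (intro tendsto_intros null)
  then show ?thesis by (simp add: S.qnorm_def L2_inner_diag)
qed

text \<open>Replaces weak compactness: near-minimisers of the norm in the convex sets of elements close to
  the tail of the sequence form a Cauchy sequence by the parallelogram law.\<close>

theorem bounded_null_limit:
  assumes v: "v \<in> D" and e: "\<And>n. e n \<in> D" and bnd: "\<And>n. S.qnorm (e n) \<le> C"
    and null: "(\<lambda>n. L2_norm \<Omega> (e n)) \<longlonglongrightarrow> 0" and lim: "(\<lambda>n. b (e n) v) \<longlonglongrightarrow> z"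
  shows "z = 0"
proof -
  define \<epsilon> where "\<epsilon> n = 1 / real (Suc n)" for n
  have \<epsilon>: "0 < \<epsilon> n" for n by (simp add: \<epsilon>_def)
  have \<epsilon>_mono: "\<epsilon> m \<le> \<epsilon> n" if "n \<le> m" for n m using that by (simp add: \<epsilon>_def divide_left_mono)
  have \<epsilon>_lim: "\<epsilon> \<longlonglongrightarrow> 0" unfolding \<epsilon>_def by (rule LIMSEQ_Suc[OF lim_1_over_n])
  \<comment> \<open>Convex decreasing sets: small in \<open>L2\<close>, with the value of the
    functional near \<open>z\<close>. Each contains some \<open>e k\<close>, and the second
    condition passes the limit \<open>z\<close> on to any selection from these sets.\<close>
  define A where "A n = {w \<in> D. L2_norm \<Omega> w \<le> \<epsilon> n \<and> norm (b w v - z) \<le> \<epsilon> n}" for n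
  have A_mono: "A m \<subseteq> A n" if "n \<le> m" for n m
    using \<epsilon>_mono[OF that] by (auto simp: A_def)
  have A_mid: "(\<lambda>x. (1/2) * (w x + w' x)) \<in> A n" if w: "w \<in> A n" "w' \<in> A n" for w w' n
  proof -
    have ww: "w \<in> D" "w' \<in> D" using w by (auto simp: A_def)
    note D = ww S.add_mem[OF ww] S.scale_mem[OF S.add_mem[OF ww], of "1/2"]
    have "(L2_norm \<Omega> (\<lambda>x. (1/2) * (w x + w' x)))\<^sup>2 = 1 / 4 * (L2_norm \<Omega> (\<lambda>x. w x + w' x))\<^sup>2"
      by (simp only: L2_norm_scale[OF D_L2[OF D(3)]] power_mult_distrib) (simp add: power2_eq_square norm_divide)
    also have "\<dots> \<le> 1 / 4 * (2 * (L2_norm \<Omega> w)\<^sup>2 + 2 * (L2_norm \<Omega> w')\<^sup>2)"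
      by (intro mult_left_mono L2_norm_add_sq D_L2 D) auto
    also have "\<dots> \<le> 1 / 4 * (2 * (\<epsilon> n)\<^sup>2 + 2 * (\<epsilon> n)\<^sup>2)"
      using w by (intro mult_left_mono add_mono power_mono) (auto simp: A_def)
    finally have "(L2_norm \<Omega> (\<lambda>x. (1/2) * (w x + w' x)))\<^sup>2 \<le> (\<epsilon> n)\<^sup>2" by simp
    then have 1: "L2_norm \<Omega> (\<lambda>x. (1/2) * (w x + w' x)) \<le> \<epsilon> n"
      by (rule power2_le_imp_le[OF _ less_imp_le[OF \<epsilon>]])
    have "b (\<lambda>x. (1/2) * (w x + w' x)) v - z = (1/2) * ((b w v - z) + (b w' v - z))"
      unfolding form_scale_left[OF D(3) v] form_add_left[OF D(1,2) v] by (simp add: field_simps)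
    then have "norm (b (\<lambda>x. (1/2) * (w x + w' x)) v - z) \<le> 1 / 2 * (norm (b w v - z) + norm (b w' v - z))"
      using norm_triangle_ineq[of "b w v - z" "b w' v - z"] by (simp only: norm_mult) simp
    also have "\<dots> \<le> 1 / 2 * (\<epsilon> n + \<epsilon> n)" using w by (intro mult_left_mono add_mono) (auto simp: A_def)
    finally show ?thesis using 1 D by (simp add: A_def)
  qed
  have A_e: "\<exists>k. e k \<in> A n" for n
  proof -
    have "eventually (\<lambda>k. L2_norm \<Omega> (e k) < \<epsilon> n) sequentially" using null \<epsilon>[of n] by (rule order_tendstoD)
    moreover have "eventually (\<lambda>k. dist (b (e k) v) z < \<epsilon> n) sequentially" using lim \<epsilon>[of n] by (rule tendstoD)
    ultimately have "eventually (\<lambda>k. e k \<in> A n) sequentially"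
      by eventually_elim (auto simp: A_def e dist_norm)
    then show ?thesis by (auto dest: eventually_happens)
  qed
  define Q where "Q n = (\<lambda>w. (S.qnorm w)\<^sup>2) ` A n" for n
  \<comment> \<open>The sets shrink, so their infima increase; the given sequence bounds them by
    \<open>C^2\<close>, hence they converge.\<close>
  define m where "m n = Inf (Q n)" for n
  have bdd: "bdd_below (Q n)" and ne: "Q n \<noteq> {}" for n
    using A_e[of n] by (auto simp: Q_def intro!: bdd_belowI2[of _ 0])
  have m_le: "m n \<le> (S.qnorm w)\<^sup>2" if "w \<in> A n" for n w
    unfolding m_def using that by (intro cInf_lower bdd) (auto simp: Q_def)
  have m_inc: "incseq m"
    unfolding m_def by (intro incseq_SucI cInf_superset_mono ne bdd) (use A_mono[of n "Suc n" for n] in \<open>auto simp: Q_def\<close>)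
  have m_bd: "m n \<le> C\<^sup>2" for n
  proof -
    obtain k where "e k \<in> A n" using A_e by blast
    then have "m n \<le> (S.qnorm (e k))\<^sup>2" by (rule m_le)
    also have "\<dots> \<le> C\<^sup>2" using bnd e by (intro power_mono) auto
    finally show ?thesis .
  qed
  obtain M where M: "m \<longlonglongrightarrow> M" "\<And>n. m n \<le> M"
    using incseq_convergent[OF m_inc, of "C\<^sup>2"] m_bd by blast
  have "\<exists>w. w \<in> A n \<and> (S.qnorm w)\<^sup>2 < m n + \<epsilon> n" for n
    using cInf_less_iff[OF ne bdd, of n "m n + \<epsilon> n"] \<epsilon>[of n] unfolding m_def[symmetric] by (auto simp: Q_def)
  then have "\<forall>n. \<exists>w. w \<in> A n \<and> (S.qnorm w)\<^sup>2 < m n + \<epsilon> n" ..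
  from choice[OF this] obtain w where w: "\<And>n. w n \<in> A n" "\<And>n. (S.qnorm (w n))\<^sup>2 < m n + \<epsilon> n" by blast
  have wD: "w n \<in> D" and wL: "L2_norm \<Omega> (w n) \<le> \<epsilon> n" and wz: "norm (b (w n) v - z) \<le> \<epsilon> n" for n
    using w(1)[of n] by (auto simp: A_def)
  \<comment> \<open>From the parallelogram law: with \<open>j = min n k\<close>, both
    near-minimisers lie in \<open>A j\<close>, so their midpoint has squared norm at least
    \<open>m j\<close>, which is \<open>m n\<close> or \<open>m k\<close>. Convergence of
    \<open>m\<close> to \<open>M\<close> makes \<open>F\<close> a null sequence.\<close>
  define F where "F n = 4 * (M - m n) + 2 * \<epsilon> n" for n
  have "(\<lambda>n. S.qnorm (w n)) \<longlonglongrightarrow> 0"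
  proof (rule qnorm_Cauchy_null[where w = w and F = F, OF wD])
    show "(\<lambda>n. L2_norm \<Omega> (w n)) \<longlonglongrightarrow> 0"
      by (rule Lim_null_comparison[OF always_eventually[OF allI] \<epsilon>_lim]) (simp add: wL)
    have "F \<longlonglongrightarrow> 4 * (M - M) + 2 * 0" unfolding F_def by (intro tendsto_intros M \<epsilon>_lim)
    then show "F \<longlonglongrightarrow> 0" by simp
    fix n k :: nat
    define j where "j = min n k"
    have "m j \<le> (S.qnorm (\<lambda>x. (1/2) * (w n x + w k x)))\<^sup>2"
      using w(1) A_mono[of j n] A_mono[of j k] by (intro m_le A_mid) (auto simp: j_def)
    moreover have "m j = m n \<or> m j = m k" by (auto simp: j_def min_def)
    ultimately show "(S.qnorm (\<lambda>x. w n x - w k x))\<^sup>2 \<le> F n + F k"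
      unfolding S.parallelogram[OF wD wD] F_def using w(2)[of n] w(2)[of k] M(2)[of n] M(2)[of k] by auto
  qed
  then have "(\<lambda>n. (2 * (1 + T) + 2 * g) * S.qnorm (w n) * S.qnorm v) \<longlonglongrightarrow> (2 * (1 + T) + 2 * g) * 0 * S.qnorm v"
    by (intro tendsto_intros)
  then have "(\<lambda>n. (2 * (1 + T) + 2 * g) * S.qnorm (w n) * S.qnorm v) \<longlonglongrightarrow> 0" by simp
  then have "(\<lambda>n. b (w n) v) \<longlonglongrightarrow> 0"
    by (rule Lim_null_comparison[rotated]) (intro always_eventually allI form_bound wD v)
  moreover have "(\<lambda>n. b (w n) v - z) \<longlonglongrightarrow> 0"
    by (rule Lim_null_comparison[OF always_eventually[OF allI] \<epsilon>_lim]) (rule wz)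
  then have "(\<lambda>n. b (w n) v) \<longlonglongrightarrow> z" by (simp add: LIM_zero_iff)
  ultimately show "z = 0" using LIMSEQ_unique by blast
qed

end

section \<open>Locality of the relaxed form\<close>

text \<open>The definition involves two closures of the same regular part, one carrying the operator
  and one being the form in question. Minimality makes each extend the other, so their operators
  coincide.\<close>

lemma is_relaxed_form_kato:
  assumes "is_relaxed_form \<Omega> D a D' b'"
  shows "closed_sectorial_form \<Omega> D' b'" and "kato_operator \<Omega> D' b' = form_operator \<Omega> D a"
proof -
  obtain r D'' b'' where r: "is_form_closure \<Omega> D r D' b'" "is_form_closure \<Omega> D r D'' b''"
    "kato_operator \<Omega> D'' b'' = form_operator \<Omega> D a"
    using assms unfolding is_relaxed_form_def is_regular_part_def by blast
  show "closed_sectorial_form \<Omega> D' b'" using r(1) by (simp add: is_form_closure_def)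
  have e: "form_extends D' b' D'' b''" "form_extends D'' b'' D' b'"
    using r(1,2) unfolding is_form_closure_def by blast+
  then have "D' = D''" by (auto simp: form_extends_def)
  moreover from this e have "\<forall>u\<in>D''. \<forall>v\<in>D''. b' u v = b'' u v" by (auto simp: form_extends_def)
  ultimately have "kato_operator \<Omega> D' b' = kato_operator \<Omega> D'' b''"
    by (auto simp: kato_operator_def)
  with r(3) show "kato_operator \<Omega> D' b' = form_operator \<Omega> D a" by simp
qed

text \<open>In terms of \<open>y = \<kappa> * sqrt l\<close> the expression is a multiple of
  \<open>y^2 / exp y\<close>.\<close>

lemma mult_exp_sqrt_tendsto_0:
  assumes "0 < \<kappa>" "filterlim l at_top F"
  shows "((\<lambda>n. l n * exp (- \<kappa> * sqrt (l n))) \<longlongrightarrow> 0) F"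
proof -
  have "filterlim (\<lambda>n. \<kappa> * sqrt (l n)) at_top F"
    by (intro filterlim_tendsto_pos_mult_at_top[OF tendsto_const assms(1)] filterlim_compose[OF sqrt_at_top assms(2)])
  from filterlim_compose[OF tendsto_power_div_exp_0[of 2] this]
  have "((\<lambda>n. 1 / \<kappa>\<^sup>2 * ((\<kappa> * sqrt (l n))\<^sup>2 / exp (\<kappa> * sqrt (l n)))) \<longlongrightarrow> 1 / \<kappa>\<^sup>2 * 0) F"
    by (rule tendsto_mult_left)
  moreover have "eventually (\<lambda>n. 1 / \<kappa>\<^sup>2 * ((\<kappa> * sqrt (l n))\<^sup>2 / exp (\<kappa> * sqrt (l n))) = l n * exp (- \<kappa> * sqrt (l n))) F"
    using filterlim_at_top_dense[THEN iffD1, OF assms(2), rule_format, of 0]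
    by eventually_elim (use assms(1) in \<open>simp add: power_mult_distrib exp_minus field_simps\<close>)
  ultimately show ?thesis by (auto elim: Lim_transform_eventually)
qed

theorem corollary4p3:
  fixes \<Omega> :: "(real^'d::finite) set"
    and c :: "'d \<Rightarrow> 'd \<Rightarrow> real^'d \<Rightarrow> complex"
    and \<theta> :: real
    and Da Dr :: "(real^'d \<Rightarrow> complex) set"
    and ar :: "(real^'d \<Rightarrow> complex) \<Rightarrow> (real^'d \<Rightarrow> complex) \<Rightarrow> complex"
    and u v :: "real^'d \<Rightarrow> complex"
  assumes "open \<Omega>"
    and "\<And>i j. c i j \<in> L_infty \<Omega>"
    and "0 \<le> \<theta>" and "\<theta> < pi / 2"
    and "AE x in lebesgue_on \<Omega>. \<forall>\<xi>::complex^'d.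
           (\<Sum>i\<in>UNIV. \<Sum>j\<in>UNIV. c i j x * \<xi> $ i * cnj (\<xi> $ j)) \<in> sector \<theta>"
    and "L2_subspace \<Omega> Da" and "Da \<subseteq> H1 \<Omega>" and "Cc_infty \<Omega> \<subseteq> Da"
    and "\<And>w \<rho> \<psi>. w \<in> Da \<Longrightarrow> \<psi> \<in> Cb_infty \<Longrightarrow> (\<lambda>x. of_real (exp (\<rho> * \<psi> x)) * w x) \<in> Da"
    and "is_relaxed_form \<Omega> Da (div_form \<Omega> c) Dr ar"
    and "u \<in> Dr" and "v \<in> Dr"
    and "compact (ess_support \<Omega> u)" and "compact (ess_support \<Omega> v)"
    and "ess_support \<Omega> u \<inter> ess_support \<Omega> v = {}"
  shows "ar u v = 0"
proof -
  note sector = sector_Re_Im[OF _ \<open>0 \<le> \<theta>\<close> \<open>\<theta> < pi / 2\<close>]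
  have T: "0 \<le> tan \<theta>"
    using \<open>0 \<le> \<theta>\<close> \<open>\<theta> < pi / 2\<close> by (cases "\<theta> = 0") (auto intro!: less_imp_le[OF tan_gt_zero])
  have "AE x in lebesgue_on \<Omega>. sectorial UNIV (matrix_form (\<lambda>i j. c i j x)) (tan \<theta>)"
    using assms(5)
  proof eventually_elim
    case (elim x)
    have *: "matrix_form (\<lambda>i j. c i j x) \<xi> \<xi> \<in> sector \<theta>" for \<xi>
      using elim[rule_format, of "\<chi> i. \<xi> i"] by (simp add: matrix_form_def mult.commute)
    show ?case
      by (intro sectorial.intro sesquilinear_matrix_form sectorial_axioms.intro T sector *)
  qed
  then interpret elliptic_form \<Omega> c "tan \<theta>" Da
    using assms T by unfold_locales auto
  note relaxed = is_relaxed_form_kato[OF assms(10)]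
  obtain g B where "shifted_closed_form \<Omega> Dr ar g B"
    by (rule closed_sectorial_form_shift[OF relaxed(1)])
  then interpret R: shifted_closed_form \<Omega> Dr ar g B .
  note uv = \<open>u \<in> Dr\<close> \<open>v \<in> Dr\<close> and uvL = R.D_L2[OF \<open>u \<in> Dr\<close>] R.D_L2[OF \<open>v \<in> Dr\<close>]
  note supp = ess_support_AE[OF assms(1), of u] ess_support_AE[OF assms(1), of v]
  obtain C \<kappa> where \<kappa>: "0 < \<kappa>"
    and res: "\<And>l. 0 < l \<Longrightarrow> \<exists>x. (x, \<lambda>y. u y - of_real l * x y) \<in> form_operator \<Omega> Da (div_form \<Omega> c)
       \<and> norm (L2_inner \<Omega> x v) \<le> C / l * exp (- \<kappa> * sqrt l)"
    using resolvent_off_diagonal[OF uvL assms(13-15) supp] by blast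
  \<comment> \<open>The part \<open>g\<close> of the parameter pays for the shift in
    \<open>qnorm\<close>; the remainder \<open>n + 1\<close> tends to infinity and forces the
    \<open>L2\<close> norms below to zero.\<close>
  define l where "l n = g + real (Suc n)" for n
  have l: "0 < l n" for n using R.g_nonneg by (simp add: l_def)
  have l_top: "filterlim l at_top sequentially"
    unfolding l_def by (intro filterlim_tendsto_add_at_top[OF tendsto_const] filterlim_compose[OF filterlim_real_sequentially filterlim_Suc])
  obtain x where x: "\<And>n. (x n, \<lambda>y. u y - of_real (l n) * x n y) \<in> kato_operator \<Omega> Dr ar"
    and xv: "\<And>n. norm (L2_inner \<Omega> (x n) v) \<le> C / l n * exp (- \<kappa> * sqrt (l n))"
    using res[OF l] unfolding relaxed(2) by metis
  have xD: "x n \<in> Dr" and xw: "\<And>w. w \<in> Dr \<Longrightarrow> ar (x n) w = L2_inner \<Omega> (\<lambda>y. u y - of_real (l n) * x n y) w" for n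
    using x[of n] by (auto simp: kato_operator_def)
  \<comment> \<open>The error in approximating \<open>u\<close> by \<open>l n\<close> times the
    resolvent vector \<open>x n\<close>. Working with the error rather than with the approximants
    places the sequence in the setting of \<open>bounded_null_limit\<close>.\<close>
  define e where "e n = (\<lambda>y. of_real (l n) * x n y - u y)" for n
  have e: "e n \<in> Dr" for n unfolding e_def by (intro R.S.diff_mem R.S.scale_mem xD uv)
  have ar_e: "ar (e n) w = - of_real (l n) * L2_inner \<Omega> (e n) w - ar u w" if "w \<in> Dr" for n w
  proof -
    have "ar (e n) w = of_real (l n) * L2_inner \<Omega> (\<lambda>y. u y - of_real (l n) * x n y) w - ar u w"
      unfolding e_def by (simp add: R.form_diff_left R.form_scale_left R.S.scale_mem xD uv that xw)
    also have "L2_inner \<Omega> (\<lambda>y. u y - of_real (l n) * x n y) w = - L2_inner \<Omega> (e n) w"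
      unfolding e_def by (simp add: L2.diff_left L2.scale_left L2_scale R.D_L2 xD uv that)
    finally show ?thesis by simp
  qed
  define C0 where "C0 = (2 * (1 + B) + 2 * g) * R.S.qnorm u"
  have C0: "0 \<le> C0" using R.S.T_nonneg R.g_nonneg uv by (simp add: C0_def)
  \<comment> \<open>Obtained by testing the equation for \<open>e n\<close> with \<open>e n\<close>
    itself. Both terms on the left are nonnegative: one gives the bound in the form norm, the other
    a decay of order \<open>1 / sqrt n\<close> in \<open>L2\<close>.\<close>
  have main: "(R.S.qnorm (e n))\<^sup>2 + real (Suc n) * (L2_norm \<Omega> (e n))\<^sup>2 \<le> C0 * R.S.qnorm (e n)" for n
  proof -
    have "(R.S.qnorm (e n))\<^sup>2 = Re (ar (e n) (e n)) + g * (L2_norm \<Omega> (e n))\<^sup>2"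
      by (simp add: R.S.qnorm_sq e L2_inner_diag)
    also have "\<dots> = - real (Suc n) * (L2_norm \<Omega> (e n))\<^sup>2 - Re (ar u (e n))"
      by (simp add: ar_e e L2_inner_diag l_def algebra_simps)
    finally have "(R.S.qnorm (e n))\<^sup>2 + real (Suc n) * (L2_norm \<Omega> (e n))\<^sup>2 = - Re (ar u (e n))"
      by (simp add: algebra_simps)
    also have "\<dots> \<le> norm (ar u (e n))" using abs_Re_le_cmod[of "ar u (e n)"] by simp
    also have "\<dots> \<le> C0 * R.S.qnorm (e n)" unfolding C0_def by (rule R.form_bound[OF uv(1) e])
    finally show ?thesis .
  qed
  have e_bound: "R.S.qnorm (e n) \<le> C0" for n
  proof (cases "R.S.qnorm (e n) = 0")
    case False
    then have pos: "0 < R.S.qnorm (e n)" using e by (simp add: less_le)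
    have "0 \<le> real (Suc n) * (L2_norm \<Omega> (e n))\<^sup>2" by simp
    then have "R.S.qnorm (e n) * R.S.qnorm (e n) \<le> C0 * R.S.qnorm (e n)"
      using main[of n] unfolding power2_eq_square[of "R.S.qnorm (e n)"] by linarith
    then show ?thesis using pos by (rule mult_right_le_imp_le)
  qed (use C0 in simp)
  have e_le: "L2_norm \<Omega> (e n) \<le> C0 * sqrt (1 / real (Suc n))" for n
  proof -
    have "real (Suc n) * (L2_norm \<Omega> (e n))\<^sup>2 \<le> C0 * C0"
      using main[of n] mult_left_mono[OF e_bound[of n] C0] zero_le_power2[of "R.S.qnorm (e n)"] by linarith
    then have "(L2_norm \<Omega> (e n))\<^sup>2 \<le> C0\<^sup>2 * (1 / real (Suc n))" by (simp add: field_simps power2_eq_square)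
    then have "L2_norm \<Omega> (e n) \<le> sqrt (C0\<^sup>2 * (1 / real (Suc n)))" by (rule real_le_rsqrt)
    then show ?thesis using C0 by (simp only: real_sqrt_mult real_sqrt_abs abs_of_nonneg)
  qed
  have "(\<lambda>n. C0 * sqrt (1 / real (Suc n))) \<longlonglongrightarrow> C0 * sqrt 0"
    by (intro tendsto_intros LIMSEQ_Suc[OF lim_1_over_n])
  then have "(\<lambda>n. C0 * sqrt (1 / real (Suc n))) \<longlonglongrightarrow> 0" by simp
  from tendsto_sandwich[OF always_eventually[OF allI[OF L2_norm_nonneg]] always_eventually[OF allI[OF e_le]] tendsto_const this]
  have e_null: "(\<lambda>n. L2_norm \<Omega> (e n)) \<longlonglongrightarrow> 0" .
  have uv0: "L2_inner \<Omega> u v = 0"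
  proof -
    have "AE x in lebesgue_on \<Omega>. u x * cnj (v x) = 0"
      using supp by eventually_elim (use assms(15) in auto)
    then show ?thesis unfolding L2_inner_def by (rule integral_eq_zero_AE)
  qed
  \<comment> \<open>The bound \<open>xv\<close> carries a factor \<open>1 / l n\<close>, so two
    powers of \<open>l n\<close> leave one against the exponential.\<close>
  have "(\<lambda>n. (of_real (l n))\<^sup>2 * L2_inner \<Omega> (x n) v) \<longlonglongrightarrow> 0"
  proof (rule Lim_null_comparison[OF always_eventually[OF allI]])
    show "norm ((of_real (l n))\<^sup>2 * L2_inner \<Omega> (x n) v) \<le> C * (l n * exp (- \<kappa> * sqrt (l n)))" for n
      using mult_left_mono[OF xv[of n], of "(l n)\<^sup>2"] l[of n]
      by (simp add: norm_mult norm_power power2_eq_square mult_ac)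
    show "(\<lambda>n. C * (l n * exp (- \<kappa> * sqrt (l n)))) \<longlonglongrightarrow> 0"
      by (rule tendsto_mult_right_zero[OF mult_exp_sqrt_tendsto_0[OF \<kappa> l_top]])
  qed
  then have "(\<lambda>n. - ((of_real (l n))\<^sup>2 * L2_inner \<Omega> (x n) v) - ar u v) \<longlonglongrightarrow> - 0 - ar u v"
    by (intro tendsto_intros)
  \<comment> \<open>Orthogonality of \<open>u\<close> and \<open>v\<close> removes the term of first
    order in \<open>l n\<close>; besides \<open>- ar u v\<close> only the exponentially small one is
    left.\<close>
  moreover have "ar (e n) v = - ((of_real (l n))\<^sup>2 * L2_inner \<Omega> (x n) v) - ar u v" for n
  proof -
    have "L2_inner \<Omega> (e n) v = of_real (l n) * L2_inner \<Omega> (x n) v - L2_inner \<Omega> u v"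
      unfolding e_def by (simp add: L2.diff_left L2.scale_left L2_scale R.D_L2 xD uv)
    then show ?thesis using ar_e[OF uv(2), of n] by (simp add: uv0 power2_eq_square)
  qed
  ultimately have "(\<lambda>n. ar (e n) v) \<longlonglongrightarrow> - ar u v" by simp
  from R.bounded_null_limit[OF uv(2) e e_bound e_null this] show ?thesis by simp
qed

end
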